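(* The decision version of VEST is $\mathsf{W}[1]$-hard when parameterized by $k$, even when all matrices $T_i$ are $2\times 2$ integer matrices and $S$ is the identity matrix.
   Context: An instance of VEST consists of positive integers $d,m,h$, a vector $\mathbf{v}\in\mathbb{Q}^d$, a list $(T_1,\dots,T_m)$ of rational $d\times d$ matrices, and $S\in\mathbb{Q}^{h\times d}$; for $k\in\mathbb{N}$, $M_k := |\{(i_1,\dots,i_k)\in\{1,\dots,m\}^k : S T_{i_k}\cdots T_{i_1}\mathbf{v}=\mathbf{0}\}|$. The decision version of VEST asks, given such an instance and $k$, whether $M_k>0$. *)

theory Defs
  imports "Jordan_Normal_Form.Matrix"
begin

section \<open>Model of computation\<close>

text \<open>
  Time is measured in the WHILE language over binary trees (N. D. Jones, Computability and
  Complexity from a Programming Perspective, 1997).  A program has finitely many variables, each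
  holding a tree, and every step performs one tree constructor or destructor operation.  Instead of
  Jones's unit cost we charge an assignment the size of the tree it writes.  Hence the total size
  of the store never exceeds input size plus elapsed time (plus a constant depending on the
  program), so this measure and the running time of multitape Turing machines are polynomially
  related, without any appeal to sharing of subtrees.
\<close>

datatype data = Atom | Pair data data

primrec dsize :: "data \<Rightarrow> nat" where
  "dsize Atom = 1"
| "dsize (Pair x y) = Suc (dsize x + dsize y)"

fun dhd :: "data \<Rightarrow> data" where
  "dhd Atom = Atom"
| "dhd (Pair x y) = x"

fun dtl :: "data \<Rightarrow> data" where
  "dtl Atom = Atom"
| "dtl (Pair x y) = y"

datatype expr = ENil | EVar nat | ECons nat nat | EHd nat | ETl nat

type_synonym store = "nat \<Rightarrow> data"

primrec eval_expr :: "store \<Rightarrow> expr \<Rightarrow> data" where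
  "eval_expr s ENil = Atom"
| "eval_expr s (EVar x) = s x"
| "eval_expr s (ECons x y) = Pair (s x) (s y)"
| "eval_expr s (EHd x) = dhd (s x)"
| "eval_expr s (ETl x) = dtl (s x)"

datatype prog =
    Skip
  | Assign nat expr
  | Seq prog prog
  | If nat prog prog
  | While nat prog

text \<open>\<open>exec c s t s'\<close>: program \<open>c\<close> started in store \<open>s\<close> halts after time \<open>t\<close> in store \<open>s'\<close>.
  A variable counts as true iff its value is not \<open>Atom\<close>.\<close>

inductive exec :: "prog \<Rightarrow> store \<Rightarrow> nat \<Rightarrow> store \<Rightarrow> bool" where
  exec_Skip: "exec Skip s 1 s"
| exec_Assign: "exec (Assign x e) s (Suc (dsize (eval_expr s e))) (s(x := eval_expr s e))"
| exec_Seq: "exec c s t s' \<Longrightarrow> exec c' s' t' s'' \<Longrightarrow> exec (Seq c c') s (t + t') s''"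
| exec_IfT: "s x \<noteq> Atom \<Longrightarrow> exec c s t s' \<Longrightarrow> exec (If x c c') s (Suc t) s'"
| exec_IfF: "s x = Atom \<Longrightarrow> exec c' s t s' \<Longrightarrow> exec (If x c c') s (Suc t) s'"
| exec_WhileT: "s x \<noteq> Atom \<Longrightarrow> exec c s t s' \<Longrightarrow> exec (While x c) s' t' s''
    \<Longrightarrow> exec (While x c) s (Suc (t + t')) s''"
| exec_WhileF: "s x = Atom \<Longrightarrow> exec (While x c) s 1 s"

text \<open>Input and output are in variable 0; the other variables are initialised with \<open>Atom\<close>.\<close>

definition runs :: "prog \<Rightarrow> data \<Rightarrow> nat \<Rightarrow> data \<Rightarrow> bool" where
  "runs c x t y \<longleftrightarrow> (\<exists>s. exec c ((\<lambda>_. Atom)(0 := x)) t s \<and> s 0 = y)"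


section \<open>Encodings\<close>

primrec enc_list :: "data list \<Rightarrow> data" where
  "enc_list [] = Atom"
| "enc_list (x # xs) = Pair x (enc_list xs)"

definition enc_bool :: "bool \<Rightarrow> data" where
  "enc_bool b = (if b then Pair Atom Atom else Atom)"

definition enc_unary :: "nat \<Rightarrow> data" where
  "enc_unary n = enc_list (replicate n Atom)"

text \<open>Binary expansion, least significant bit first.\<close>

fun bits :: "nat \<Rightarrow> bool list" where
  "bits n = (if n = 0 then [] else odd n # bits (n div 2))"

declare bits.simps [simp del]

definition enc_binary :: "nat \<Rightarrow> data" where
  "enc_binary n = enc_list (map enc_bool (bits n))"

definition enc_int :: "int \<Rightarrow> data" where
  "enc_int z = Pair (enc_bool (z < 0)) (enc_binary (nat \<bar>z\<bar>))"

text \<open>Numerator and denominator of the reduced fraction, both in binary.\<close>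

definition enc_rat :: "rat \<Rightarrow> data" where
  "enc_rat q = Pair (enc_int (fst (quotient_of q))) (enc_int (snd (quotient_of q)))"

definition enc_vec :: "rat vec \<Rightarrow> data" where
  "enc_vec v = enc_list (map enc_rat (list_of_vec v))"

definition enc_mat :: "rat mat \<Rightarrow> data" where
  "enc_mat A = enc_list (map enc_vec (rows A))"


section \<open>Parameterized problems and reductions\<close>

type_synonym param_problem = "(data \<times> nat) set"

definition computable :: "(nat \<Rightarrow> nat) \<Rightarrow> bool" where
  "computable f \<longleftrightarrow> (\<exists>c. \<forall>n. \<exists>t. runs c (enc_unary n) t (enc_unary (f n)))"

text \<open>Parameterized (fpt many-one) reduction from \<open>A\<close> to \<open>B\<close>, all of whose outputs lie
  in \<open>Q\<close>; for \<open>Q = UNIV\<close> this is the usual notion.\<close>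

definition fpt_reducible_within ::
    "param_problem \<Rightarrow> param_problem \<Rightarrow> param_problem \<Rightarrow> bool" where
  "fpt_reducible_within Q A B \<longleftrightarrow>
     (\<exists>c f g e. computable f \<and> computable g \<and>
       (\<forall>x k. \<exists>x' k' t.
          runs c (Pair x (enc_unary k)) t (Pair x' (enc_unary k')) \<and>
          t \<le> f k * dsize x ^ e \<and>
          k' \<le> g k \<and>
          ((x, k) \<in> A \<longleftrightarrow> (x', k') \<in> B) \<and>
          (x', k') \<in> Q))"

definition fpt_reducible :: "param_problem \<Rightarrow> param_problem \<Rightarrow> bool" where
  "fpt_reducible A B \<longleftrightarrow> fpt_reducible_within UNIV A B"


section \<open>Weighted circuit satisfiability and the W-hierarchy\<close>

text \<open>A circuit is the list of its gates in topological order.  A gate refers to its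
  predecessors by their positions in the list; the last gate is the output.\<close>

datatype gate = In | Not nat | And "nat list" | Or "nat list"

type_synonym circuit = "gate list"

primrec preds :: "gate \<Rightarrow> nat list" where
  "preds In = []"
| "preds (Not j) = [j]"
| "preds (And js) = js"
| "preds (Or js) = js"

definition wf_circuit :: "circuit \<Rightarrow> bool" where
  "wf_circuit C \<longleftrightarrow> C \<noteq> [] \<and>
     (\<forall>i < length C. \<forall>j \<in> set (preds (C ! i)). j < i) \<and>
     (\<forall>js. And js \<in> set C \<or> Or js \<in> set C \<longrightarrow> 2 \<le> length js)"

text \<open>Value of the output gate, where the value of each gate is computed from the list of the
  values of all earlier gates.\<close>

definition eval_circuit :: "('a list \<Rightarrow> gate \<Rightarrow> 'a) \<Rightarrow> circuit \<Rightarrow> 'a" where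
  "eval_circuit step C = last (foldl (\<lambda>vs g. vs @ [step vs g]) [] C)"

text \<open>An assignment is given by the set \<open>X\<close> of (positions of) input gates set to true.\<close>

primrec gate_value :: "nat set \<Rightarrow> bool list \<Rightarrow> gate \<Rightarrow> bool" where
  "gate_value X vs In = (length vs \<in> X)"
| "gate_value X vs (Not j) = (\<not> vs ! j)"
| "gate_value X vs (And js) = (\<forall>j \<in> set js. vs ! j)"
| "gate_value X vs (Or js) = (\<exists>j \<in> set js. vs ! j)"

text \<open>Maximum number of edges on a path from an input gate to the given gate.\<close>

primrec gate_depth :: "nat list \<Rightarrow> gate \<Rightarrow> nat" where
  "gate_depth ds In = 0"
| "gate_depth ds (Not j) = Suc (ds ! j)"
| "gate_depth ds (And js) = Suc (Max ((!) ds ` set js))"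
| "gate_depth ds (Or js) = Suc (Max ((!) ds ` set js))"

text \<open>Maximum number of large gates (those of fan-in greater than 2) on such a path.\<close>

primrec gate_weft :: "nat list \<Rightarrow> gate \<Rightarrow> nat" where
  "gate_weft ws In = 0"
| "gate_weft ws (Not j) = ws ! j"
| "gate_weft ws (And js) = Max ((!) ws ` set js) + (if length js > 2 then 1 else 0)"
| "gate_weft ws (Or js) = Max ((!) ws ` set js) + (if length js > 2 then 1 else 0)"

definition inputs :: "circuit \<Rightarrow> nat set" where
  "inputs C = {i. i < length C \<and> C ! i = In}"

text \<open>Gate positions may be written in unary, as they are bounded by the number of gates.\<close>

primrec enc_gate :: "gate \<Rightarrow> data" where
  "enc_gate In = Pair (enc_unary 0) Atom"
| "enc_gate (Not j) = Pair (enc_unary 1) (enc_unary j)"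
| "enc_gate (And js) = Pair (enc_unary 2) (enc_list (map enc_unary js))"
| "enc_gate (Or js) = Pair (enc_unary 3) (enc_list (map enc_unary js))"

definition enc_circuit :: "circuit \<Rightarrow> data" where
  "enc_circuit C = enc_list (map enc_gate C)"

text \<open>Does a circuit of weft at most \<open>w\<close> and depth at most \<open>d\<close> have a satisfying assignment
  of weight exactly \<open>k\<close>?\<close>

definition WCS :: "nat \<Rightarrow> nat \<Rightarrow> param_problem" where
  "WCS w d = {(enc_circuit C, k) | C k.
     wf_circuit C \<and> eval_circuit gate_weft C \<le> w \<and> eval_circuit gate_depth C \<le> d \<and>
     (\<exists>X \<subseteq> inputs C. card X = k \<and> eval_circuit (gate_value X) C)}"

definition W :: "nat \<Rightarrow> param_problem set" where
  "W w = {A. \<exists>d \<ge> 1. fpt_reducible A (WCS w d)}"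

definition W1_hard :: "param_problem \<Rightarrow> bool" where
  "W1_hard P \<longleftrightarrow> (\<forall>A \<in> W 1. fpt_reducible A P)"

text \<open>\<open>P\<close> is W[1]-hard even when restricted to the instances in \<open>Q\<close>: the reductions produce
  only instances in \<open>Q\<close>, for yes- and no-instances alike.\<close>

definition W1_hard_on :: "param_problem \<Rightarrow> param_problem \<Rightarrow> bool" where
  "W1_hard_on Q P \<longleftrightarrow> (\<forall>A \<in> W 1. fpt_reducible_within Q A P)"


section \<open>VEST\<close>

definition vest_instance ::
    "nat \<Rightarrow> nat \<Rightarrow> nat \<Rightarrow> rat vec \<Rightarrow> rat mat list \<Rightarrow> rat mat \<Rightarrow> bool" where
  "vest_instance d m h v Ts S \<longleftrightarrow> d > 0 \<and> m > 0 \<and> h > 0 \<and>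
     v \<in> carrier_vec d \<and> length Ts = m \<and> set Ts \<subseteq> carrier_mat d d \<and> S \<in> carrier_mat h d"

text \<open>The matrix at the head of the index list is applied first; matrices are numbered from 0.\<close>

definition apply_mats :: "rat mat list \<Rightarrow> nat list \<Rightarrow> rat vec \<Rightarrow> rat vec" where
  "apply_mats Ts is v = foldl (\<lambda>w i. (Ts ! i) *\<^sub>v w) v is"

definition vest_count :: "rat vec \<Rightarrow> rat mat list \<Rightarrow> rat mat \<Rightarrow> nat \<Rightarrow> nat" where
  "vest_count v Ts S k =
     card {is. length is = k \<and> set is \<subseteq> {..<length Ts} \<and>
               S *\<^sub>v apply_mats Ts is v = 0\<^sub>v (dim_row S)}"

text \<open>The numbers \<open>d\<close>, \<open>m\<close> and \<open>h\<close> are determined by \<open>v\<close>, \<open>Ts\<close> and \<open>S\<close>, hence not encoded.\<close>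

definition enc_vest :: "rat vec \<Rightarrow> rat mat list \<Rightarrow> rat mat \<Rightarrow> data" where
  "enc_vest v Ts S = Pair (enc_vec v) (Pair (enc_list (map enc_mat Ts)) (enc_mat S))"

definition VEST_decision :: param_problem where
  "VEST_decision = {(enc_vest v Ts S, k) | d m h v Ts S k.
     vest_instance d m h v Ts S \<and> vest_count v Ts S k > 0}"

definition VEST_2x2_int_id :: param_problem where
  "VEST_2x2_int_id = {(enc_vest v Ts (1\<^sub>m 2), k) | m v Ts k.
     vest_instance 2 m 2 v Ts (1\<^sub>m 2) \<and> (\<forall>T \<in> set Ts. elements_mat T \<subseteq> \<int>)}"

end

theory Submission
  imports Defs
begin

text \<open>
  Weighted satisfiability of circuits of weft 1 and depth \<open>d\<close> is reduced directly to VEST.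

  A gate of weft 0 and bounded depth is a difference of two sums of boundedly many monomials in the
  inputs.  Hence a large gate compares two such sums, with polynomially many possible values, and the
  circuit is satisfied by \<open>X\<close> iff \<open>X\<close> satisfies one of polynomially many certificates, each of which
  prescribes for boundedly many lists of monomials how many of them are true under \<open>X\<close>.
  For \<open>X = {x\<^sub>1, \<dots>, x\<^sub>k}\<close> this number is a sum over the tuples of elements of \<open>X\<close> of bounded length.
  So one chooses the elements \<open>x\<^sub>a\<close> and, for each tuple of indices, a tuple of inputs, each choice being
  a vector of natural numbers; agreement of the choices and the constraints of the certificate become the
  condition that the chosen vectors have a prescribed sum.  The vectors are turned into integers \<open>z\<close>
  by reading them as digits in a base too large for carries.  Finally the matrices
  \<open>((1, z), (0, 1))\<close> add the chosen integers to the first coordinate of a vector \<open>(a, 1)\<close>, and a projection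
  annihilating the second coordinate tests whether the sum is zero.

  The length of the tuples depends on \<open>d\<close> only, so the reduction runs in time polynomial in the size of
  the circuit and \<open>k\<close>, and the new parameter is polynomial in \<open>k\<close>.
\<close>


section \<open>Polynomially bounded functions on naturals\<close>

text \<open>\<open>W 1\<close> collects circuits of every depth bound, and no normal form of weft 1
  circuits is at hand; the proof exploits instead that the depth bound is a constant, so that
  recursion over it and exponents depending on it stay polynomial. Certificates prescribe exact
  counts because the zero test of a sum expresses equalities only: the inequalities needed by large
  gates are resolved by listing all possible values beforehand. Truth and falsity are certified
  alike, so that negation is a swap. The zero test would also accept repeated vectors, mixtures of
  certificates and accidental cancellation. Hence a certificate has a single negative vector, which
  states the demand, while all other vectors are nonnegative. One coordinate forces exactly one
  negative vector, and its zeros exclude the vectors of other certificates. Numbers are unary in the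
  polynomial-time layer, which suffices for entries and digit widths. The packed integers are
  exponentially large, so only their bits are ever computed.\<close>

inductive pb :: "(nat \<Rightarrow> nat) \<Rightarrow> bool" where
  pb_id: "pb (\<lambda>n. n)"
| pb_const: "pb (\<lambda>n. c)"
| pb_add: "pb f \<Longrightarrow> pb g \<Longrightarrow> pb (\<lambda>n. f n + g n)"
| pb_mult: "pb f \<Longrightarrow> pb g \<Longrightarrow> pb (\<lambda>n. f n * g n)"

lemma pb_Suc: "pb f \<Longrightarrow> pb (\<lambda>n. Suc (f n))"
  using pb_add[OF _ pb_const[of 1]] by simp

lemma pb_comp: "pb f \<Longrightarrow> pb g \<Longrightarrow> pb (\<lambda>n. f (g n))"
  by (induction rule: pb.induct) (auto intro: pb.intros)

lemma pb_power: "pb f \<Longrightarrow> pb (\<lambda>n. f n ^ e)"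
  by (induction e) (auto intro: pb.intros)

lemmas pb_intros = pb_id pb_const pb_add pb_mult pb_Suc pb_power

text \<open>Built without subtraction, these functions are monotone; so a size bound for an
  intermediate value may be substituted into the time bound of the next program.\<close>

lemma pb_mono: "pb f \<Longrightarrow> m \<le> n \<Longrightarrow> f m \<le> f n"
  by (induction rule: pb.induct) (auto intro: add_mono mult_mono)

lemma pb_bound: "pb f \<Longrightarrow> \<exists>c e. \<forall>n. f n \<le> c * (n + 1) ^ e"
proof (induction rule: pb.induct)
  case pb_id
  show ?case by (rule exI[of _ 1], rule exI[of _ 1]) simp
next
  case (pb_const c)
  show ?case by (rule exI[of _ c], rule exI[of _ 0]) simp
next
  case (pb_add f g)
  then obtain c e c' e' where f: "\<And>n. f n \<le> c * (n + 1) ^ e" and g: "\<And>n. g n \<le> c' * (n + 1) ^ e'"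
    by blast
  have "f n + g n \<le> (c + c') * (n + 1) ^ (e + e')" for n
  proof -
    have "(n + 1) ^ e \<le> (n + 1) ^ (e + e')" "(n + 1) ^ e' \<le> (n + 1) ^ (e + e')"
      by (rule power_increasing; simp)+
    then show ?thesis
      using f[of n] g[of n] by (smt (verit) add_mono distrib_right le_trans mult_le_mono2)
  qed
  then show ?case by blast
next
  case (pb_mult f g)
  then obtain c e c' e' where f: "\<And>n. f n \<le> c * (n + 1) ^ e" and g: "\<And>n. g n \<le> c' * (n + 1) ^ e'"
    by blast
  have "f n * g n \<le> (c * c') * (n + 1) ^ (e + e')" for n
    using mult_le_mono[OF f[of n] g[of n]] by (simp add: power_add ac_simps)
  then show ?case by blast
qed


section \<open>Encodable types\<close>

text \<open>Injectivity is what allows equality of values to be tested on their trees. Numbers will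
  be encoded in unary, so polynomial time means polynomial in their value.\<close>

class encodable =
  fixes encode :: "'a \<Rightarrow> data"
  assumes inj_encode: "inj encode"

lemma encode_eq_iff [simp]: "encode x = encode y \<longleftrightarrow> x = y"
  using inj_encode by (auto dest: injD)

instantiation data :: encodable
begin
definition encode_data :: "data \<Rightarrow> data" where "encode_data d = d"
instance by standard (simp add: encode_data_def inj_def)
end

declare encode_data_def [simp]

instantiation bool :: encodable
begin
definition encode_bool :: "bool \<Rightarrow> data" where "encode_bool = enc_bool"
instance by standard (auto simp: encode_bool_def enc_bool_def inj_def)
end

lemma encode_bool [simp]: "encode True = Pair Atom Atom" "encode False = Atom"
  by (simp_all add: encode_bool_def enc_bool_def)

instantiation prod :: (encodable, encodable) encodable
begin
definition encode_prod :: "'a \<times> 'b \<Rightarrow> data" where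
  "encode_prod p = Pair (encode (fst p)) (encode (snd p))"
instance by standard (auto simp: encode_prod_def inj_def)
end

lemma encode_prod [simp]: "encode (x, y) = Pair (encode x) (encode y)"
  by (simp add: encode_prod_def)

lemma enc_list_inject [simp]: "enc_list xs = enc_list ys \<longleftrightarrow> xs = ys"
proof (induction xs arbitrary: ys)
  case Nil
  show ?case by (cases ys) auto
next
  case (Cons x xs)
  then show ?case by (cases ys) auto
qed

instantiation list :: (encodable) encodable
begin
definition encode_list :: "'a list \<Rightarrow> data" where "encode_list xs = enc_list (map encode xs)"
instance by standard (auto simp: encode_list_def inj_def inj_map_eq_map[OF inj_encode])
end

lemma encode_list [simp]: "encode [] = Atom" "encode (x # xs) = Pair (encode x) (encode xs)"
  by (simp_all add: encode_list_def)

lemma enc_unary_simps [simp]: "enc_unary 0 = Atom" "enc_unary (Suc n) = Pair Atom (enc_unary n)"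
  by (simp_all add: enc_unary_def)

instantiation nat :: encodable
begin
definition encode_nat :: "nat \<Rightarrow> data" where "encode_nat = enc_unary"
instance by standard (auto simp: encode_nat_def enc_unary_def inj_def)
end

lemma encode_nat [simp]: "encode (0::nat) = Atom" "encode (Suc n) = Pair Atom (encode n)"
  by (simp_all add: encode_nat_def)

lemma dsize_pos [simp]: "0 < dsize d"
  by (cases d) auto

lemma dsize_neq_0 [simp]: "dsize d \<noteq> 0"
  by (cases d) auto

lemma dsize_dhd: "dsize (dhd d) \<le> dsize d" and dsize_dtl: "dsize (dtl d) \<le> dsize d"
  by (cases d; simp)+

lemma dsize_encode_list: "dsize (encode xs) = Suc (\<Sum>x\<leftarrow>xs. Suc (dsize (encode x)))"
  by (induction xs) auto

lemma dsize_encode_nat [simp]: "dsize (encode (n::nat)) = 2 * n + 1"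
  by (induction n) auto


section \<open>Polynomial-time functions\<close>

text \<open>Programs are used as families indexed by a base register: \<open>P m\<close> overwrites register \<open>m\<close>,
  keeps the registers below it, and finds and leaves those above it empty.  This stack discipline
  makes programs composable without renaming variables.  Nothing is required of inputs that do not
  encode an element of \<open>'a\<close>.\<close>

definition implements :: "(nat \<Rightarrow> prog) \<Rightarrow> (nat \<Rightarrow> nat) \<Rightarrow> ('a::encodable \<Rightarrow> 'b::encodable) \<Rightarrow> bool" where
  "implements P p f \<longleftrightarrow> (\<forall>m s x. (\<forall>i>m. s i = Atom) \<longrightarrow> s m = encode x \<longrightarrow>
     (\<exists>t \<le> p (dsize (encode x)). exec (P m) s t (s(m := encode (f x)))))"

definition polytime :: "('a::encodable \<Rightarrow> 'b::encodable) \<Rightarrow> bool" where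
  "polytime f \<longleftrightarrow> (\<exists>P p. pb p \<and> implements P p f)"

lemma implementsD:
  assumes "implements P p f" "\<forall>i>m. s i = Atom" "s m = encode x"
  obtains t where "t \<le> p (dsize (encode x))" "exec (P m) s t (s(m := encode (f x)))"
  using assms unfolding implements_def by blast

lemma polytimeE:
  assumes "polytime f"
  obtains P p where "pb p" "implements P p f"
  using assms unfolding polytime_def by blast

lemma polytimeI: "implements P p f \<Longrightarrow> pb p \<Longrightarrow> polytime f"
  unfolding polytime_def by blast

lemma exec_AssignI: "t = Suc (dsize (eval_expr s e)) \<Longrightarrow> s' = s(x := eval_expr s e) \<Longrightarrow>
    exec (Assign x e) s t s'"
  using exec_Assign by simp

text \<open>An assignment is charged the size of the tree it writes, so a value created during the
  run is no larger than the elapsed time. Time bounds therefore imply bounds on the output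
  size.\<close>

lemma exec_dsize: "exec c s t s' \<Longrightarrow> dsize (s' x) \<le> max (dsize (s x)) t"
  by (induction rule: exec.induct) auto

lemma polytime_dsize:
  assumes "polytime f"
  obtains q where "pb q" "\<And>x. dsize (encode (f x)) \<le> q (dsize (encode x))"
proof -
  obtain P p where p: "pb p" "implements P p f" using assms by (rule polytimeE)
  have "dsize (encode (f x)) \<le> dsize (encode x) + p (dsize (encode x))" for x
  proof -
    let ?s = "(\<lambda>_. Atom)(0 := encode x)"
    obtain t where t: "t \<le> p (dsize (encode x))" "exec (P 0) ?s t (?s(0 := encode (f x)))"
      using p(2) by (rule implementsD[where m = 0 and s = ?s]) auto
    show ?thesis using exec_dsize[OF t(2), of 0] t(1) by auto
  qed
  then show ?thesis using that[of "\<lambda>n. n + p n"] pb_add[OF pb_id p(1)] by blast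
qed

lemma polytime_expr:
  fixes f :: "'a::encodable \<Rightarrow> 'b::encodable"
  assumes "\<And>m s x. s m = encode x \<Longrightarrow> eval_expr s (e m) = encode (f x)"
    and "\<And>x. dsize (encode (f x)) \<le> dsize (encode x)"
  shows "polytime f"
proof (rule polytimeI)
  show "implements (\<lambda>m. Assign m (e m)) (\<lambda>n. Suc n) f"
    unfolding implements_def
  proof (intro allI impI exI conjI)
    fix m :: nat and s :: store and x :: 'a
    assume "s m = encode x"
    then show "exec (Assign m (e m)) s (Suc (dsize (encode (f x)))) (s(m := encode (f x)))"
      by (intro exec_AssignI) (simp_all add: assms)
    show "Suc (dsize (encode (f x))) \<le> Suc (dsize (encode x))" using assms(2) by simp
  qed
qed (intro pb_intros)

lemma polytime_coerce: "(\<And>x. encode (f x) = encode x) \<Longrightarrow> polytime f"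
  by (rule polytime_expr[where e = EVar]) auto

lemma polytime_id: "polytime (\<lambda>x. x)"
  by (rule polytime_coerce) simp

lemma polytime_Atom: "polytime (\<lambda>x. Atom)"
  by (rule polytime_expr[where e = "\<lambda>_. ENil"]) (auto simp: Suc_le_eq)

lemma polytime_comp:
  fixes f :: "'b::encodable \<Rightarrow> 'c::encodable" and g :: "'a::encodable \<Rightarrow> 'b"
  assumes F: "polytime f" and G: "polytime g"
  shows "polytime (\<lambda>x. f (g x))"
proof -
  obtain P p where p: "pb p" "implements P p f" using F by (rule polytimeE)
  obtain Q q where q: "pb q" "implements Q q g" using G by (rule polytimeE)
  obtain r where r: "pb r" "\<And>x. dsize (encode (g x)) \<le> r (dsize (encode x))"
    using polytime_dsize[OF G] by blast
  have "implements (\<lambda>m. Seq (Q m) (P m)) (\<lambda>n. q n + p (r n)) (\<lambda>x. f (g x))"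
    unfolding implements_def
  proof (intro allI impI)
    fix m :: nat and s :: store and x :: 'a
    assume s: "\<forall>i>m. s i = Atom" "s m = encode x"
    obtain t where t: "t \<le> q (dsize (encode x))" "exec (Q m) s t (s(m := encode (g x)))"
      using implementsD[OF q(2) s] by blast
    let ?s = "s(m := encode (g x))"
    obtain u where u: "u \<le> p (dsize (encode (g x)))" "exec (P m) ?s u (?s(m := encode (f (g x))))"
      using implementsD[OF p(2), of m ?s] s by auto
    have "u \<le> p (r (dsize (encode x)))"
      using u(1) pb_mono[OF p(1) r(2)[of x]] by simp
    then show "\<exists>t\<le>q (dsize (encode x)) + p (r (dsize (encode x))).
        exec (Seq (Q m) (P m)) s t (s(m := encode (f (g x))))"
      using exec_Seq[OF t(2) u(2)] t(1) by (intro exI[of _ "t + u"]) simp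
  qed
  then show ?thesis by (rule polytimeI) (intro pb_intros p(1) q(1) pb_comp[OF p(1) r(1)])
qed

lemma polytime_Pair:
  fixes f :: "'a::encodable \<Rightarrow> 'b::encodable" and g :: "'a \<Rightarrow> 'c::encodable"
  assumes F: "polytime f" and G: "polytime g"
  shows "polytime (\<lambda>x. (f x, g x))"
proof -
  obtain P p where p: "pb p" "implements P p f" using F by (rule polytimeE)
  obtain Q q where q: "pb q" "implements Q q g" using G by (rule polytimeE)
  obtain r where r: "pb r" "\<And>x. dsize (encode (f x)) \<le> r (dsize (encode x))"
    using polytime_dsize[OF F] by blast
  obtain r' where r': "pb r'" "\<And>x. dsize (encode (g x)) \<le> r' (dsize (encode x))"
    using polytime_dsize[OF G] by blast
  \<comment> \<open>The input stays in register \<open>m\<close> while both results are built above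
    it; the two upper registers are emptied at the end to restore the stack discipline.\<close>
  let ?P = "\<lambda>m::nat. Seq (Assign (m+1) (EVar m)) (Seq (P (m+1)) (Seq (Assign (m+2) (EVar m)) (Seq (Q (m+2))
    (Seq (Assign m (ECons (m+1) (m+2))) (Seq (Assign (m+1) ENil) (Assign (m+2) ENil))))))"
  have "implements ?P (\<lambda>n. 8 + 2 * n + p n + q n + r n + r' n) (\<lambda>x. (f x, g x))"
    unfolding implements_def
  proof (intro allI impI)
    fix m :: nat and s :: store and x :: 'a
    assume s: "\<forall>i>m. s i = Atom" "s m = encode x"
    let ?s1 = "s(m+1 := encode x)" and ?n = "dsize (encode x)"
    obtain t where t: "t \<le> p ?n" "exec (P (m+1)) ?s1 t (?s1(m+1 := encode (f x)))"
      using implementsD[OF p(2), of "m+1" ?s1] s by auto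
    let ?s2 = "?s1(m+1 := encode (f x), m+2 := encode x)"
    obtain u where u: "u \<le> q ?n" "exec (Q (m+2)) ?s2 u (?s2(m+2 := encode (g x)))"
      using implementsD[OF q(2), of "m+2" ?s2] s by auto
    let ?s3 = "?s2(m+2 := encode (g x), m := encode (f x, g x))"
    have "exec (?P m) s (Suc ?n + (t + (Suc ?n + (u + (Suc (dsize (encode (f x, g x))) + (2 + 2))))))
      (?s3(m+1 := Atom, m+2 := Atom))"
      by (rule exec_Seq[OF exec_AssignI exec_Seq[OF t(2) exec_Seq[OF exec_AssignI exec_Seq[OF u(2)
        exec_Seq[where s' = ?s3, OF exec_AssignI
        exec_Seq[where s' = "?s3(m+1 := Atom)", OF exec_AssignI exec_AssignI]]]]]]) (auto simp: s)
    moreover have "?s3(m+1 := Atom, m+2 := Atom) = s(m := encode (f x, g x))"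
      using s by (auto simp: fun_eq_iff)
    moreover have "Suc ?n + (t + (Suc ?n + (u + (Suc (dsize (encode (f x, g x))) + (2 + 2)))))
      \<le> 8 + 2 * ?n + p ?n + q ?n + r ?n + r' ?n"
      using t(1) u(1) r(2)[of x] r'(2)[of x] by simp
    ultimately show "\<exists>t\<le>8 + 2 * ?n + p ?n + q ?n + r ?n + r' ?n.
       exec (?P m) s t (s(m := encode (f x, g x)))" by metis
  qed
  then show ?thesis
    by (rule polytimeI) (intro pb_intros p(1) q(1) r(1) r'(1))
qed

text \<open>The true branch receives the environment together with the decomposed scrutinee.\<close>

lemma polytime_branch:
  fixes c :: "'a::encodable \<Rightarrow> 'c::encodable" and f :: "'a \<times> 't::encodable \<Rightarrow> 'b::encodable"
  assumes C: "polytime c" and F: "polytime f" and G: "polytime g"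
    and h: "\<And>x. encode (c x) = Atom \<Longrightarrow> h x = g x"
      "\<And>x. encode (c x) \<noteq> Atom \<Longrightarrow> \<exists>y. encode (c x) = encode y \<and> h x = f (x, y)"
  shows "polytime h"
proof -
  obtain R r where r: "pb r" "implements R r c" using C by (rule polytimeE)
  obtain P p where p: "pb p" "implements P p f" using F by (rule polytimeE)
  obtain Q q where q: "pb q" "implements Q q g" using G by (rule polytimeE)
  obtain z where z: "pb z" "\<And>x. dsize (encode (c x)) \<le> z (dsize (encode x))"
    using polytime_dsize[OF C] by blast
  let ?T = "\<lambda>m::nat. Seq (Assign m (ECons m (m+1))) (Seq (Assign (m+1) ENil) (P m))"
  let ?P = "\<lambda>m::nat. Seq (Assign (m+1) (EVar m)) (Seq (R (m+1)) (If (m+1) (?T m) (Q m)))"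
  let ?p = "\<lambda>n. 9 + 2 * n + r n + p (1 + n + z n) + q n + z n"
  have "implements ?P ?p h"
    unfolding implements_def
  proof (intro allI impI)
    fix m :: nat and s :: store and x :: 'a
    assume s: "\<forall>i>m. s i = Atom" "s m = encode x"
    let ?s1 = "s(m+1 := encode x)" and ?n = "dsize (encode x)"
    obtain t where t: "t \<le> r ?n" "exec (R (m+1)) ?s1 t (?s1(m+1 := encode (c x)))"
      using implementsD[OF r(2), of "m+1" ?s1] s by auto
    let ?s2 = "?s1(m+1 := encode (c x))"
    have "\<exists>v \<le> 7 + p (1 + ?n + z ?n) + q ?n + ?n + z ?n. exec (If (m+1) (?T m) (Q m)) ?s2 v (s(m := encode (h x)))"
    proof (cases "encode (c x) = Atom")
      case True
      obtain w where w: "w \<le> q ?n" "exec (Q m) s w (s(m := encode (g x)))"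
        using implementsD[OF q(2) s] by blast
      have "?s2 = s" using s True by (auto simp: fun_eq_iff)
      then have "exec (If (m+1) (?T m) (Q m)) ?s2 (Suc w) (s(m := encode (h x)))"
        using w(2) True s h(1)[OF True] by (auto intro: exec_IfF)
      then show ?thesis using w(1) by (intro exI[of _ "Suc w"]) auto
    next
      case False
      obtain y where y: "encode (c x) = encode y" "h x = f (x, y)" using h(2)[OF False] by blast
      let ?s3 = "?s2(m := encode (x, y))"
      obtain u where u: "u \<le> p (dsize (encode (x, y)))"
        "exec (P m) (s(m := encode (x, y))) u (s(m := encode (h x)))"
        using implementsD[OF p(2), of m "s(m := encode (x, y))" "(x, y)"] s y(2) by auto
      have "exec (?T m) ?s2 (Suc (dsize (encode (x, y))) + (2 + u)) (s(m := encode (h x)))"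
        by (rule exec_Seq[where s' = ?s3, OF exec_AssignI exec_Seq[OF exec_AssignI u(2)]])
          (use s in \<open>auto simp: y(1) fun_eq_iff\<close>)
      then have e: "exec (If (m+1) (?T m) (Q m)) ?s2 (Suc (Suc (dsize (encode (x, y))) + (2 + u))) (s(m := encode (h x)))"
        using False by (intro exec_IfT) auto
      have d: "dsize (encode (x, y)) \<le> 1 + ?n + z ?n" using z(2)[of x] y(1) by simp
      then have "u \<le> p (1 + ?n + z ?n)" using u(1) pb_mono[OF p(1)] le_trans by blast
      then show ?thesis using d e
        by (intro exI[of _ "Suc (Suc (dsize (encode (x, y))) + (2 + u))"]) auto
    qed
    then obtain v where v: "v \<le> 7 + p (1 + ?n + z ?n) + q ?n + ?n + z ?n"
      "exec (If (m+1) (?T m) (Q m)) ?s2 v (s(m := encode (h x)))" by blast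
    have "exec (?P m) s (Suc ?n + (t + v)) (s(m := encode (h x)))"
      by (rule exec_Seq[OF exec_AssignI exec_Seq[OF t(2) v(2)]]) (auto simp: s)
    then show "\<exists>t\<le>?p ?n. exec (?P m) s t (s(m := encode (h x)))"
      using t(1) v(1) by (intro exI[of _ "Suc ?n + (t + v)"]) auto
  qed
  moreover have "pb ?p"
    by (intro pb_intros p(1) q(1) r(1) z(1) pb_comp[OF p(1)])
  ultimately show ?thesis by (rule polytimeI)
qed

text \<open>The loop test is the head of the state. A size bound on all iterates has to be assumed,
  since polynomially many iterations of a polynomial-time function can grow exponentially.\<close>

lemma polytime_while:
  fixes f :: "'a::encodable \<Rightarrow> 's::encodable" and g :: "'s \<Rightarrow> 's"
  assumes G: "polytime g" and a: "polytime a" and q: "pb q"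
    and f: "\<And>x. \<exists>n \<le> q (dsize (encode x)). f x = (g ^^ n) (a x) \<and>
      dhd (encode ((g ^^ n) (a x))) = Atom \<and> (\<forall>i<n. dhd (encode ((g ^^ i) (a x))) \<noteq> Atom) \<and>
      (\<forall>i\<le>n. dsize (encode ((g ^^ i) (a x))) \<le> q (dsize (encode x)))"
  shows "polytime f"
proof -
  obtain P p where p: "pb p" "implements P p g" using G by (rule polytimeE)
  \<comment> \<open>Register \<open>m+1\<close> holds the loop flag. It is emptied first, because
    \<open>P m\<close> expects empty registers above \<open>m\<close>, and is recomputed
    afterwards.\<close>
  let ?B = "\<lambda>m::nat. Seq (Assign (m+1) ENil) (Seq (P m) (Assign (m+1) (EHd m)))"
  let ?P = "\<lambda>m::nat. Seq (Assign (m+1) (EHd m)) (While (m+1) (?B m))"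
  let ?c = "\<lambda>b. 5 + b + p b"
  have loop: "\<exists>t \<le> 1 + n * ?c b. exec (While (m+1) (?B m)) (s(m := encode x, m+1 := dhd (encode x))) t
      (s(m := encode ((g ^^ n) x)))"
    if "\<forall>i>m. s i = Atom" "dhd (encode ((g ^^ n) x)) = Atom" "\<forall>i<n. dhd (encode ((g ^^ i) x)) \<noteq> Atom"
      "\<forall>i\<le>n. dsize (encode ((g ^^ i) x)) \<le> b" for n x m s b
    using that
  proof (induction n arbitrary: x)
    case 0
    have "s(m := encode x, m+1 := dhd (encode x)) = s(m := encode x)" using 0 by (auto simp: fun_eq_iff)
    moreover have "exec (While (m+1) (?B m)) (s(m := encode x)) 1 (s(m := encode x))"
      using 0 by (intro exec_WhileF) auto
    ultimately show ?case by (intro exI[of _ 1]) (simp only: funpow_0, simp)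
  next
    case (Suc n)
    let ?s = "s(m := encode x)"
    obtain t where t: "t \<le> p (dsize (encode x))" "exec (P m) ?s t (s(m := encode (g x)))"
      using implementsD[OF p(2), of m ?s] Suc.prems(1) by auto
    have g_Suc: "(g ^^ i) (g x) = (g ^^ Suc i) x" for i by (simp add: funpow_swap1)
    have "dhd (encode ((g ^^ n) (g x))) = Atom" "\<forall>i<n. dhd (encode ((g ^^ i) (g x))) \<noteq> Atom"
      "\<forall>i\<le>n. dsize (encode ((g ^^ i) (g x))) \<le> b"
      unfolding g_Suc using Suc.prems by auto
    from Suc.IH[OF Suc.prems(1) this] obtain u where u: "u \<le> 1 + n * ?c b"
      "exec (While (m+1) (?B m)) (s(m := encode (g x), m+1 := dhd (encode (g x)))) u
        (s(m := encode ((g ^^ n) (g x))))" by blast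
    have e: "exec (?B m) (s(m := encode x, m+1 := dhd (encode x))) (2 + (t + Suc (dsize (dhd (encode (g x))))))
        (s(m := encode (g x), m+1 := dhd (encode (g x))))"
      by (rule exec_Seq[OF exec_AssignI exec_Seq[OF t(2) exec_AssignI]])
        (use Suc.prems(1) in \<open>auto simp: fun_eq_iff\<close>)
    have "dhd (encode x) \<noteq> Atom" using Suc.prems(3)[rule_format, of 0] by simp
    then have "exec (While (m+1) (?B m)) (s(m := encode x, m+1 := dhd (encode x)))
        (Suc (2 + (t + Suc (dsize (dhd (encode (g x))))) + u)) (s(m := encode ((g ^^ n) (g x))))"
      by (intro exec_WhileT[OF _ e u(2)]) simp
    moreover have "Suc (2 + (t + Suc (dsize (dhd (encode (g x))))) + u) \<le> 1 + Suc n * ?c b"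
    proof -
      have "dsize (dhd (encode (g x))) \<le> b"
        using dsize_dhd[of "encode (g x)"] Suc.prems(4)[rule_format, of 1] by simp
      moreover have "t \<le> p b"
        using t(1) pb_mono[OF p(1), of "dsize (encode x)" b] Suc.prems(4)[rule_format, of 0] by simp
      ultimately show ?thesis using u(1) by simp
    qed
    ultimately show ?case unfolding g_Suc by blast
  qed
  obtain R r where r: "pb r" "implements R r a" using a by (rule polytimeE)
  have "implements (\<lambda>m. Seq (R m) (?P m)) (\<lambda>n. r n + (q n + 2 + (1 + q n * (5 + q n + p (q n))))) f"
    unfolding implements_def
  proof (intro allI impI)
    fix m :: nat and s :: store and x :: 'a
    assume s: "\<forall>i>m. s i = Atom" "s m = encode x"
    let ?n = "dsize (encode x)" and ?s = "s(m := encode (a x))"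
    obtain n where n: "n \<le> q ?n" "f x = (g ^^ n) (a x)" "dhd (encode ((g ^^ n) (a x))) = Atom"
      "\<forall>i<n. dhd (encode ((g ^^ i) (a x))) \<noteq> Atom" "\<forall>i\<le>n. dsize (encode ((g ^^ i) (a x))) \<le> q ?n"
      using f by meson
    obtain u where u: "u \<le> r ?n" "exec (R m) s u ?s"
      using implementsD[OF r(2) s] by blast
    obtain t where t: "t \<le> 1 + n * ?c (q ?n)" "exec (While (m+1) (?B m))
        (s(m := encode (a x), m+1 := dhd (encode (a x)))) t (s(m := encode ((g ^^ n) (a x))))"
      using loop[OF s(1) n(3-5)] by blast
    have "t \<le> 1 + q ?n * ?c (q ?n)"
      using t(1) mult_le_mono1[OF n(1)] by (meson add_le_cancel_left le_trans)
    moreover have "dsize (dhd (encode (a x))) \<le> q ?n"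
      using dsize_dhd[of "encode (a x)"] n(5)[rule_format, of 0] by simp
    moreover have "exec (Seq (R m) (?P m)) s (u + (Suc (dsize (dhd (encode (a x)))) + t))
        (s(m := encode ((g ^^ n) (a x))))"
      by (rule exec_Seq[OF u(2) exec_Seq[OF exec_AssignI t(2)]]) auto
    ultimately show "\<exists>t\<le>r ?n + (q ?n + 2 + (1 + q ?n * (5 + q ?n + p (q ?n)))).
        exec (Seq (R m) (?P m)) s t (s(m := encode (f x)))"
      using u(1) n(2) by (intro exI[of _ "u + (Suc (dsize (dhd (encode (a x)))) + t)"]) auto
  qed
  moreover have "pb (\<lambda>n. r n + (q n + 2 + (1 + q n * (5 + q n + p (q n)))))"
    using q p(1) r(1) by (intro pb_intros pb_comp[OF p(1)])
  ultimately show ?thesis by (rule polytimeI)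
qed


section \<open>Closure properties of polynomial-time functions\<close>

text \<open>Programs see encodings only, and the result types of \<open>f\<close> and
  \<open>g\<close> may differ. Hence coercions cost nothing, for example reading a number as a list
  of atoms, or \<open>#\<close> as pairing.\<close>

lemma polytime_cong:
  assumes "polytime f" "\<And>x. encode (g x) = encode (f x)"
  shows "polytime g"
  using assms unfolding polytime_def implements_def by simp

lemma polytime_data_Pair: "polytime a \<Longrightarrow> polytime b \<Longrightarrow> polytime (\<lambda>e. data.Pair (a e) (b e))"
  by (rule polytime_cong[where f = "\<lambda>e. (a e, b e)"]) (simp_all add: polytime_Pair)

lemma polytime_const: "polytime (\<lambda>_. c)"
proof -
  have "polytime (\<lambda>_. d)" for d :: data
    by (induction d) (auto intro: polytime_Atom polytime_data_Pair)
  from this[of "encode c"] show ?thesis by (rule polytime_cong) simp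
qed

lemma polytime_fst: "polytime f \<Longrightarrow> polytime (\<lambda>x. fst (f x))"
proof (rule polytime_comp[where f = fst])
  show "polytime (fst :: 'b \<times> 'c \<Rightarrow> 'b)"
    by (rule polytime_expr[where e = EHd]) (auto simp: encode_prod_def)
qed

lemma polytime_snd: "polytime f \<Longrightarrow> polytime (\<lambda>x. snd (f x))"
proof (rule polytime_comp[where f = snd])
  show "polytime (snd :: 'b \<times> 'c \<Rightarrow> 'c)"
    by (rule polytime_expr[where e = ETl]) (auto simp: encode_prod_def)
qed

text \<open>A function of two arguments is treated once in uncurried form; this rule then
  substitutes arbitrary polynomial-time arguments.\<close>

lemma polytime_app2:
  assumes "polytime (\<lambda>p. f (fst p) (snd p))" "polytime a" "polytime b"
  shows "polytime (\<lambda>e. f (a e) (b e))"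
  using polytime_comp[OF assms(1) polytime_Pair[OF assms(2,3)]] by simp

lemma polytime_app3:
  assumes "polytime (\<lambda>p. f (fst p) (fst (snd p)) (snd (snd p)))" "polytime a" "polytime b" "polytime c"
  shows "polytime (\<lambda>e. f (a e) (b e) (c e))"
  using polytime_comp[OF assms(1) polytime_Pair[OF assms(2) polytime_Pair[OF assms(3,4)]]] by simp

lemma polytime_If:
  assumes "polytime c" "polytime f" "polytime g"
  shows "polytime (\<lambda>e. if c e then f e else g e)"
proof (rule polytime_branch[where c = c and f = "\<lambda>p::'a \<times> bool. f (fst p)" and g = g])
  show "polytime (\<lambda>p::'a \<times> bool. f (fst p))" by (rule polytime_comp[OF assms(2) polytime_fst[OF polytime_id]])
  fix x
  show "(if c x then f x else g x) = g x" if "encode (c x) = Atom"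
    using that by (cases "c x") simp_all
  show "\<exists>y::bool. encode (c x) = encode y \<and> (if c x then f x else g x) = f (fst (x, y))" if "encode (c x) \<noteq> Atom"
    using that by (intro exI[of _ "c x"]) (cases "c x"; simp)
qed (use assms in simp_all)

lemma polytime_case_list:
  assumes "polytime xs" "polytime f" "polytime (\<lambda>p. g (fst p) (fst (snd p)) (snd (snd p)))"
  shows "polytime (\<lambda>e. case xs e of [] \<Rightarrow> f e | y # ys \<Rightarrow> g e y ys)"
proof (rule polytime_branch[OF assms(1,3,2)])
  fix x
  show "encode (xs x) = Atom \<Longrightarrow> (case xs x of [] \<Rightarrow> f x | y # ys \<Rightarrow> g x y ys) = f x"
    by (cases "xs x") auto
  show "\<exists>z. encode (xs x) = encode z \<and> (case xs x of [] \<Rightarrow> f x | y # ys \<Rightarrow> g x y ys) =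
      g (fst (x, z)) (fst (snd (x, z))) (snd (snd (x, z)))" if "encode (xs x) \<noteq> Atom"
  proof (cases "xs x")
    case (Cons y ys)
    then show ?thesis by (intro exI[of _ "(y, ys)"]) simp
  qed (use that in auto)
qed

lemma polytime_case_data:
  assumes "polytime d" "polytime f" "polytime (\<lambda>p. g (fst p) (fst (snd p)) (snd (snd p)))"
  shows "polytime (\<lambda>e. case d e of Atom \<Rightarrow> f e | data.Pair y z \<Rightarrow> g e y z)"
proof (rule polytime_branch[OF assms(1,3,2)])
  fix x
  show "encode (d x) = Atom \<Longrightarrow> (case d x of Atom \<Rightarrow> f x | data.Pair y z \<Rightarrow> g x y z) = f x"
    by simp
  show "\<exists>z. encode (d x) = encode z \<and> (case d x of Atom \<Rightarrow> f x | data.Pair y z \<Rightarrow> g x y z) =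
      g (fst (x, z)) (fst (snd (x, z))) (snd (snd (x, z)))" if "encode (d x) \<noteq> Atom"
  proof (cases "d x")
    case (Pair y z)
    then show ?thesis by (intro exI[of _ "(y, z)"]) simp
  qed (use that in auto)
qed

lemma polytime_Cons: "polytime a \<Longrightarrow> polytime b \<Longrightarrow> polytime (\<lambda>e. a e # b e)"
  by (rule polytime_cong[where f = "\<lambda>e. (a e, b e)"]) (simp_all add: polytime_Pair)

lemma polytime_conj: "polytime a \<Longrightarrow> polytime b \<Longrightarrow> polytime (\<lambda>e. a e \<and> b e)"
  by (rule polytime_cong[where f = "\<lambda>e. if a e then b e else False"])
    (simp_all add: polytime_If polytime_const)

lemma polytime_disj: "polytime a \<Longrightarrow> polytime b \<Longrightarrow> polytime (\<lambda>e. a e \<or> b e)"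
  by (rule polytime_cong[where f = "\<lambda>e. if a e then True else b e"])
    (simp_all add: polytime_If polytime_const)

lemma polytime_not: "polytime a \<Longrightarrow> polytime (\<lambda>e. \<not> a e)"
  by (rule polytime_cong[where f = "\<lambda>e. if a e then False else True"])
    (simp_all add: polytime_If polytime_const)

lemma polytime_encode: "polytime a \<Longrightarrow> polytime (\<lambda>e. encode (a e))"
  by (rule polytime_cong[where f = a]) simp_all

lemmas polytime_basic = polytime_id polytime_const polytime_fst polytime_snd polytime_Pair polytime_If
  polytime_data_Pair polytime_case_list polytime_case_data polytime_Cons polytime_conj polytime_disj polytime_not polytime_encode

section \<open>Size estimates and iteration over lists\<close>

lemma dsize_fst_le: "dsize (encode (fst p)) \<le> dsize (encode p)"
  and dsize_snd_le: "dsize (encode (snd p)) \<le> dsize (encode p)"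
  by (cases p; simp)+

lemma dsize_take_le: "dsize (encode (take i xs)) \<le> dsize (encode xs)"
  by (induction xs arbitrary: i) (auto simp: take_Cons split: nat.split)

lemma dsize_drop_le: "dsize (encode (drop i xs)) \<le> dsize (encode xs)"
proof (induction xs arbitrary: i)
  case (Cons x xs)
  then show ?case by (cases i) (auto simp: le_SucI trans_le_add2)
qed simp

lemma length_le_dsize: "length xs \<le> dsize (encode xs)"
  by (induction xs) auto

lemma dsize_mem_le: "x \<in> set xs \<Longrightarrow> dsize (encode x) \<le> dsize (encode xs)"
  by (induction xs) auto

lemma dsize_list_le: "(\<And>x. x \<in> set xs \<Longrightarrow> dsize (encode x) \<le> b) \<Longrightarrow> dsize (encode xs) \<le> 1 + length xs * (1 + b)"
proof (induction xs)
  case (Cons x xs)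
  then have "dsize (encode x) \<le> b" "dsize (encode xs) \<le> 1 + length xs * (1 + b)" by auto
  then show ?case by simp
qed simp

text \<open>The remaining list is the first component of the loop state, so the head of the state is
  \<open>Atom\<close> exactly when the list is used up. The environment \<open>e\<close> travels
  along unchanged.\<close>

lemma polytime_foldl:
  fixes f :: "'e::encodable \<Rightarrow> 'b::encodable \<Rightarrow> 'x::encodable \<Rightarrow> 'b"
  assumes f: "polytime (\<lambda>p. f (fst p) (fst (snd p)) (snd (snd p)))" and a: "polytime a" and xs: "polytime xs"
    and q: "pb q"
    and bound: "\<And>e i. i \<le> length (xs e) \<Longrightarrow> dsize (encode (foldl (f e) (a e) (take i (xs e)))) \<le> q (dsize (encode e))"
  shows "polytime (\<lambda>e. foldl (f e) (a e) (xs e))"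
proof -
  define step :: "'x list \<times> 'e \<times> 'b \<Rightarrow> 'x list \<times> 'e \<times> 'b" where
    "step = (\<lambda>p. case fst p of [] \<Rightarrow> p | y # ys \<Rightarrow> (ys, (fst (snd p), f (fst (snd p)) (snd (snd p)) y)))"
  have step: "polytime step"
    unfolding step_def by (intro polytime_basic polytime_app3[OF f])
  have iter: "(step ^^ i) (ys, e, b) = (drop i ys, e, foldl (f e) b (take i ys))" if "i \<le> length ys" for i ys e b
    using that
  proof (induction i arbitrary: ys b)
    case (Suc i)
    then obtain y zs where ys: "ys = y # zs" by (cases ys) auto
    have "step (ys, e, b) = (zs, e, f e b y)" by (simp add: step_def ys)
    then show ?case using Suc by (simp add: funpow_Suc_right ys del: funpow.simps)
  qed simp
  obtain r where r: "pb r" "\<And>e. dsize (encode (xs e)) \<le> r (dsize (encode e))"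
    using polytime_dsize[OF xs] by blast
  let ?q = "\<lambda>n. 2 + n + r n + q n"
  have "polytime (\<lambda>e. ([] :: 'x list, e, foldl (f e) (a e) (xs e)))"
  proof (rule polytime_while[OF step, where a = "\<lambda>e. (xs e, e, a e)" and q = ?q])
    show "polytime (\<lambda>e. (xs e, e, a e))" by (intro polytime_basic xs a)
    show "pb ?q" by (intro pb_intros r(1) q)
    fix e
    let ?n = "length (xs e)"
    show "\<exists>n\<le>?q (dsize (encode e)). ([], e, foldl (f e) (a e) (xs e)) = (step ^^ n) (xs e, e, a e) \<and>
      dhd (encode ((step ^^ n) (xs e, e, a e))) = Atom \<and>
      (\<forall>i<n. dhd (encode ((step ^^ i) (xs e, e, a e))) \<noteq> Atom) \<and>
      (\<forall>i\<le>n. dsize (encode ((step ^^ i) (xs e, e, a e))) \<le> ?q (dsize (encode e)))"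
    proof (intro exI[of _ ?n] conjI allI impI)
      show "?n \<le> ?q (dsize (encode e))"
        using length_le_dsize[of "xs e"] r(2)[of e] by simp
      fix i
      show "dhd (encode ((step ^^ i) (xs e, e, a e))) \<noteq> Atom" if "i < ?n"
        using that by (simp add: iter Cons_nth_drop_Suc[symmetric])
      show "dsize (encode ((step ^^ i) (xs e, e, a e))) \<le> ?q (dsize (encode e))" if "i \<le> ?n"
        using that bound[OF that] r(2)[of e] dsize_drop_le[of i "xs e"] by (simp add: iter)
    qed (simp_all add: iter)
  qed
  from polytime_snd[OF polytime_snd[OF this]] show ?thesis by simp
qed

lemma polytime_rev: "polytime xs \<Longrightarrow> polytime (\<lambda>e. rev (xs e))"
proof (rule polytime_comp[where f = rev])
  have eq: "foldl (\<lambda>a x. x # a) ys xs = rev xs @ ys" for xs ys :: "'b list"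
    by (induction xs arbitrary: ys) auto
  have "polytime (\<lambda>e::'b list. foldl (\<lambda>a x. x # a) [] e)"
  proof (rule polytime_foldl[where q = "\<lambda>n. n"])
    fix e :: "'b list" and i
    show "dsize (encode (foldl (\<lambda>a x. x # a) [] (take i e))) \<le> dsize (encode e)"
      using dsize_take_le[of i e] by (simp add: eq dsize_encode_list rev_map[symmetric])
  qed (intro polytime_basic pb_intros)+
  then show "polytime (rev :: 'b list \<Rightarrow> 'b list)" by (simp add: eq)
qed

lemma dsize_append: "dsize (encode (xs @ ys)) + 1 = dsize (encode xs) + dsize (encode ys)"
  by (induction xs) auto

lemma polytime_append:
  assumes "polytime a" "polytime b"
  shows "polytime (\<lambda>e. a e @ b e)"
proof (rule polytime_app2[OF _ assms])
  have eq: "foldl (\<lambda>a x. x # a) ys xs = rev xs @ ys" for xs ys :: "'b list"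
    by (induction xs arbitrary: ys) auto
  have "polytime (\<lambda>e::'b list \<times> 'b list. foldl (\<lambda>a x. x # a) (snd e) (rev (fst e)))"
  proof (rule polytime_foldl[where q = "\<lambda>n. n"])
    fix e :: "'b list \<times> 'b list" and i
    have "dsize (encode (rev (take i (rev (fst e))))) \<le> dsize (encode (fst e))"
      unfolding take_rev rev_rev_ident by (rule dsize_drop_le)
    then show "dsize (encode (foldl (\<lambda>a x. x # a) (snd e) (take i (rev (fst e))))) \<le> dsize (encode e)"
      using dsize_append[of "rev (take i (rev (fst e)))" "snd e"]
      by (cases e) (simp add: eq)
  qed (intro polytime_basic polytime_rev pb_intros)+
  then show "polytime (\<lambda>p::'b list \<times> 'b list. fst p @ snd p)" by (simp add: eq)
qed

lemma polytime_map:
  fixes g :: "'e::encodable \<Rightarrow> 'x::encodable \<Rightarrow> 'y::encodable"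
  assumes xs: "polytime xs" and g: "polytime (\<lambda>p. g (fst p) (snd p))"
  shows "polytime (\<lambda>e. map (g e) (xs e))"
proof -
  have eq: "foldl (\<lambda>a x. h x # a) ys zs = rev (map h zs) @ ys" for h :: "'x \<Rightarrow> 'y" and zs ys
    by (induction zs arbitrary: ys) auto
  obtain q where q: "pb q" "\<And>x. dsize (encode (g (fst x) (snd x))) \<le> q (dsize (encode x))"
    using polytime_dsize[OF g] by blast
  obtain r where r: "pb r" "\<And>e. dsize (encode (xs e)) \<le> r (dsize (encode e))"
    using polytime_dsize[OF xs] by blast
  have "polytime (\<lambda>e. foldl (\<lambda>a x. g e x # a) [] (xs e))"
  proof (rule polytime_foldl[where q = "\<lambda>n. 1 + r n * (1 + q (1 + n + r n))"])
    fix e :: 'e and i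
    let ?n = "dsize (encode e)"
    have "dsize (encode (rev (map (g e) (take i (xs e))))) \<le>
        1 + length (rev (map (g e) (take i (xs e)))) * (1 + q (1 + ?n + r ?n))"
    proof (rule dsize_list_le)
      fix y
      assume "y \<in> set (rev (map (g e) (take i (xs e))))"
      then obtain x where x: "x \<in> set (xs e)" "y = g e x" by (auto dest: in_set_takeD)
      have "dsize (encode x) \<le> r ?n" using dsize_mem_le[OF x(1)] r(2)[of e] by simp
      then have "dsize (encode (e, x)) \<le> 1 + ?n + r ?n" by simp
      with q(2)[of "(e, x)"] show "dsize (encode y) \<le> q (1 + ?n + r ?n)"
        using pb_mono[OF q(1)] x(2) by (metis fst_conv le_trans snd_conv)
    qed
    also have "\<dots> \<le> 1 + r ?n * (1 + q (1 + ?n + r ?n))"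
      using length_le_dsize[of "xs e"] r(2)[of e] by (intro add_left_mono mult_le_mono1) simp
    finally show "dsize (encode (foldl (\<lambda>a x. g e x # a) [] (take i (xs e)))) \<le>
        1 + r ?n * (1 + q (1 + ?n + r ?n))" by (simp add: eq)
  next
    show "polytime (\<lambda>p. g (fst p) (snd (snd p)) # fst (snd p))"
      by (intro polytime_basic polytime_app2[OF g])
    show "pb (\<lambda>n. 1 + r n * (1 + q (1 + n + r n)))"
      by (intro pb_intros r(1) pb_comp[OF q(1)])
  qed (intro polytime_basic xs)+
  from polytime_rev[OF this] show ?thesis by (simp add: eq)
qed

lemma dsize_concat_le: "dsize (encode (concat xss)) \<le> dsize (encode xss)"
proof (induction xss)
  case (Cons xs xss)
  then show ?case using dsize_append[of xs "concat xss"] by simp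
qed simp

lemma polytime_concat: "polytime xss \<Longrightarrow> polytime (\<lambda>e. concat (xss e))"
proof (rule polytime_comp[where f = concat])
  have eq: "foldl (\<lambda>a xs. a @ xs) ys xss = ys @ concat xss" for xss and ys :: "'b list"
    by (induction xss arbitrary: ys) auto
  have "polytime (\<lambda>e::'b list list. foldl (\<lambda>a xs. a @ xs) [] e)"
  proof (rule polytime_foldl[where q = "\<lambda>n. n"])
    fix e :: "'b list list" and i
    show "dsize (encode (foldl (\<lambda>a xs. a @ xs) [] (take i e))) \<le> dsize (encode e)"
      using dsize_take_le[of i e] dsize_concat_le[of "take i e"] by (simp add: eq)
  qed (intro polytime_basic polytime_append pb_intros)+
  then show "polytime (concat :: 'b list list \<Rightarrow> 'b list)" by (simp add: eq)
qed

lemma polytime_filter: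
  assumes xs: "polytime xs" and P: "polytime (\<lambda>p. P (fst p) (snd p))"
  shows "polytime (\<lambda>e. filter (P e) (xs e))"
proof -
  have eq: "filter Q ys = concat (map (\<lambda>x. if Q x then [x] else []) ys)" for Q and ys :: "'b list"
    by (induction ys) auto
  show ?thesis
    unfolding eq by (intro polytime_basic polytime_concat polytime_map xs P)
qed

lemma polytime_list_all:
  assumes xs: "polytime xs" and P: "polytime (\<lambda>p. P (fst p) (snd p))"
  shows "polytime (\<lambda>e. list_all (P e) (xs e))"
proof -
  have eq: "list_all Q ys = (case filter (\<lambda>x. \<not> Q x) ys of [] \<Rightarrow> True | _ # _ \<Rightarrow> False)" for Q and ys :: "'b list"
    by (induction ys) auto
  show ?thesis
    unfolding eq by (intro polytime_basic polytime_filter xs P)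
qed

lemmas polytime_lists = polytime_basic polytime_rev polytime_append polytime_map polytime_concat
  polytime_filter polytime_list_all

lemma polytime_product:
  "polytime xs \<Longrightarrow> polytime ys \<Longrightarrow> polytime (\<lambda>e. List.product (xs e) (ys e))"
  unfolding product_concat_map
  by (rule polytime_app2[where f = "\<lambda>xs ys. concat (map (\<lambda>x. map (\<lambda>y. (x, y)) ys) xs)"])
    (intro polytime_lists)

text \<open>Here \<open>n\<close> is a constant: each level of the induction yields a new program,
  and the degree of the polynomial grows with \<open>n\<close>.\<close>

lemma polytime_n_lists:
  "polytime xs \<Longrightarrow> polytime (\<lambda>e. List.n_lists n (xs e))"
proof (induction n)
  case (Suc n)
  show ?case unfolding n_lists.simps
    by (rule polytime_app2[where f = "\<lambda>zss xs. concat (map (\<lambda>ys. map (\<lambda>y. y # ys) xs) zss)", OF _ Suc.IH Suc.prems])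
      (intro polytime_lists, (rule Suc.prems)?)
qed (simp add: polytime_const)

subsection \<open>Natural numbers\<close>

text \<open>A number is encoded like a list of atoms, which gives access to the list operations.\<close>

lemma encode_replicate_Atom: "encode (replicate n Atom) = encode n"
  by (induction n) auto

lemma polytime_replicate_Atom: "polytime n \<Longrightarrow> polytime (\<lambda>e. replicate (n e) Atom)"
  by (rule polytime_cong[where f = n]) (simp_all add: encode_replicate_Atom)

lemma polytime_length:
  assumes "polytime xs"
  shows "polytime (\<lambda>e. length (xs e))"
proof (rule polytime_cong[where f = "\<lambda>e. map (\<lambda>_. Atom) (xs e)"])
  show "polytime (\<lambda>e. map (\<lambda>_. Atom) (xs e))" by (intro polytime_lists assms)
qed (simp add: map_replicate_const encode_replicate_Atom)

lemma polytime_replicate: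
  assumes "polytime n" "polytime x"
  shows "polytime (\<lambda>e. replicate (n e) (x e))"
proof -
  have eq: "replicate m y = map (\<lambda>_. y) (replicate m Atom)" for m and y :: 'b
    by simp
  show ?thesis
    by (subst eq, rule polytime_app2[where f = "\<lambda>as y. map (\<lambda>_. y) as", OF _ polytime_replicate_Atom])
      (intro polytime_lists assms)+
qed

lemma polytime_Suc: "polytime n \<Longrightarrow> polytime (\<lambda>e. Suc (n e))"
  by (rule polytime_cong[where f = "\<lambda>e. (Atom, n e)"]) (simp_all add: polytime_basic)

lemma polytime_add:
  fixes m n :: "'a::encodable \<Rightarrow> nat"
  assumes "polytime m" "polytime n"
  shows "polytime (\<lambda>e. m e + n e)"
proof -
  have eq: "k + l = length (replicate k Atom @ replicate l Atom)" for k l :: nat by simp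
  show ?thesis unfolding eq
    by (intro polytime_length polytime_append polytime_replicate_Atom assms)
qed

lemma polytime_sum_list:
  assumes "polytime ns"
  shows "polytime (\<lambda>e. sum_list (ns e) :: nat)"
proof -
  have eq: "sum_list ks = length (concat (map (\<lambda>k. replicate k Atom) ks))" for ks :: "nat list"
    by (induction ks) auto
  show ?thesis unfolding eq
    by (intro polytime_lists polytime_length polytime_replicate_Atom assms)
qed

lemma polytime_drop:
  fixes xs :: "'a::encodable \<Rightarrow> 'b::encodable list"
  assumes "polytime n" "polytime xs"
  shows "polytime (\<lambda>e. drop (n e) (xs e))"
proof -
  let ?tl = "\<lambda>xs::'b list. case xs of [] \<Rightarrow> [] | _ # ys \<Rightarrow> ys"
  have eq: "foldl (\<lambda>a _. ?tl a) ys as = drop (length as) ys" for as :: "data list" and ys :: "'b list"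
    by (induction as arbitrary: ys) (auto split: list.split)
  have "polytime (\<lambda>e::nat \<times> 'b list. foldl (\<lambda>a _. ?tl a) (snd e) (replicate (fst e) Atom))"
  proof (rule polytime_foldl[where q = "\<lambda>n. n"])
    fix e :: "nat \<times> 'b list" and i
    show "dsize (encode (foldl (\<lambda>a _. ?tl a) (snd e) (take i (replicate (fst e) Atom)))) \<le> dsize (encode e)"
      unfolding eq using dsize_drop_le dsize_snd_le le_trans by blast
  qed (intro polytime_basic polytime_replicate_Atom pb_intros)+
  then have "polytime (\<lambda>e::nat \<times> 'b list. drop (fst e) (snd e))" by (simp add: eq)
  from polytime_app2[OF this assms] show ?thesis .
qed

lemma polytime_diff:
  fixes m n :: "'a::encodable \<Rightarrow> nat"
  assumes "polytime m" "polytime n"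
  shows "polytime (\<lambda>e. m e - n e)"
proof -
  have eq: "k - l = length (drop l (replicate k Atom))" for k l :: nat by simp
  show ?thesis unfolding eq
    by (intro polytime_length polytime_drop polytime_replicate_Atom assms)
qed

lemma polytime_less:
  fixes m n :: "'a::encodable \<Rightarrow> nat"
  assumes "polytime m" "polytime n"
  shows "polytime (\<lambda>e. m e < n e)"
proof -
  have eq: "k < l \<longleftrightarrow> (case drop k (replicate l Atom) of [] \<Rightarrow> False | _ # _ \<Rightarrow> True)" for k l :: nat
    by (cases "l - k") auto
  show ?thesis unfolding eq
    by (intro polytime_lists polytime_drop polytime_replicate_Atom assms)
qed

lemma polytime_le:
  fixes m n :: "'a::encodable \<Rightarrow> nat"
  assumes "polytime m" "polytime n"
  shows "polytime (\<lambda>e. m e \<le> n e)"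
  unfolding less_Suc_eq_le[symmetric] by (intro polytime_less polytime_Suc assms)

lemma polytime_upt:
  assumes "polytime m"
  shows "polytime (\<lambda>e. [0..<m e])"
proof -
  have eq: "foldl (\<lambda>a _. length a # a) [] as = rev [0..<length as]" for as :: "data list"
    by (induction as rule: rev_induct) auto
  have "polytime (\<lambda>m::nat. foldl (\<lambda>a _. length a # a) [] (replicate m Atom))"
  proof (rule polytime_foldl[where q = "\<lambda>n. 1 + n * (1 + n)"])
    fix m i :: nat
    have "dsize (encode (rev [0..<min i m])) \<le> 1 + length (rev [0..<min i m]) * (1 + dsize (encode m))"
      by (rule dsize_list_le) auto
    also have "\<dots> \<le> 1 + dsize (encode m) * (1 + dsize (encode m))"
      by (intro add_left_mono mult_le_mono1) auto
    finally show "dsize (encode (foldl (\<lambda>a _. length a # a) [] (take i (replicate m Atom)))) \<le>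
        1 + dsize (encode m) * (1 + dsize (encode m))"
      by (simp only: eq min.commute length_take length_replicate)
  qed (intro polytime_basic polytime_length polytime_replicate_Atom pb_intros)+
  from polytime_rev[OF this] have "polytime (\<lambda>m::nat. [0..<m])" by (simp add: eq)
  from polytime_comp[OF this assms] show ?thesis .
qed

text \<open>A total substitute for \<open>!\<close>, whose value outside the list is unspecified and
  hence not the output of any known program.\<close>

definition lookup :: "'a \<Rightarrow> 'a list \<Rightarrow> nat \<Rightarrow> 'a" where
  "lookup d xs i = (case drop i xs of [] \<Rightarrow> d | x # _ \<Rightarrow> x)"

lemma lookup_nth [simp]: "i < length xs \<Longrightarrow> lookup d xs i = xs ! i"
  by (simp add: lookup_def Cons_nth_drop_Suc[symmetric])

lemma polytime_lookup:
  assumes "polytime d" "polytime xs" "polytime i"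
  shows "polytime (\<lambda>e. lookup (d e) (xs e) (i e))"
  unfolding lookup_def by (intro polytime_basic polytime_drop assms)

subsection \<open>Equality\<close>

text \<open>Two trees are compared with a stack of pairs of subtrees still to be compared.\<close>

definition eq_step :: "(data \<times> data) list \<times> bool \<Rightarrow> (data \<times> data) list \<times> bool" where
  "eq_step s = (case fst s of [] \<Rightarrow> s | p # ps \<Rightarrow>
     (case fst p of
       Atom \<Rightarrow> (case snd p of Atom \<Rightarrow> (ps, snd s) | data.Pair _ _ \<Rightarrow> ([], False))
     | data.Pair x y \<Rightarrow> (case snd p of Atom \<Rightarrow> ([], False)
         | data.Pair x' y' \<Rightarrow> ((x, x') # (y, y') # ps, snd s))))"

text \<open>Comparing two inner nodes replaces them by their children, so the total size of the
  first components decreases and bounds the number of steps. The state does not grow: the two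
  removed nodes pay for the additional pair and list cell.\<close>

lemma eq_step_iter:
  "(\<Sum>p\<leftarrow>st. dsize (fst p)) \<le> k \<Longrightarrow> \<exists>n\<le>k. (eq_step ^^ n) (st, r) = ([], r \<and> (\<forall>p\<in>set st. fst p = snd p)) \<and>
    (\<forall>i<n. fst ((eq_step ^^ i) (st, r)) \<noteq> []) \<and>
    (\<forall>i\<le>n. dsize (encode ((eq_step ^^ i) (st, r))) \<le> dsize (encode (st, r)))"
  (is "_ \<Longrightarrow> \<exists>n\<le>k. ?P n st r")
proof (induction k arbitrary: st r)
  case 0
  then show ?case by (cases st) auto
next
  case (Suc k)
  show ?case
  proof (cases st)
    case Nil
    then show ?thesis by (intro exI[of _ 0]) simp
  next
    case (Cons p ps)
    obtain st' r' where s': "eq_step (st, r) = (st', r')" by (cases "eq_step (st, r)")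
    have sum: "(\<Sum>p\<leftarrow>st'. dsize (fst p)) < (\<Sum>p\<leftarrow>st. dsize (fst p))"
      and res: "(r' \<and> (\<forall>p\<in>set st'. fst p = snd p)) = (r \<and> (\<forall>p\<in>set st. fst p = snd p))"
      and size: "dsize (encode (st', r')) \<le> dsize (encode (st, r))"
      using s' unfolding Cons eq_step_def
      by (cases p; cases "fst p"; cases "snd p"; cases r; auto)+
    from sum Suc.prems have "(\<Sum>p\<leftarrow>st'. dsize (fst p)) \<le> k" by simp
    from Suc.IH[OF this, of r'] obtain n where n: "n \<le> k" "?P n st' r'" by blast
    have step: "(eq_step ^^ Suc i) (st, r) = (eq_step ^^ i) (st', r')" for i
      by (simp add: funpow_Suc_right s' del: funpow.simps)
    have "?P (Suc n) st r"
    proof (intro conjI allI impI)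
      show "(eq_step ^^ Suc n) (st, r) = ([], r \<and> (\<forall>p\<in>set st. fst p = snd p))"
        unfolding step using n(2) res by simp
      show "fst ((eq_step ^^ i) (st, r)) \<noteq> []" if "i < Suc n" for i
      proof (cases i)
        case (Suc j)
        then show ?thesis using that n(2) unfolding Suc step by simp
      qed (simp add: Cons)
      show "dsize (encode ((eq_step ^^ i) (st, r))) \<le> dsize (encode (st, r))" if "i \<le> Suc n" for i
      proof (cases i)
        case (Suc j)
        then have "dsize (encode ((eq_step ^^ j) (st', r'))) \<le> dsize (encode (st', r'))"
          using that n(2) by simp
        then show ?thesis using size unfolding Suc step by (rule le_trans)
      qed simp
    qed
    with n(1) show ?thesis by (intro exI[of _ "Suc n"]) simp
  qed
qed

text \<open>By injectivity of \<open>encode\<close>, two values are equal iff their trees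
  are.\<close>

lemma polytime_eq:
  assumes "polytime a" "polytime b"
  shows "polytime (\<lambda>e. a e = b e)"
proof -
  have step: "polytime eq_step"
    unfolding eq_step_def by (intro polytime_basic)
  let ?q = "\<lambda>n::nat. n + 7"
  have "polytime (\<lambda>p::data \<times> data. ([] :: (data \<times> data) list, fst p = snd p))"
  proof (rule polytime_while[OF step, where a = "\<lambda>p. ([p], True)" and q = ?q])
    show "polytime (\<lambda>p::data \<times> data. ([p], True))" by (intro polytime_basic)
    show "pb ?q" by (intro pb_intros)
    fix p :: "data \<times> data"
    obtain n where "n \<le> dsize (fst p)" "(eq_step ^^ n) ([p], True) = ([], fst p = snd p)"
      "\<forall>i<n. fst ((eq_step ^^ i) ([p], True)) \<noteq> []"
      "\<forall>i\<le>n. dsize (encode ((eq_step ^^ i) ([p], True))) \<le> dsize (encode ([p], True))"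
      using eq_step_iter[of "[p]" "dsize (fst p)" True] by auto
    moreover have "dhd (encode s) = Atom \<longleftrightarrow> fst s = []" for s :: "(data \<times> data) list \<times> bool"
      by (cases s; cases "fst s") auto
    moreover have "dsize (fst p) \<le> dsize (encode p)" using dsize_fst_le[of p] by simp
    ultimately show "\<exists>n\<le>?q (dsize (encode p)). ([], fst p = snd p) = (eq_step ^^ n) ([p], True) \<and>
      dhd (encode ((eq_step ^^ n) ([p], True))) = Atom \<and>
      (\<forall>i<n. dhd (encode ((eq_step ^^ i) ([p], True))) \<noteq> Atom) \<and>
      (\<forall>i\<le>n. dsize (encode ((eq_step ^^ i) ([p], True))) \<le> ?q (dsize (encode p)))"
      by (intro exI[of _ n]) auto
  qed
  from polytime_snd[OF this] have "polytime (\<lambda>p::data \<times> data. fst p = snd p)" by simp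
  from polytime_app2[OF this polytime_encode[OF assms(1)] polytime_encode[OF assms(2)]]
  show ?thesis by simp
qed

lemmas polytime_intros = polytime_lists polytime_product polytime_n_lists polytime_length polytime_replicate
  polytime_Suc polytime_add polytime_sum_list polytime_drop polytime_diff polytime_less polytime_le
  polytime_upt polytime_lookup polytime_eq


section \<open>Circuits\<close>

lemma enc_unary_inject [simp]: "enc_unary m = enc_unary n \<longleftrightarrow> m = n"
  by (simp add: enc_unary_def)

instantiation gate :: encodable
begin
definition encode_gate :: "gate \<Rightarrow> data" where "encode_gate = enc_gate"
instance
proof
  have "inj enc_unary" by (simp add: inj_def)
  then have "enc_gate g = enc_gate h \<Longrightarrow> g = h" for g h
    by (cases g; cases h) (auto simp: numeral_2_eq_2 numeral_3_eq_3 inj_map_eq_map)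
  then show "inj (encode :: gate \<Rightarrow> data)" by (simp add: encode_gate_def inj_def)
qed
end

lemma encode_gate [simp]:
  "encode In = data.Pair Atom Atom"
  "encode (Not j) = data.Pair (encode (1::nat)) (encode j)"
  "encode (And js) = data.Pair (encode (2::nat)) (encode js)"
  "encode (Or js) = data.Pair (encode (3::nat)) (encode js)"
  by (simp_all add: encode_gate_def encode_nat_def encode_list_def)

lemma encode_circuit: "encode C = enc_circuit C"
  by (simp add: encode_list_def enc_circuit_def encode_gate_def)

lemma polytime_dhd: "polytime a \<Longrightarrow> polytime (\<lambda>e. dhd (a e))"
  by (rule polytime_cong[where f = "\<lambda>e. case a e of Atom \<Rightarrow> Atom | data.Pair x y \<Rightarrow> x"])
    (intro polytime_intros, auto split: data.split)

lemma polytime_dtl: "polytime a \<Longrightarrow> polytime (\<lambda>e. dtl (a e))"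
  by (rule polytime_cong[where f = "\<lambda>e. case a e of Atom \<Rightarrow> Atom | data.Pair x y \<Rightarrow> y"])
    (intro polytime_intros, auto split: data.split)

lemma polytime_gate_branch:
  fixes f :: "'a::encodable \<times> 't::encodable \<Rightarrow> 'b::encodable"
  assumes g: "polytime (g :: 'a \<Rightarrow> gate)" and f: "polytime f" and k: "polytime k"
    and h: "\<And>x. dhd (encode (g x)) = tag \<Longrightarrow> \<exists>y. dtl (encode (g x)) = encode y \<and> h x = f (x, y)"
      "\<And>x. dhd (encode (g x)) \<noteq> tag \<Longrightarrow> h x = k x"
  shows "polytime h"
\<comment> \<open>The payload may itself be \<open>Atom\<close>, for instance for position 0.
  Pairing it with an atom makes the scrutinee true exactly when the tag matches.\<close>
proof (rule polytime_branch[where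
      c = "\<lambda>x. if dhd (encode (g x)) = tag then data.Pair Atom (dtl (encode (g x))) else Atom"
      and f = "\<lambda>p :: 'a \<times> data \<times> 't. f (fst p, snd (snd p))" and g = k])
  show "polytime (\<lambda>x. if dhd (encode (g x)) = tag then data.Pair Atom (dtl (encode (g x))) else Atom)"
    by (intro polytime_intros polytime_dhd polytime_dtl g)
  show "polytime (\<lambda>p :: 'a \<times> data \<times> 't. f (fst p, snd (snd p)))"
    by (rule polytime_comp[OF f]) (intro polytime_intros)
  fix x
  show "h x = k x" if "encode (if dhd (encode (g x)) = tag then data.Pair Atom (dtl (encode (g x))) else Atom) = Atom"
    using that h(2) by (auto split: if_splits)
  assume "encode (if dhd (encode (g x)) = tag then data.Pair Atom (dtl (encode (g x))) else Atom) \<noteq> Atom"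
  then have tag: "dhd (encode (g x)) = tag" by (auto split: if_splits)
  from h(1)[OF this] obtain y where "dtl (encode (g x)) = encode y" "h x = f (x, y)" by blast
  with tag show "\<exists>y::data \<times> 't. encode (if dhd (encode (g x)) = tag then data.Pair Atom (dtl (encode (g x))) else Atom)
      = encode y \<and> h x = f (fst (x, y), snd (snd (x, y)))"
    by (intro exI[of _ "(Atom, y)"]) simp
qed (rule k)

lemma polytime_case_gate:
  assumes g: "polytime g" and a: "polytime a" and b: "polytime (\<lambda>p. b (fst p) (snd p))"
    and c: "polytime (\<lambda>p. c (fst p) (snd p))" and d: "polytime (\<lambda>p. d (fst p) (snd p))"
  shows "polytime (\<lambda>e. case g e of In \<Rightarrow> a e | Not j \<Rightarrow> b e j | And js \<Rightarrow> c e js | Or js \<Rightarrow> d e js)"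
proof -
  have 1: "polytime (\<lambda>e. case g e of In \<Rightarrow> a e | Not _ \<Rightarrow> a e | And _ \<Rightarrow> a e | Or js \<Rightarrow> d e js)"
  proof (rule polytime_gate_branch[OF g d a, where tag = "encode (3::nat)"])
    fix e
    show "\<exists>js. dtl (encode (g e)) = encode js \<and>
        (case g e of In \<Rightarrow> a e | Not _ \<Rightarrow> a e | And _ \<Rightarrow> a e | Or js \<Rightarrow> d e js) = d (fst (e, js)) (snd (e, js))"
      if "dhd (encode (g e)) = encode (3::nat)"
      using that by (cases "g e") (auto simp: numeral_3_eq_3 numeral_2_eq_2)
  qed (auto split: gate.split)
  have 2: "polytime (\<lambda>e. case g e of In \<Rightarrow> a e | Not _ \<Rightarrow> a e | And js \<Rightarrow> c e js | Or js \<Rightarrow> d e js)"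
  proof (rule polytime_gate_branch[OF g c 1, where tag = "encode (2::nat)"])
    fix e
    show "\<exists>js. dtl (encode (g e)) = encode js \<and>
        (case g e of In \<Rightarrow> a e | Not _ \<Rightarrow> a e | And js \<Rightarrow> c e js | Or js \<Rightarrow> d e js) = c (fst (e, js)) (snd (e, js))"
      if "dhd (encode (g e)) = encode (2::nat)"
      using that by (cases "g e") (auto simp: numeral_3_eq_3 numeral_2_eq_2)
  qed (auto split: gate.split)
  show ?thesis
  proof (rule polytime_gate_branch[OF g b 2, where tag = "encode (1::nat)"])
    fix e
    show "\<exists>j. dtl (encode (g e)) = encode j \<and>
        (case g e of In \<Rightarrow> a e | Not j \<Rightarrow> b e j | And js \<Rightarrow> c e js | Or js \<Rightarrow> d e js) = b (fst (e, j)) (snd (e, j))"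
      if "dhd (encode (g e)) = encode (1::nat)"
      using that by (cases "g e") (auto simp: numeral_3_eq_3 numeral_2_eq_2)
  qed (auto split: gate.split)
qed

lemma polytime_gates:
  "polytime (a :: _ \<Rightarrow> nat) \<Longrightarrow> polytime (\<lambda>e. Not (a e))"
  "polytime as \<Longrightarrow> polytime (\<lambda>e. And (as e))"
  "polytime as \<Longrightarrow> polytime (\<lambda>e. Or (as e))"
  subgoal by (rule polytime_cong[where f = "\<lambda>e. (1::nat, a e)"]) (simp_all add: polytime_intros)
  subgoal by (rule polytime_cong[where f = "\<lambda>e. (2::nat, as e)"]) (simp_all add: polytime_intros)
  subgoal by (rule polytime_cong[where f = "\<lambda>e. (3::nat, as e)"]) (simp_all add: polytime_intros)
  done

lemma polytime_preds: "polytime g \<Longrightarrow> polytime (\<lambda>e. preds (g e))"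
  by (rule polytime_cong[where f = "\<lambda>e. case g e of In \<Rightarrow> [] | Not j \<Rightarrow> [j] | And js \<Rightarrow> js | Or js \<Rightarrow> js"])
    (intro polytime_intros polytime_case_gate, auto split: gate.split)

lemmas polytime_gate_intros = polytime_intros polytime_dhd polytime_dtl polytime_case_gate polytime_gates polytime_preds

subsection \<open>Parsing\<close>

primrec dlist :: "data \<Rightarrow> data list" where
  "dlist Atom = []"
| "dlist (data.Pair x y) = x # dlist y"

lemma encode_dlist: "encode (dlist d) = d"
  by (induction d) auto

lemma dlist_encode: "dlist (encode xs) = map encode xs"
  by (induction xs) auto

lemma length_dlist_encode [simp]: "length (dlist (encode n)) = n"
  by (induction n) auto

lemma polytime_dlist: "polytime a \<Longrightarrow> polytime (\<lambda>e. dlist (a e))"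
  by (rule polytime_cong[where f = a]) (simp_all add: encode_dlist)

text \<open>The parser is total: malformed trees also yield some gate, and every tag from 3 on is
  read as \<open>Or\<close>. Such inputs are recognised later by encoding the result again.\<close>

definition gate_of :: "data \<Rightarrow> gate" where
  "gate_of d =
    (if length (dlist (dhd d)) = 0 then In
     else if length (dlist (dhd d)) = 1 then Not (length (dlist (dtl d)))
     else if length (dlist (dhd d)) = 2 then And (map (\<lambda>x. length (dlist x)) (dlist (dtl d)))
     else Or (map (\<lambda>x. length (dlist x)) (dlist (dtl d))))"

definition circuit_of :: "data \<Rightarrow> circuit" where
  "circuit_of d = map gate_of (dlist d)"

lemma gate_of_encode: "gate_of (encode g) = g"
  by (cases g) (simp_all add: gate_of_def dlist_encode o_def del: encode_nat)

lemma circuit_of_encode: "circuit_of (encode C) = C"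
  by (simp add: circuit_of_def dlist_encode o_def gate_of_encode)

lemma polytime_circuit_of: "polytime x \<Longrightarrow> polytime (\<lambda>e. circuit_of (x e))"
proof (rule polytime_comp[where f = circuit_of])
  have gate_of: "polytime gate_of"
    unfolding gate_of_def by (intro polytime_gate_intros polytime_dlist)
  show "polytime circuit_of"
    unfolding circuit_of_def by (intro polytime_intros polytime_dlist polytime_comp[OF gate_of])
qed

subsection \<open>Gate-wise evaluation\<close>

definition gate_values :: "('a list \<Rightarrow> gate \<Rightarrow> 'a) \<Rightarrow> circuit \<Rightarrow> 'a list" where
  "gate_values step C = foldl (\<lambda>vs g. vs @ [step vs g]) [] C"

lemma length_gate_values [simp]: "length (gate_values step C) = length C"
  unfolding gate_values_def by (induction C rule: rev_induct) auto

lemma gate_values_nth: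
  "i < length C \<Longrightarrow> gate_values step C ! i = step (take i (gate_values step C)) (C ! i)"
proof (induction C rule: rev_induct)
  case (snoc g C)
  have *: "gate_values step (C @ [g]) = gate_values step C @ [step (gate_values step C) g]"
    by (simp add: gate_values_def)
  show ?case
    using snoc by (cases "i = length C") (auto simp: * nth_append)
qed simp

lemma eval_circuit_conv:
  assumes "C \<noteq> []"
  shows "eval_circuit step C = gate_values step C ! (length C - 1)"
proof -
  have "gate_values step C \<noteq> []" using assms by (metis length_gate_values length_0_conv)
  then show ?thesis
    unfolding eval_circuit_def gate_values_def[symmetric] by (simp add: last_conv_nth)
qed

lemma wf_preds: "wf_circuit C \<Longrightarrow> i < length C \<Longrightarrow> j \<in> set (preds (C ! i)) \<Longrightarrow> j < i"
  by (simp add: wf_circuit_def)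

lemma wf_fanin: "wf_circuit C \<Longrightarrow> i < length C \<Longrightarrow> C ! i = And js \<or> C ! i = Or js \<Longrightarrow> 2 \<le> length js"
  unfolding wf_circuit_def by (metis nth_mem)

definition gate_at :: "circuit \<Rightarrow> nat \<Rightarrow> gate" where
  "gate_at C i = lookup In C i"

lemma gate_at_nth [simp]: "i < length C \<Longrightarrow> gate_at C i = C ! i"
  by (simp add: gate_at_def)

context
  fixes C :: circuit
  assumes wf: "wf_circuit C"
begin

text \<open>Predecessors in a well-formed circuit come before the gate, so the restriction to a
  prefix in \<open>gate_values_nth\<close> is invisible.\<close>

lemma value_nth:
  fixes X defines "v \<equiv> \<lambda>i. gate_values (gate_value X) C ! i"
  assumes i: "i < length C"
  shows "v i = (case C ! i of In \<Rightarrow> i \<in> X | Not j \<Rightarrow> \<not> v j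
    | And js \<Rightarrow> \<forall>j\<in>set js. v j | Or js \<Rightarrow> \<exists>j\<in>set js. v j)"
  using wf_preds[OF wf i] i unfolding v_def gate_values_nth[OF i]
  by (auto split: gate.split)

text \<open>Fan-in at least 2 keeps the sets under \<open>Max\<close> nonempty, so a bound on the
  maximum is a bound on every predecessor. The same reason is behind
  \<open>weft_nth\<close>.\<close>

lemma depth_nth:
  fixes D :: "nat \<Rightarrow> nat" defines "D \<equiv> \<lambda>i. gate_values gate_depth C ! i"
  assumes i: "i < length C"
  shows "D i \<le> Suc n \<longleftrightarrow> (\<forall>j\<in>set (preds (C ! i)). D j \<le> n)" "D i = 0 \<longleftrightarrow> C ! i = In"
proof -
  have D: "D i = gate_depth (take i (gate_values gate_depth C)) (C ! i)"
    unfolding D_def by (rule gate_values_nth[OF i])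
  have nth: "take i (gate_values gate_depth C) ! j = D j" if "j \<in> set (preds (C ! i))" for j
    using wf_preds[OF wf i that] by (simp add: D_def)
  have ne: "C ! i = And js \<or> C ! i = Or js \<Longrightarrow> js \<noteq> []" for js
    using wf_fanin[OF wf i, of js] by auto
  show "D i \<le> Suc n \<longleftrightarrow> (\<forall>j\<in>set (preds (C ! i)). D j \<le> n)"
    unfolding D using nth ne by (cases "C ! i") auto
  show "D i = 0 \<longleftrightarrow> C ! i = In"
    unfolding D by (cases "C ! i") auto
qed

lemma weft_nth:
  fixes V :: "nat \<Rightarrow> nat" defines "V \<equiv> \<lambda>i. gate_values gate_weft C ! i"
  assumes i: "i < length C"
  shows "V i = 0 \<longleftrightarrow> length (preds (C ! i)) \<le> 2 \<and> (\<forall>j\<in>set (preds (C ! i)). V j = 0)"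
    "V i \<le> 1 \<longleftrightarrow> (\<forall>j\<in>set (preds (C ! i)). V j \<le> (if length (preds (C ! i)) \<le> 2 then 1 else 0))"
    "C ! i = In \<Longrightarrow> V i = 0"
proof -
  have V: "V i = gate_weft (take i (gate_values gate_weft C)) (C ! i)"
    unfolding V_def by (rule gate_values_nth[OF i])
  have nth: "take i (gate_values gate_weft C) ! j = V j" if "j \<in> set (preds (C ! i))" for j
    using wf_preds[OF wf i that] by (simp add: V_def)
  have ne: "C ! i = And js \<or> C ! i = Or js \<Longrightarrow> js \<noteq> []" for js
    using wf_fanin[OF wf i, of js] by auto
  have Max: "Max (f ` set js) \<le> k \<longleftrightarrow> (\<forall>j\<in>set js. f j \<le> k)" if "js \<noteq> []" for f :: "nat \<Rightarrow> nat" and js k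
    using that by simp
  show "V i = 0 \<longleftrightarrow> length (preds (C ! i)) \<le> 2 \<and> (\<forall>j\<in>set (preds (C ! i)). V j = 0)"
    unfolding V using nth ne Max[of _ _ 0] by (cases "C ! i") auto
  show "V i \<le> 1 \<longleftrightarrow> (\<forall>j\<in>set (preds (C ! i)). V j \<le> (if length (preds (C ! i)) \<le> 2 then 1 else 0))"
    unfolding V using nth ne Max[of _ _ 0] by (cases "C ! i") auto
  show "C ! i = In \<Longrightarrow> V i = 0"
    unfolding V by simp
qed

end

text \<open>Recursion on the depth bound: each level is a polynomial-time function of the one below, so no
  size estimates are needed.  \<open>weft0\<close> and \<open>weft1\<close> say that depth is at most \<open>n\<close> and weft at most 0 or 1.\<close>

primrec weft0 :: "nat \<Rightarrow> circuit \<Rightarrow> nat \<Rightarrow> bool" where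
  "weft0 0 C i \<longleftrightarrow> gate_at C i = In"
| "weft0 (Suc n) C i \<longleftrightarrow> length (preds (gate_at C i)) \<le> 2 \<and> list_all (weft0 n C) (preds (gate_at C i))"

primrec weft1 :: "nat \<Rightarrow> circuit \<Rightarrow> nat \<Rightarrow> bool" where
  "weft1 0 C i \<longleftrightarrow> gate_at C i = In"
| "weft1 (Suc n) C i \<longleftrightarrow> (if length (preds (gate_at C i)) \<le> 2 then list_all (weft1 n C) (preds (gate_at C i))
     else list_all (weft0 n C) (preds (gate_at C i)))"

lemma weft0_iff:
  assumes wf: "wf_circuit C"
  shows "i < length C \<Longrightarrow> weft0 n C i \<longleftrightarrow> gate_values gate_depth C ! i \<le> n \<and> gate_values gate_weft C ! i = 0"
proof (induction n arbitrary: i)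
  case 0
  then show ?case using depth_nth(2)[OF wf 0] weft_nth(3)[OF wf 0] by auto
next
  case (Suc n)
  have "weft0 n C j \<longleftrightarrow> gate_values gate_depth C ! j \<le> n \<and> gate_values gate_weft C ! j = 0"
    if "j \<in> set (preds (C ! i))" for j
    using Suc wf_preds[OF wf Suc.prems that] by simp
  then show ?case
    using Suc.prems unfolding depth_nth(1)[OF wf Suc.prems] weft_nth(1)[OF wf Suc.prems]
    by (auto simp: list_all_iff)
qed

lemma weft1_iff:
  assumes wf: "wf_circuit C"
  shows "i < length C \<Longrightarrow> weft1 n C i \<longleftrightarrow> gate_values gate_depth C ! i \<le> n \<and> gate_values gate_weft C ! i \<le> 1"
proof (induction n arbitrary: i)
  case 0
  then show ?case using depth_nth(2)[OF wf 0] weft_nth(3)[OF wf 0] by auto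
next
  case (Suc n)
  have "weft1 n C j \<longleftrightarrow> gate_values gate_depth C ! j \<le> n \<and> gate_values gate_weft C ! j \<le> 1"
    "weft0 n C j \<longleftrightarrow> gate_values gate_depth C ! j \<le> n \<and> gate_values gate_weft C ! j = 0"
    if "j \<in> set (preds (C ! i))" for j
    using Suc wf_preds[OF wf Suc.prems that] weft0_iff[OF wf] by simp_all
  then show ?case
    using Suc.prems unfolding depth_nth(1)[OF wf Suc.prems] weft_nth(2)[OF wf Suc.prems]
    by (auto simp: list_all_iff)
qed

definition wf_check :: "circuit \<Rightarrow> bool" where
  "wf_check C \<longleftrightarrow> C \<noteq> [] \<and> list_all (\<lambda>i. list_all (\<lambda>j. j < i) (preds (gate_at C i)) \<and>
     (case gate_at C i of In \<Rightarrow> True | Not j \<Rightarrow> True | And js \<Rightarrow> 2 \<le> length js | Or js \<Rightarrow> 2 \<le> length js)) [0..<length C]"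

lemma wf_check_iff: "wf_check C \<longleftrightarrow> wf_circuit C"
proof -
  have "(\<forall>js. And js \<in> set C \<or> Or js \<in> set C \<longrightarrow> 2 \<le> length js) \<longleftrightarrow>
    (\<forall>i<length C. case C ! i of In \<Rightarrow> True | Not j \<Rightarrow> True | And js \<Rightarrow> 2 \<le> length js | Or js \<Rightarrow> 2 \<le> length js)"
    unfolding in_set_conv_nth by (auto split: gate.split)
  then show ?thesis
    unfolding wf_check_def wf_circuit_def by (auto simp: list_all_iff)
qed

lemma polytime_gate_at: "polytime C \<Longrightarrow> polytime i \<Longrightarrow> polytime (\<lambda>e. gate_at (C e) (i e))"
  unfolding gate_at_def by (intro polytime_intros)

lemma polytime_weft0: "polytime C \<Longrightarrow> polytime i \<Longrightarrow> polytime (\<lambda>e. weft0 n (C e) (i e))"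
proof (rule polytime_app2[where f = "weft0 n"])
  show "polytime (\<lambda>p. weft0 n (fst p) (snd p))"
  proof (induction n)
    case (Suc n)
    show ?case unfolding weft0.simps
      by (intro polytime_gate_intros polytime_gate_at polytime_app2[where f = "weft0 n", OF Suc])
  qed (simp, intro polytime_intros polytime_gate_at)
qed

lemma polytime_weft1: "polytime C \<Longrightarrow> polytime i \<Longrightarrow> polytime (\<lambda>e. weft1 n (C e) (i e))"
proof (rule polytime_app2[where f = "weft1 n"])
  show "polytime (\<lambda>p. weft1 n (fst p) (snd p))"
  proof (induction n)
    case (Suc n)
    show ?case unfolding weft1.simps
      by (intro polytime_gate_intros polytime_gate_at polytime_weft0 polytime_app2[where f = "weft1 n", OF Suc])
  qed (simp, intro polytime_intros polytime_gate_at)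
qed

lemma polytime_wf_check: "polytime C \<Longrightarrow> polytime (\<lambda>e. wf_check (C e))"
proof (rule polytime_comp[where f = wf_check])
  show "polytime wf_check"
    unfolding wf_check_def by (intro polytime_gate_intros polytime_gate_at)
qed


section \<open>Circuits of weft one as systems of counting constraints\<close>

text \<open>A list of monomials, each given by the list of its variables, stands for their sum; a pair of
  such lists for the difference of the sums.\<close>

type_synonym msum = "nat list list"

definition num_true :: "nat set \<Rightarrow> msum \<Rightarrow> nat" where
  "num_true X L = length (filter (\<lambda>\<mu>. set \<mu> \<subseteq> X) L)"

lemma num_true_append [simp]: "num_true X (L @ M) = num_true X L + num_true X M"
  and num_true_Nil [simp]: "num_true X [] = 0"
  and num_true_Cons: "num_true X (\<mu> # L) = of_bool (set \<mu> \<subseteq> X) + num_true X L"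
  by (simp_all add: num_true_def)

lemma num_true_le_length: "num_true X L \<le> length L"
  by (simp add: num_true_def)

section \<open>Gates of weft 0 as differences of sums of monomials\<close>

definition lmult :: "msum \<Rightarrow> msum \<Rightarrow> msum" where
  "lmult L M = concat (map (\<lambda>\<mu>. map (\<lambda>\<nu>. \<mu> @ \<nu>) M) L)"

text \<open>Appending two monomials multiplies their truth values, so this is the distributive law;
  repeated variables do no harm.\<close>

lemma num_true_lmult: "num_true X (lmult L M) = num_true X L * num_true X M"
proof (induction L)
  case (Cons \<mu> L)
  have "num_true X (map (\<lambda>\<nu>. \<mu> @ \<nu>) M) = of_bool (set \<mu> \<subseteq> X) * num_true X M"
    by (induction M) (auto simp: num_true_Cons)
  then show ?case using Cons by (simp add: lmult_def num_true_Cons algebra_simps)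
qed (simp add: lmult_def)

text \<open>The polynomial \<open>1 - p\<close>: the empty monomial is true under every
  \<open>X\<close>, and exchanging the two sums changes the sign.\<close>

definition pneg :: "msum \<times> msum \<Rightarrow> msum \<times> msum" where
  "pneg p = ([] # snd p, fst p)"

text \<open>The expansion of \<open>(a - b) * (c - d)\<close>, with positive and negative products
  collected separately.\<close>

definition pmult :: "msum \<times> msum \<Rightarrow> msum \<times> msum \<Rightarrow> msum \<times> msum" where
  "pmult p q = (lmult (fst p) (fst q) @ lmult (snd p) (snd q), lmult (fst p) (snd q) @ lmult (snd p) (fst q))"

definition psum :: "(msum \<times> msum) list \<Rightarrow> msum \<times> msum" where
  "psum ps = (concat (map fst ps), concat (map snd ps))"

definition represents :: "nat set \<Rightarrow> msum \<times> msum \<Rightarrow> bool \<Rightarrow> bool" where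
  "represents X p b \<longleftrightarrow> num_true X (fst p) = num_true X (snd p) + of_bool b"

lemma represents_input: "represents X ([[i]], []) (i \<in> X)"
  by (simp add: represents_def num_true_Cons)

lemma represents_pneg: "represents X p b \<Longrightarrow> represents X (pneg p) (\<not> b)"
  by (cases b) (simp_all add: represents_def pneg_def num_true_Cons)

lemma represents_pmult: "represents X p b \<Longrightarrow> represents X q c \<Longrightarrow> represents X (pmult p q) (b \<and> c)"
  by (cases b; cases c) (simp_all add: represents_def pmult_def num_true_lmult algebra_simps)

lemma num_true_psum:
  assumes "\<And>j. j \<in> set js \<Longrightarrow> represents X (p j) (b j)"
  shows "num_true X (fst (psum (map p js))) = num_true X (snd (psum (map p js))) + length (filter b js)"
  using assms by (induction js) (auto simp: psum_def represents_def)

text \<open>Meant for gates satisfying \<open>weft0 n\<close>, where the first two predecessors of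
  an \<open>And\<close> or \<open>Or\<close> are all of them. \<open>Or\<close> is obtained by De
  Morgan.\<close>

primrec gate_poly :: "nat \<Rightarrow> circuit \<Rightarrow> nat \<Rightarrow> msum \<times> msum" where
  "gate_poly 0 C i = ([[i]], [])"
| "gate_poly (Suc n) C i = (case gate_at C i of
      In \<Rightarrow> ([[i]], [])
    | Not j \<Rightarrow> pneg (gate_poly n C j)
    | And js \<Rightarrow> pmult (gate_poly n C (lookup 0 js 0)) (gate_poly n C (lookup 0 js 1))
    | Or js \<Rightarrow> pneg (pmult (pneg (gate_poly n C (lookup 0 js 0))) (pneg (gate_poly n C (lookup 0 js 1)))))"

section \<open>Certificates: exact values of sums\<close>

type_synonym cert = "(msum \<times> nat) list"

definition sat :: "nat set \<Rightarrow> cert \<Rightarrow> bool" where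
  "sat X z \<longleftrightarrow> (\<forall>c\<in>set z. num_true X (fst c) = snd c)"

text \<open>Both sums are guessed, each being at most its number of monomials. Falsity is equality,
  because the difference is never negative where this is applied.\<close>

definition split_certs :: "msum \<times> msum \<Rightarrow> cert list \<times> cert list" where
  "split_certs p =
    (map (\<lambda>ab. [(fst p, fst ab), (snd p, snd ab)])
       (filter (\<lambda>ab. snd ab < fst ab) (List.product [0..<Suc (length (fst p))] [0..<Suc (length (snd p))])),
     map (\<lambda>ab. [(fst p, fst ab), (snd p, snd ab)])
       (filter (\<lambda>ab. fst ab = snd ab) (List.product [0..<Suc (length (fst p))] [0..<Suc (length (snd p))])))"

text \<open>Truth needs a certificate for each conjunct, falsity a certificate against one of them.
  Disjunction is derived by swapping.\<close>

definition and_certs :: "cert list \<times> cert list \<Rightarrow> cert list \<times> cert list \<Rightarrow> cert list \<times> cert list" where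
  "and_certs c d = (concat (map (\<lambda>z. map (\<lambda>w. z @ w) (fst d)) (fst c)), snd c @ snd d)"

definition not_certs :: "cert list \<times> cert list \<Rightarrow> cert list \<times> cert list" where
  "not_certs c = (snd c, fst c)"

text \<open>The two components certify truth and falsity of the gate.\<close>

primrec gate_certs :: "nat \<Rightarrow> circuit \<Rightarrow> nat \<Rightarrow> cert list \<times> cert list" where
  "gate_certs 0 C i = split_certs ([[i]], [])"
| "gate_certs (Suc n) C i = (case gate_at C i of
      In \<Rightarrow> split_certs ([[i]], [])
    | Not j \<Rightarrow> not_certs (gate_certs n C j)
    | And js \<Rightarrow> if length js \<le> 2 then and_certs (gate_certs n C (lookup 0 js 0)) (gate_certs n C (lookup 0 js 1))
        else not_certs (split_certs (psum (map (\<lambda>j. pneg (gate_poly n C j)) js)))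
    | Or js \<Rightarrow> if length js \<le> 2 then not_certs (and_certs (not_certs (gate_certs n C (lookup 0 js 0)))
          (not_certs (gate_certs n C (lookup 0 js 1))))
        else split_certs (psum (map (\<lambda>j. gate_poly n C j) js)))"

definition decides :: "nat set \<Rightarrow> cert list \<times> cert list \<Rightarrow> bool \<Rightarrow> bool" where
  "decides X c b \<longleftrightarrow> (b \<longleftrightarrow> (\<exists>z\<in>set (fst c). sat X z)) \<and> (\<not> b \<longleftrightarrow> (\<exists>z\<in>set (snd c). sat X z))"

lemma decides_split:
  assumes "num_true X (snd p) \<le> num_true X (fst p)"
  shows "decides X (split_certs p) (num_true X (snd p) < num_true X (fst p))"
proof -
  \<comment> \<open>Only the pair of actual counts under \<open>X\<close> satisfies its certificate,
    and \<open>num_true_le_length\<close> puts this pair into the enumerated range.\<close>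
  have *: "(\<exists>z\<in>set (map (\<lambda>ab. [(fst p, fst ab), (snd p, snd ab)])
       (filter Q (List.product [0..<Suc (length (fst p))] [0..<Suc (length (snd p))]))). sat X z) \<longleftrightarrow>
     Q (num_true X (fst p), num_true X (snd p))" for Q
    using num_true_le_length[of X "fst p"] num_true_le_length[of X "snd p"]
    by (auto simp: sat_def less_Suc_eq_le simp del: upt_Suc)
  show ?thesis
    unfolding decides_def split_certs_def fst_conv snd_conv * using assms by auto
qed

lemma decides_not: "decides X c b \<Longrightarrow> decides X (not_certs c) (\<not> b)"
  by (auto simp: decides_def not_certs_def)

lemma decides_and: "decides X c b \<Longrightarrow> decides X d b' \<Longrightarrow> decides X (and_certs c d) (b \<and> b')"
proof -
  have "sat X (z @ w) \<longleftrightarrow> sat X z \<and> sat X w" for z w by (auto simp: sat_def)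
  then have "(\<exists>y\<in>set (fst (and_certs c d)). sat X y) \<longleftrightarrow>
      (\<exists>z\<in>set (fst c). sat X z) \<and> (\<exists>w\<in>set (fst d). sat X w)"
    by (auto simp: and_certs_def)
  moreover have "(\<exists>y\<in>set (snd (and_certs c d)). sat X y) \<longleftrightarrow>
      (\<exists>z\<in>set (snd c). sat X z) \<or> (\<exists>w\<in>set (snd d). sat X w)"
    by (auto simp: and_certs_def)
  moreover assume "decides X c b" "decides X d b'"
  ultimately show ?thesis unfolding decides_def by blast
qed

context
  fixes C :: circuit and X :: "nat set"
  assumes wf: "wf_circuit C"
begin

abbreviation gval :: "nat \<Rightarrow> bool" where
  "gval i \<equiv> gate_values (gate_value X) C ! i"

lemma gate_cases_small:
  assumes i: "i < length C" and g: "C ! i = And js \<or> C ! i = Or js" and "length js \<le> 2"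
  obtains a b where "js = [a, b]"
proof -
  have "length js = 2" using wf_fanin[OF wf i g] assms(3) by simp
  then show ?thesis using that by (auto simp: numeral_2_eq_2 length_Suc_conv)
qed

lemma represents_gate_poly: "i < length C \<Longrightarrow> weft0 n C i \<Longrightarrow> represents X (gate_poly n C i) (gval i)"
proof (induction n arbitrary: i)
  case 0
  then show ?case using value_nth[OF wf 0(1), of X] represents_input by auto
next
  case (Suc n)
  note i = Suc.prems(1)
  have IH: "represents X (gate_poly n C j) (gval j)" if "j \<in> set (preds (C ! i))" for j
    using Suc wf_preds[OF wf i that] that by (auto simp: list_all_iff)
  note v = value_nth[OF wf i, of X]
  show ?case
  proof (cases "C ! i")
    case In
    then show ?thesis using i v represents_input by auto
  next
    case (Not j)
    then show ?thesis using i v IH represents_pneg by auto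
  next
    case (And js)
    then obtain a b where ab: "js = [a, b]"
      using gate_cases_small[OF i, of js] Suc.prems by auto
    then show ?thesis using represents_pmult[OF IH IH, of a b] i v And by simp
  next
    case (Or js)
    then obtain a b where ab: "js = [a, b]"
      using gate_cases_small[OF i, of js] Suc.prems by auto
    then show ?thesis
      using represents_pneg[OF represents_pmult[OF represents_pneg[OF IH] represents_pneg[OF IH]], of a b] i v Or by simp
  qed
qed

text \<open>The difference of the two sums counts the true gates: it is positive iff one of them is
  true, and never negative, as \<open>decides_split\<close> requires.\<close>

lemma decides_psum:
  assumes "\<And>j. j \<in> set js \<Longrightarrow> represents X (p j) (b j)"
  shows "decides X (split_certs (psum (map p js))) (\<exists>j\<in>set js. b j)"
proof -
  have eq: "num_true X (fst (psum (map p js))) = num_true X (snd (psum (map p js))) + length (filter b js)"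
    using assms by (rule num_true_psum)
  have *: "(\<exists>j\<in>set js. b j) \<longleftrightarrow> num_true X (snd (psum (map p js))) < num_true X (fst (psum (map p js)))"
    unfolding eq by (auto simp: filter_empty_conv)
  show ?thesis unfolding * by (rule decides_split) (simp add: eq)
qed

text \<open>In weft 1 a large gate has predecessors of weft 0 only, which \<open>gate_poly\<close>
  represents; small gates combine the certificates of their predecessors.\<close>

lemma decides_gate_certs: "i < length C \<Longrightarrow> weft1 n C i \<Longrightarrow> decides X (gate_certs n C i) (gval i)"
proof (induction n arbitrary: i)
  case 0
  then show ?case
    using value_nth[OF wf 0(1), of X] decides_split[of X "([[i]], [])"] by (auto simp: num_true_Cons)
next
  case (Suc n)
  note i = Suc.prems(1)
  have IH: "decides X (gate_certs n C j) (gval j)"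
    if "j \<in> set (preds (C ! i))" "length (preds (C ! i)) \<le> 2" for j
    using Suc wf_preds[OF wf i that(1)] that by (auto simp: list_all_iff)
  have poly: "represents X (gate_poly n C j) (gval j)"
    if "j \<in> set (preds (C ! i))" "\<not> length (preds (C ! i)) \<le> 2" for j
    using Suc represents_gate_poly wf_preds[OF wf i that(1)] that by (auto simp: list_all_iff)
  note v = value_nth[OF wf i, of X]
  show ?case
  proof (cases "C ! i")
    case In
    then show ?thesis using i v decides_split[of X "([[i]], [])"] by (auto simp: num_true_Cons)
  next
    case (Not j)
    then show ?thesis using i v IH decides_not by auto
  next
    case (And js)
    show ?thesis
    proof (cases "length js \<le> 2")
      case True
      then obtain a b where ab: "js = [a, b]"
        using gate_cases_small[OF i, of js] And by auto
      then show ?thesis using decides_and[OF IH IH, of a b] i v And by simp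
    next
      case False
      \<comment> \<open>A large \<open>And\<close> fails iff some negated predecessor holds, so the
        sum of the negations is tested and the answer swapped.\<close>
      then have "decides X (not_certs (split_certs (psum (map (\<lambda>j. pneg (gate_poly n C j)) js)))) (\<not> (\<exists>j\<in>set js. \<not> gval j))"
        using And by (intro decides_not decides_psum represents_pneg poly) auto
      then show ?thesis using i v And False by simp
    qed
  next
    case (Or js)
    show ?thesis
    proof (cases "length js \<le> 2")
      case True
      then obtain a b where ab: "js = [a, b]"
        using gate_cases_small[OF i, of js] Or by auto
      then show ?thesis
        using decides_not[OF decides_and[OF decides_not[OF IH] decides_not[OF IH]], of a b] i v Or by simp
    next
      case False
      then have "decides X (split_certs (psum (map (\<lambda>j. gate_poly n C j) js))) (\<exists>j\<in>set js. gval j)"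
        using Or by (intro decides_psum poly) auto
      then show ?thesis using i v Or False by simp
    qed
  qed
qed

end

section \<open>Degree bounds\<close>

definition max_mono_length :: "nat \<Rightarrow> msum \<Rightarrow> bool" where
  "max_mono_length D L \<longleftrightarrow> (\<forall>\<mu>\<in>set L. length \<mu> \<le> D)"

definition certs_bounded :: "nat \<Rightarrow> cert list \<times> cert list \<Rightarrow> bool" where
  "certs_bounded D c \<longleftrightarrow> (\<forall>z\<in>set (fst c) \<union> set (snd c). \<forall>(L, a)\<in>set z. max_mono_length D L)"

lemma max_mono_length_mono: "max_mono_length D L \<Longrightarrow> D \<le> E \<Longrightarrow> max_mono_length E L"
  by (auto simp: max_mono_length_def)

lemma max_mono_length_lmult:
  "max_mono_length D L \<Longrightarrow> max_mono_length E M \<Longrightarrow> max_mono_length (D + E) (lmult L M)"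
  by (auto simp: max_mono_length_def lmult_def intro: add_mono)

lemma max_mono_length_append [simp]:
  "max_mono_length D (L @ M) \<longleftrightarrow> max_mono_length D L \<and> max_mono_length D M"
  by (auto simp: max_mono_length_def)

text \<open>Degrees grow only by multiplication, which at most doubles the bound per level. This
  yields the constant tuple length \<open>2 ^ n\<close>.\<close>

lemma gate_poly_bounded: "max_mono_length (2 ^ n) (fst (gate_poly n C i)) \<and> max_mono_length (2 ^ n) (snd (gate_poly n C i))"
proof (induction n arbitrary: i)
  case 0
  show ?case by (simp add: max_mono_length_def)
next
  case (Suc n)
  have le: "(2::nat) ^ n \<le> 2 ^ Suc n" "(2::nat) ^ n + 2 ^ n = 2 ^ Suc n" by simp_all
  have neg: "max_mono_length D (fst (pneg p)) \<and> max_mono_length D (snd (pneg p))"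
    if "max_mono_length D (fst p) \<and> max_mono_length D (snd p)" for p D
    using that by (simp add: pneg_def max_mono_length_def)
  have mult: "max_mono_length (2 ^ Suc n) (fst (pmult p q)) \<and> max_mono_length (2 ^ Suc n) (snd (pmult p q))"
    if "max_mono_length (2 ^ n) (fst p) \<and> max_mono_length (2 ^ n) (snd p)"
      "max_mono_length (2 ^ n) (fst q) \<and> max_mono_length (2 ^ n) (snd q)" for p q
    unfolding pmult_def le(2)[symmetric] using that by (simp add: max_mono_length_lmult)
  have mono: "max_mono_length (2 ^ Suc n) L" if "max_mono_length (2 ^ n) L" for L
    using that le(1) by (rule max_mono_length_mono)
  have in': "max_mono_length (2 ^ Suc n) [[i]] \<and> max_mono_length (2 ^ Suc n) []" for i
    by (simp add: max_mono_length_def)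
  show ?case
    using Suc.IH by (simp only: gate_poly.simps split: gate.split) (auto intro!: neg mult simp: in' mono neg simp del: power_Suc)
qed

lemma gate_certs_bounded: "certs_bounded (2 ^ n) (gate_certs n C i)"
proof (induction n arbitrary: i)
  case 0
  show ?case by (auto simp: certs_bounded_def split_certs_def max_mono_length_def)
next
  case (Suc n)
  have le: "(2::nat) ^ n \<le> 2 ^ Suc n" by simp
  have split: "certs_bounded D (split_certs p)" if "max_mono_length D (fst p)" "max_mono_length D (snd p)" for D p
    using that by (auto simp: certs_bounded_def split_certs_def)
  have not: "certs_bounded D (not_certs c)" if "certs_bounded D c" for D c
    using that by (auto simp: certs_bounded_def not_certs_def)
  have "and": "certs_bounded D (and_certs c d)" if "certs_bounded D c" "certs_bounded D d" for D c d
    using that by (fastforce simp: certs_bounded_def and_certs_def)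
  have mono: "certs_bounded (2 ^ Suc n) c" if "certs_bounded (2 ^ n) c" for c
    using that max_mono_length_mono[OF _ le] by (fastforce simp: certs_bounded_def)
  have psum: "max_mono_length (2 ^ Suc n) (fst (psum (map p js))) \<and> max_mono_length (2 ^ Suc n) (snd (psum (map p js)))"
    if "\<And>j. max_mono_length (2 ^ n) (fst (p j)) \<and> max_mono_length (2 ^ n) (snd (p j))" for p js
    using that max_mono_length_mono[OF _ le] by (fastforce simp: psum_def max_mono_length_def)
  have neg: "max_mono_length (2 ^ n) (fst (pneg (gate_poly n C j))) \<and> max_mono_length (2 ^ n) (snd (pneg (gate_poly n C j)))" for j
    using gate_poly_bounded[of n C j] by (simp add: pneg_def max_mono_length_def)
  have in': "max_mono_length (2 ^ Suc n) [[i]]" "max_mono_length (2 ^ Suc n) []" for i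
    by (simp_all add: max_mono_length_def)
  note poly = psum[OF gate_poly_bounded] psum[OF neg]
  show ?case
    unfolding gate_certs.simps
    by (auto split: gate.split intro!: split not "and" mono[OF Suc.IH] simp: in' poly simp del: power_Suc)
qed

text \<open>Encoding the parsed circuit again detects trees that encode no circuit. A rejected input
  gets no certificates and thus becomes a no-instance.\<close>

definition circuit_certs :: "nat \<Rightarrow> data \<Rightarrow> cert list" where
  "circuit_certs n x = (if encode (circuit_of x) = x \<and> wf_check (circuit_of x) \<and>
       weft1 n (circuit_of x) (length (circuit_of x) - 1)
     then fst (gate_certs n (circuit_of x) (length (circuit_of x) - 1)) else [])"

definition input_list :: "data \<Rightarrow> nat list" where
  "input_list x = filter (\<lambda>i. gate_at (circuit_of x) i = In) [0..<length (circuit_of x)]"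

lemma circuit_certs_bounded: "z \<in> set (circuit_certs n x) \<Longrightarrow> (L, a) \<in> set z \<Longrightarrow> \<mu> \<in> set L \<Longrightarrow> length \<mu> \<le> 2 ^ n"
  using gate_certs_bounded[of n "circuit_of x" "length (circuit_of x) - 1"]
  unfolding circuit_certs_def certs_bounded_def max_mono_length_def by (fastforce split: if_splits)

text \<open>The encoding determines the circuit, so the quantifier over circuits collapses to
  \<open>circuit_of x\<close>. The certificates do not depend on \<open>X\<close>, hence can be
  chosen before it.\<close>

lemma WCS_iff_certs:
  "(x, k) \<in> WCS 1 n \<longleftrightarrow> (\<exists>z\<in>set (circuit_certs n x). \<exists>X\<subseteq>set (input_list x). card X = k \<and> sat X z)"
proof -
  define C where "C = circuit_of x"
  let ?i = "length C - 1"
  have inputs: "set (input_list x) = inputs C"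
    by (auto simp: input_list_def inputs_def C_def)
  have "(x, k) \<in> WCS 1 n \<longleftrightarrow> encode C = x \<and> wf_circuit C \<and> eval_circuit gate_weft C \<le> 1 \<and>
      eval_circuit gate_depth C \<le> n \<and> (\<exists>X\<subseteq>inputs C. card X = k \<and> eval_circuit (gate_value X) C)"
  proof -
    have "(x, k) \<in> WCS 1 n \<longleftrightarrow> (\<exists>C. x = encode C \<and> wf_circuit C \<and> eval_circuit gate_weft C \<le> 1 \<and>
      eval_circuit gate_depth C \<le> n \<and> (\<exists>X\<subseteq>inputs C. card X = k \<and> eval_circuit (gate_value X) C))"
      by (auto simp: WCS_def encode_circuit)
    also have "\<dots> \<longleftrightarrow> encode C = x \<and> wf_circuit C \<and> eval_circuit gate_weft C \<le> 1 \<and>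
      eval_circuit gate_depth C \<le> n \<and> (\<exists>X\<subseteq>inputs C. card X = k \<and> eval_circuit (gate_value X) C)"
      unfolding C_def by (metis circuit_of_encode)
    finally show ?thesis .
  qed
  also have "\<dots> \<longleftrightarrow> encode C = x \<and> wf_circuit C \<and> weft1 n C ?i \<and>
      (\<exists>X\<subseteq>inputs C. card X = k \<and> gate_values (gate_value X) C ! ?i)"
  proof (cases "wf_circuit C")
    case True
    then have ne: "C \<noteq> []" by (simp add: wf_circuit_def)
    then have "?i < length C" by (cases C) auto
    from weft1_iff[OF True this] show ?thesis unfolding eval_circuit_conv[OF ne] by auto
  qed simp
  also have "\<dots> \<longleftrightarrow> encode C = x \<and> wf_circuit C \<and> weft1 n C ?i \<and>
      (\<exists>X\<subseteq>inputs C. card X = k \<and> (\<exists>z\<in>set (fst (gate_certs n C ?i)). sat X z))"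
  proof (cases "wf_circuit C \<and> weft1 n C ?i")
    case True
    then have "?i < length C" by (cases C) (auto simp: wf_circuit_def)
    with True have "gate_values (gate_value X) C ! ?i \<longleftrightarrow> (\<exists>z\<in>set (fst (gate_certs n C ?i)). sat X z)" for X
      using decides_gate_certs[of C ?i n X] unfolding decides_def by blast
    then show ?thesis by simp
  qed auto
  also have "\<dots> \<longleftrightarrow> (\<exists>z\<in>set (circuit_certs n x). \<exists>X\<subseteq>inputs C. card X = k \<and> sat X z)"
    unfolding circuit_certs_def C_def[symmetric] wf_check_iff by auto
  finally show ?thesis unfolding inputs .
qed

subsection \<open>Polynomial time\<close>

lemma polytime_pneg: "polytime p \<Longrightarrow> polytime (\<lambda>e. pneg (p e))"
  unfolding pneg_def by (intro polytime_intros)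

lemma polytime_lmult: "polytime L \<Longrightarrow> polytime M \<Longrightarrow> polytime (\<lambda>e. lmult (L e) (M e))"
proof (rule polytime_app2[where f = lmult])
  show "polytime (\<lambda>p. lmult (fst p) (snd p))"
    unfolding lmult_def by (intro polytime_intros)
qed

lemma polytime_pmult: "polytime p \<Longrightarrow> polytime q \<Longrightarrow> polytime (\<lambda>e. pmult (p e) (q e))"
  unfolding pmult_def by (intro polytime_intros polytime_lmult)

lemma polytime_psum: "polytime ps \<Longrightarrow> polytime (\<lambda>e. psum (ps e))"
  unfolding psum_def by (intro polytime_intros)

lemma polytime_gate_poly: "polytime C \<Longrightarrow> polytime i \<Longrightarrow> polytime (\<lambda>e. gate_poly n (C e) (i e))"
proof (rule polytime_app2[where f = "gate_poly n"])
  show "polytime (\<lambda>p. gate_poly n (fst p) (snd p))"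
  proof (induction n)
    case (Suc n)
    show ?case unfolding gate_poly.simps
      by (intro polytime_gate_intros polytime_gate_at polytime_pneg polytime_pmult
          polytime_app2[where f = "gate_poly n", OF Suc])
  qed (simp, intro polytime_intros)
qed

lemma polytime_split_certs: "polytime p \<Longrightarrow> polytime (\<lambda>e. split_certs (p e))"
proof (rule polytime_comp[where f = split_certs])
  show "polytime split_certs"
    unfolding split_certs_def by (intro polytime_intros)
qed

lemma polytime_and_certs: "polytime c \<Longrightarrow> polytime d \<Longrightarrow> polytime (\<lambda>e. and_certs (c e) (d e))"
proof (rule polytime_app2[where f = and_certs])
  show "polytime (\<lambda>p. and_certs (fst p) (snd p))"
    unfolding and_certs_def by (intro polytime_intros)
qed

lemma polytime_not_certs: "polytime c \<Longrightarrow> polytime (\<lambda>e. not_certs (c e))"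
  unfolding not_certs_def by (intro polytime_intros)

lemma polytime_gate_certs: "polytime C \<Longrightarrow> polytime i \<Longrightarrow> polytime (\<lambda>e. gate_certs n (C e) (i e))"
proof (rule polytime_app2[where f = "gate_certs n"])
  show "polytime (\<lambda>p. gate_certs n (fst p) (snd p))"
  proof (induction n)
    case (Suc n)
    show ?case unfolding gate_certs.simps
      by (intro polytime_gate_intros polytime_gate_at polytime_pneg polytime_psum polytime_gate_poly
          polytime_split_certs polytime_and_certs polytime_not_certs
          polytime_app2[where f = "gate_certs n", OF Suc])
  qed (simp, intro polytime_intros polytime_split_certs)
qed

lemma polytime_circuit_certs: "polytime x \<Longrightarrow> polytime (\<lambda>e. circuit_certs n (x e))"
proof (rule polytime_comp[where f = "circuit_certs n"])
  show "polytime (circuit_certs n)"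
    unfolding circuit_certs_def
    by (intro polytime_intros polytime_circuit_of polytime_wf_check polytime_weft1 polytime_gate_certs)
qed

lemma polytime_input_list: "polytime x \<Longrightarrow> polytime (\<lambda>e. input_list (x e))"
proof (rule polytime_comp[where f = input_list])
  show "polytime input_list"
    unfolding input_list_def by (intro polytime_intros polytime_circuit_of polytime_gate_at)
qed


section \<open>Counting constraints as a sum of vectors\<close>

text \<open>For the certificate with number \<open>s\<close>, a solution consists of one vector \<open>Main s\<close>, entered
  negatively, one vector \<open>Slot s a x\<close> for each \<open>a \<le> k\<close>, saying that the \<open>a\<close>-th element of the assignment is
  \<open>x\<close>, and one vector \<open>Tup s \<rho>\<close> for each tuple of slots, repeating the elements chosen for them.
  Input \<open>i\<close> is represented by \<open>Suc i\<close>; slot 0 always holds 0, which pads short monomials.\<close>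

datatype elem = Main nat | Slot nat nat nat | Tup nat "(nat \<times> nat) list"

text \<open>Coordinates \<open>(c, s, \<tau>, j)\<close>: \<open>c = 0\<close> counts main vectors; the others belong to certificate \<open>s\<close>.
  Those with \<open>c = 1\<close> and \<open>c = 2\<close> count the vectors for slot \<open>j\<close> and for tuple \<open>\<tau>\<close>, \<open>c = 3\<close> enforces agreement
  of the latter with the slot \<open>\<tau> ! j\<close>, and \<open>c = 4\<close> is the \<open>j\<close>-th constraint of the certificate.\<close>

type_synonym key = "nat \<times> nat \<times> nat list \<times> nat"

definition slots :: "nat \<Rightarrow> nat list" where
  "slots k = [0..<Suc k]"

definition cands :: "nat list \<Rightarrow> nat list" where
  "cands I = 0 # map Suc I"

definition slot_tuples :: "nat \<Rightarrow> nat \<Rightarrow> nat list list" where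
  "slot_tuples D k = List.n_lists D (slots k)"

text \<open>Besides consistency, different slots must hold different elements, which makes the
  solution have exactly \<open>k\<close> elements. Including \<open>(0, 0)\<close> ties slot 0 to
  the padding value and keeps that value out of the other slots.\<close>

definition compat :: "(nat \<times> nat) list \<Rightarrow> bool" where
  "compat \<rho> \<longleftrightarrow> list_all (\<lambda>p. list_all (\<lambda>q. (fst p = fst q) = (snd p = snd q)) ((0, 0) # \<rho>)) ((0, 0) # \<rho>)"

definition assignments :: "nat \<Rightarrow> nat \<Rightarrow> nat list \<Rightarrow> (nat \<times> nat) list list" where
  "assignments D k I = filter compat (List.n_lists D (List.product (slots k) (cands I)))"

definition pad :: "nat \<Rightarrow> nat list \<Rightarrow> nat list" where
  "pad D \<mu> = map Suc \<mu> @ replicate (D - length \<mu>) 0"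

definition constraint :: "cert list \<Rightarrow> nat \<Rightarrow> nat \<Rightarrow> msum \<times> nat" where
  "constraint Z s r = lookup ([], 0) (lookup [] Z s) r"

text \<open>The coordinate counting main vectors is put first: it becomes the least significant
  digit, so the initial vector becomes the integer 1.\<close>

definition keys :: "nat \<Rightarrow> nat \<Rightarrow> cert list \<Rightarrow> key list" where
  "keys D k Z = (0, 0, [], 0) # concat (map (\<lambda>s.
      map (\<lambda>a. (1, s, [], a)) (slots k) @
      map (\<lambda>\<tau>. (2, s, \<tau>, 0)) (slot_tuples D k) @
      concat (map (\<lambda>\<tau>. map (\<lambda>j. (3, s, \<tau>, j)) [0..<D]) (slot_tuples D k)) @
      map (\<lambda>r. (4, s, [], r)) [0..<length (lookup [] Z s)]) [0..<length Z])"

definition elems :: "nat \<Rightarrow> nat \<Rightarrow> nat list \<Rightarrow> cert list \<Rightarrow> elem list" where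
  "elems D k I Z = concat (map (\<lambda>s. Main s #
      map (\<lambda>p. Slot s (fst p) (snd p)) (List.product (slots k) (cands I)) @
      map (\<lambda>\<rho>. Tup s \<rho>) (assignments D k I)) [0..<length Z])"

text \<open>For \<open>c = 3\<close>, with \<open>N = sum_list (cands I)\<close>, the main vector
  demands \<open>N\<close>, the slot vector supplies \<open>x\<close> and the tuple vector
  \<open>N - y\<close>, so that the balance means \<open>x = y\<close>. The complement keeps entries
  nonnegative, and \<open>N\<close> bounds every candidate, so the subtraction is exact.\<close>

fun entry :: "nat \<Rightarrow> nat list \<Rightarrow> cert list \<Rightarrow> elem \<Rightarrow> key \<Rightarrow> nat" where
  "entry D I Z (Main s) (c, s', \<tau>, j) =
    (if c = 0 then 1
     else if c = 1 \<or> c = 2 then (if s = s' then 1 else 0)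
     else if c = 3 then (if s = s' then sum_list (cands I) else 0)
     else (if s = s' then snd (constraint Z s j) else 0))"
| "entry D I Z (Slot s a x) (c, s', \<tau>, j) =
    (if c = 1 then (if s = s' \<and> a = j then 1 else 0)
     else if c = 3 then (if s = s' \<and> a = lookup 0 \<tau> j then x else 0)
     else 0)"
| "entry D I Z (Tup s \<rho>) (c, s', \<tau>, j) =
    (if c = 2 then (if s = s' \<and> map fst \<rho> = \<tau> then 1 else 0)
     else if c = 3 then (if s = s' \<and> map fst \<rho> = \<tau> then sum_list (cands I) - lookup 0 (map snd \<rho>) j else 0)
     else if c = 4 then (if s = s' then length (filter (\<lambda>\<mu>. pad D \<mu> = map snd \<rho>) (fst (constraint Z s j))) else 0)
     else 0)"

fun is_Main :: "elem \<Rightarrow> bool" where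
  "is_Main (Main _) = True"
| "is_Main _ = False"

definition signed_entry :: "nat \<Rightarrow> nat list \<Rightarrow> cert list \<Rightarrow> elem \<Rightarrow> key \<Rightarrow> int" where
  "signed_entry D I Z e x = (if is_Main e then - int (entry D I Z e x) else int (entry D I Z e x))"

text \<open>The constant 1 in coordinate \<open>c = 0\<close> forces exactly one main vector.\<close>

definition init_entry :: "key \<Rightarrow> int" where
  "init_entry x = (if fst x = 0 then 1 else 0)"

definition balanced :: "nat \<Rightarrow> nat \<Rightarrow> nat list \<Rightarrow> cert list \<Rightarrow> elem list \<Rightarrow> bool" where
  "balanced D k I Z es \<longleftrightarrow>
     (\<forall>x\<in>set (keys D k Z). init_entry x + (\<Sum>e\<leftarrow>es. signed_entry D I Z e x) = 0)"

definition solution_length :: "nat \<Rightarrow> nat \<Rightarrow> nat" where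
  "solution_length D k = 1 + Suc k + Suc k ^ D"

section \<open>Balanced families of vectors and satisfying sets\<close>

lemma set_slots [simp]: "set (slots k) = {..k}" and distinct_slots [simp]: "distinct (slots k)"
  by (auto simp: slots_def)

lemma set_slot_tuples [simp]: "set (slot_tuples D k) = {\<tau>. length \<tau> = D \<and> set \<tau> \<subseteq> {..k}}"
  by (auto simp: slot_tuples_def set_n_lists)

lemma distinct_slot_tuples [simp]: "distinct (slot_tuples D k)"
  by (simp add: slot_tuples_def distinct_n_lists)

lemma sum_list_distinct: "distinct xs \<Longrightarrow> (\<Sum>x\<leftarrow>xs. f x) = sum f (set xs)"
  by (simp add: sum_list_distinct_conv_sum_set)

lemma sum_list_sum_swap:
  fixes f :: "'a \<Rightarrow> 'b \<Rightarrow> 'c::comm_monoid_add"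
  shows "(\<Sum>x\<leftarrow>xs. \<Sum>y\<in>A. f x y) = (\<Sum>y\<in>A. \<Sum>x\<leftarrow>xs. f x y)"
  by (induction xs) (simp_all add: sum.distrib)

text \<open>A true monomial, once padded, is the image under \<open>x\<close> of exactly one slot
  tuple, by injectivity of \<open>x\<close>; a false one is the image of none.\<close>

lemma num_true_via_tuples:
  assumes inj: "inj_on x {..k}" and x0: "x 0 = 0" and X: "\<And>i. i \<in> X \<longleftrightarrow> Suc i \<in> x ` {..k}"
    and D: "\<And>\<mu>. \<mu> \<in> set L \<Longrightarrow> length \<mu> \<le> D"
  shows "(\<Sum>\<tau>\<in>set (slot_tuples D k). length (filter (\<lambda>\<mu>. pad D \<mu> = map x \<tau>) L)) = num_true X L"
  using D
proof (induction L)
  case (Cons \<mu> L)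
  have 1: "(\<Sum>\<tau>\<in>set (slot_tuples D k). of_bool (pad D \<mu> = map x \<tau>)) = (of_bool (set \<mu> \<subseteq> X) :: nat)"
  proof (cases "set \<mu> \<subseteq> X")
    case True
    define \<tau> where "\<tau> = map (inv_into {..k} x) (pad D \<mu>)"
    have sub: "set (pad D \<mu>) \<subseteq> x ` {..k}"
      using True X x0 by (force simp: pad_def)
    have len: "length (pad D \<mu>) = D" using Cons.prems[of \<mu>] by (simp add: pad_def)
    have "inv_into {..k} x a \<in> {..k}" if "a \<in> set (pad D \<mu>)" for a
      using that sub by (intro inv_into_into) auto
    then have "\<tau> \<in> set (slot_tuples D k)" using len by (auto simp: \<tau>_def)
    moreover have "map x \<tau> = pad D \<mu>"
      unfolding \<tau>_def map_map by (rule map_idI) (use sub in \<open>auto simp: f_inv_into_f subset_iff\<close>)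
    ultimately have \<tau>: "\<tau> \<in> set (slot_tuples D k)" "map x \<tau> = pad D \<mu>" by blast+
    have unique: "pad D \<mu> = map x \<sigma> \<longleftrightarrow> \<sigma> = \<tau>" if "\<sigma> \<in> set (slot_tuples D k)" for \<sigma>
    proof -
      have "inj_on x (set \<sigma> \<union> set \<tau>)" using that \<tau>(1) by (intro inj_on_subset[OF inj]) auto
      then show ?thesis using \<tau>(2) inj_on_map_eq_map by metis
    qed
    have "(\<Sum>\<sigma>\<in>set (slot_tuples D k). of_bool (pad D \<mu> = map x \<sigma>)) =
        (\<Sum>\<sigma>\<in>set (slot_tuples D k). if \<sigma> = \<tau> then 1 else (0::nat))"
      by (intro sum.cong) (auto simp: unique simp del: set_slot_tuples)
    also have "\<dots> = 1" using \<tau>(1) by (simp del: set_slot_tuples)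
    finally show ?thesis using True by simp
  next
    case False
    then obtain i where i: "i \<in> set \<mu>" "i \<notin> X" by blast
    have "pad D \<mu> \<noteq> map x \<tau>" if "\<tau> \<in> set (slot_tuples D k)" for \<tau>
    proof
      assume "pad D \<mu> = map x \<tau>"
      then have "Suc i \<in> set (map x \<tau>)" using i(1) by (metis pad_def Un_iff image_eqI set_append set_map)
      then show False using that i(2) X by auto
    qed
    then show ?thesis using False by (simp del: set_slot_tuples)
  qed
  have "length (filter (\<lambda>\<mu>. pad D \<mu> = map x \<tau>) (\<mu> # L)) =
      of_bool (pad D \<mu> = map x \<tau>) + length (filter (\<lambda>\<mu>. pad D \<mu> = map x \<tau>) L)" for \<tau>
    by simp
  then show ?case
    using Cons 1 by (simp only: sum.distrib num_true_Cons) (simp add: num_true_Cons)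
qed (simp add: num_true_def)

context
  fixes D k :: nat and I :: "nat list" and Z :: "cert list"
begin

abbreviation "ent \<equiv> entry D I Z"
abbreviation "sent \<equiv> signed_entry D I Z"

lemma le_sum_cands: "x \<in> set (cands I) \<Longrightarrow> x \<le> sum_list (cands I)"
  by (rule member_le_sum_list) auto

lemma constraint_nth: "s < length Z \<Longrightarrow> r < length (Z ! s) \<Longrightarrow> constraint Z s r = Z ! s ! r"
  by (simp add: constraint_def)

lemma keys_cases:
  assumes "x \<in> set (keys D k Z)"
  obtains "x = (0, 0, [], 0)"
  | s a where "s < length Z" "a \<le> k" "x = (1, s, [], a)"
  | s \<tau> where "s < length Z" "\<tau> \<in> set (slot_tuples D k)" "x = (2, s, \<tau>, 0)"
  | s \<tau> j where "s < length Z" "\<tau> \<in> set (slot_tuples D k)" "j < D" "x = (3, s, \<tau>, j)"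
  | s r where "s < length Z" "r < length (Z ! s)" "x = (4, s, [], r)"
  using assms unfolding keys_def by (auto simp del: set_slot_tuples)

lemma keysI:
  "(0, 0, [], 0) \<in> set (keys D k Z)"
  "s < length Z \<Longrightarrow> a \<le> k \<Longrightarrow> (1, s, [], a) \<in> set (keys D k Z)"
  "s < length Z \<Longrightarrow> \<tau> \<in> set (slot_tuples D k) \<Longrightarrow> (2, s, \<tau>, 0) \<in> set (keys D k Z)"
  "s < length Z \<Longrightarrow> \<tau> \<in> set (slot_tuples D k) \<Longrightarrow> j < D \<Longrightarrow> (3, s, \<tau>, j) \<in> set (keys D k Z)"
  "s < length Z \<Longrightarrow> r < length (Z ! s) \<Longrightarrow> (4, s, [], r) \<in> set (keys D k Z)"
  unfolding keys_def by (auto simp: image_iff simp del: set_slot_tuples intro!: bexI[of _ s])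

lemma solution_exists:
  assumes bounded: "\<And>z L a \<mu>. z \<in> set Z \<Longrightarrow> (L, a) \<in> set z \<Longrightarrow> \<mu> \<in> set L \<Longrightarrow> length \<mu> \<le> D"
    and z: "z \<in> set Z" "X \<subseteq> set I" "card X = k" "sat X z"
  shows "\<exists>es. set es \<subseteq> set (elems D k I Z) \<and> length es = solution_length D k \<and> balanced D k I Z es"
proof -
  obtain s where s: "s < length Z" "Z ! s = z" using z(1) by (auto simp: in_set_conv_nth)
  have "finite X" using z(2) finite_subset by blast
  then obtain h where h: "bij_betw h {1..k} X"
    using ex_bij_betw_nat_finite_1 z(3) by blast
  \<comment> \<open>Slot 0 is reserved for the padding value, and \<open>Suc\<close> keeps the
    inputs apart from it.\<close>
  define x where "x a = (if a = 0 then 0 else Suc (h a))" for a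
  have inj: "inj_on x {..k}"
  proof (rule inj_onI)
    fix a b
    assume "a \<in> {..k}" "b \<in> {..k}" "x a = x b"
    then show "a = b"
      using inj_onD[OF bij_betw_imp_inj_on[OF h], of a b] by (auto simp: x_def Suc_le_eq split: if_splits)
  qed
  have X: "i \<in> X \<longleftrightarrow> Suc i \<in> x ` {..k}" for i
  proof -
    have "X = h ` {1..k}" using h by (simp add: bij_betw_def)
    then show ?thesis by (force simp: x_def image_iff)
  qed
  have x_cands: "x a \<in> set (cands I)" if "a \<le> k" for a
  proof (cases "x a")
    case (Suc i)
    then have "Suc i \<in> x ` {..k}" using that by (metis atMost_iff imageI)
    then have "i \<in> set I" using X z(2) by blast
    then show ?thesis using Suc by (simp add: cands_def)
  qed (simp add: cands_def)
  define \<rho> where "\<rho> \<tau> = map (\<lambda>a. (a, x a)) \<tau>" for \<tau>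
  have fst_\<rho>: "map fst (\<rho> \<tau>) = \<tau>" and snd_\<rho>: "map snd (\<rho> \<tau>) = map x \<tau>" for \<tau>
    by (simp_all add: \<rho>_def o_def)
  define es where "es = Main s # map (\<lambda>a. Slot s a (x a)) (slots k) @ map (\<lambda>\<tau>. Tup s (\<rho> \<tau>)) (slot_tuples D k)"
  have \<rho>_assign: "\<rho> \<tau> \<in> set (assignments D k I)" if "\<tau> \<in> set (slot_tuples D k)" for \<tau>
  proof -
    have \<tau>: "length \<tau> = D" "set \<tau> \<subseteq> {..k}" using that by auto
    have "x 0 = 0" by (simp add: x_def)
    then have xx: "a = b \<longleftrightarrow> x a = x b" "0 = b \<longleftrightarrow> 0 = x b" "b = 0 \<longleftrightarrow> x b = 0" if "a \<in> set \<tau>" "b \<in> set \<tau>" for a b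
      using inj_onD[OF inj, of a b] inj_onD[OF inj, of 0 b] that \<tau>(2) by auto
    have "compat (\<rho> \<tau>)"
      unfolding compat_def list_all_iff \<rho>_def using xx by auto
    moreover have "\<rho> \<tau> \<in> set (List.n_lists D (List.product (slots k) (cands I)))"
      using \<tau> x_cands by (auto simp: set_n_lists \<rho>_def)
    ultimately show ?thesis by (simp add: assignments_def)
  qed
  have "set es \<subseteq> set (elems D k I Z)"
    using s(1) x_cands \<rho>_assign unfolding es_def elems_def
    by (auto simp del: set_slot_tuples) (force simp del: set_slot_tuples)+
  moreover have "length es = solution_length D k"
    by (simp add: es_def solution_length_def slot_tuples_def length_n_lists slots_def)
  moreover have "balanced D k I Z es"
    unfolding balanced_def
  proof
    fix y
    assume y: "y \<in> set (keys D k Z)"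
    have sum: "(\<Sum>e\<leftarrow>es. sent e y) = - int (ent (Main s) y) + int ((\<Sum>a\<le>k. ent (Slot s a (x a)) y) +
        (\<Sum>\<tau>\<in>set (slot_tuples D k). ent (Tup s (\<rho> \<tau>)) y))"
      unfolding es_def
      by (simp add: signed_entry_def o_def sum_list_distinct del: set_slot_tuples)
    let ?S = "(\<Sum>a\<le>k. ent (Slot s a (x a)) y) + (\<Sum>\<tau>\<in>set (slot_tuples D k). ent (Tup s (\<rho> \<tau>)) y)"
    \<comment> \<open>The main vector is the only negative one, so it must match everything else. In
      coordinates of certificates other than \<open>s\<close> both sides vanish.\<close>
    have "init_entry y + int ?S = int (ent (Main s) y)"
      using y
    proof (cases rule: keys_cases)
      case 1
      then show ?thesis by (simp add: init_entry_def)
    next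
      case (2 s' a)
      have "?S = ent (Main s) y"
        using 2 by (cases "s' = s") simp_all
      then show ?thesis using 2 by (simp add: init_entry_def)
    next
      case (3 s' \<tau>)
      have "?S = ent (Main s) y"
        using 3 by (cases "s' = s") (simp_all add: fst_\<rho> del: set_slot_tuples)
      then show ?thesis using 3 by (simp add: init_entry_def)
    next
      case (4 s' \<tau> j)
      then have \<tau>: "length \<tau> = D" "\<tau> ! j \<le> k" by (auto dest: nth_mem)
      have "x (\<tau> ! j) \<le> sum_list (cands I)" using x_cands[OF \<tau>(2)] by (rule le_sum_cands)
      then have "?S = ent (Main s) y"
        using 4 \<tau> by (cases "s' = s") (simp_all add: fst_\<rho> snd_\<rho> del: set_slot_tuples)
      then show ?thesis using 4 by (simp add: init_entry_def)
    next
      case (5 s' r)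
      have "?S = ent (Main s) y"
      proof (cases "s' = s")
        case True
        obtain L a where La: "z ! r = (L, a)" by (cases "z ! r")
        then have mem: "(L, a) \<in> set z" using 5 s True by (metis nth_mem)
        have "(\<Sum>\<tau>\<in>set (slot_tuples D k). length (filter (\<lambda>\<mu>. pad D \<mu> = map x \<tau>) L)) = num_true X L"
          by (rule num_true_via_tuples[OF inj _ X]) (use bounded[OF z(1) mem] in \<open>auto simp: x_def\<close>)
        moreover have "num_true X L = a" using z(4) mem by (auto simp: sat_def)
        moreover have "constraint Z s r = (L, a)" using 5 s True La by (simp add: constraint_nth)
        ultimately show ?thesis using 5 True
          by (simp add: snd_\<rho> del: set_slot_tuples)
      next
        case False
        then show ?thesis using 5 by (simp del: set_slot_tuples)
      qed
      then show ?thesis using 5 by (simp add: init_entry_def)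
    qed
    then show "init_entry y + (\<Sum>e\<leftarrow>es. sent e y) = 0" unfolding sum by simp
  qed
  ultimately show ?thesis by blast
qed

text \<open>Exactly one vector is negative, so nothing else can cancel: every entry of another
  vector is bounded by that of the main vector. This excludes foreign certificates and then singles
  out one vector per slot and per tuple.\<close>

lemma solution_sound:
  assumes bounded: "\<And>z L a \<mu>. z \<in> set Z \<Longrightarrow> (L, a) \<in> set z \<Longrightarrow> \<mu> \<in> set L \<Longrightarrow> length \<mu> \<le> D"
    and D: "2 \<le> D" and es: "set es \<subseteq> set (elems D k I Z)" and bal: "balanced D k I Z es"
  shows "\<exists>z\<in>set Z. \<exists>X\<subseteq>set I. card X = k \<and> sat X z"
proof -
  let ?N = "sum_list (cands I)"
  define rest where "rest = filter (\<lambda>e. \<not> is_Main e) es"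
  have split: "(\<Sum>e\<leftarrow>es. sent e y) = int (\<Sum>e\<leftarrow>rest. ent e y) - int (\<Sum>e\<leftarrow>filter is_Main es. ent e y)" for y
    unfolding rest_def by (induction es) (auto simp: signed_entry_def)
  have "(\<Sum>e\<leftarrow>rest. ent e (0, 0, [], 0)) = 0"
  proof -
    have "ent e (0, 0, [], 0) = 0" if "\<not> is_Main e" for e using that by (cases e) simp_all
    then show ?thesis unfolding rest_def by (induction es) simp_all
  qed
  moreover have "(\<Sum>e\<leftarrow>filter is_Main es. ent e (0, 0, [], 0)) = length (filter is_Main es)"
  proof -
    have "ent e (0, 0, [], 0) = 1" if "is_Main e" for e using that by (cases e) simp_all
    then show ?thesis by (induction es) simp_all
  qed
  moreover have "1 + (int (\<Sum>e\<leftarrow>rest. ent e (0, 0, [], 0)) - int (\<Sum>e\<leftarrow>filter is_Main es. ent e (0, 0, [], 0))) = 0"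
  proof -
    have "init_entry (0, 0, [], 0) + (\<Sum>e\<leftarrow>es. sent e (0, 0, [], 0)) = 0"
      using bal keysI(1) unfolding balanced_def by blast
    then show ?thesis by (simp only: split init_entry_def fst_conv if_True refl)
  qed
  ultimately have "length (filter is_Main es) = 1" by linarith
  then obtain m where m: "filter is_Main es = [m]" by (auto simp: length_Suc_conv)
  then have m': "is_Main m" "m \<in> set es" by (auto dest: filter_eq_ConsD)
  then obtain s where "m = Main s" by (auto elim: is_Main.elims)
  with m m' have main: "filter is_Main es = [Main s]" and "Main s \<in> set es" by simp_all
  then have s: "s < length Z" using es by (auto simp: elems_def)
  have sum: "(\<Sum>e\<leftarrow>rest. ent e y) = ent (Main s) y" if "y \<in> set (keys D k Z)" "fst y \<noteq> 0" for y
    using bal that split[of y] main by (auto simp: balanced_def init_entry_def)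
  have one_slot: "(\<Sum>e\<leftarrow>rest. ent e (1, s, [], a)) = 1" if "a \<le> k" for a
    using sum[OF keysI(2)[OF s that]] by simp
  have one_tuple: "(\<Sum>e\<leftarrow>rest. ent e (2, s, \<tau>, 0)) = 1" if "\<tau> \<in> set (slot_tuples D k)" for \<tau>
    using sum[OF keysI(3)[OF s that]] by simp
  have rest_cases: "(\<exists>s' a x. e = Slot s' a x \<and> s' < length Z \<and> a \<le> k \<and> x \<in> set (cands I)) \<or>
      (\<exists>s' \<rho>. e = Tup s' \<rho> \<and> s' < length Z \<and> \<rho> \<in> set (assignments D k I))" if "e \<in> set rest" for e
    using that es unfolding rest_def elems_def by (auto dest!: subsetD)
  have assign: "map fst \<rho> \<in> set (slot_tuples D k)" "length \<rho> = D" "set (map snd \<rho>) \<subseteq> set (cands I)" "compat \<rho>"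
    if "\<rho> \<in> set (assignments D k I)" for \<rho>
    using that by (auto simp: assignments_def set_n_lists)
  have ent_le: "ent e y \<le> ent (Main s) y" if "e \<in> set rest" "y \<in> set (keys D k Z)" "fst y \<noteq> 0" for e y
    unfolding sum[OF that(2,3), symmetric] using that(1) by (intro member_le_sum_list) auto
  \<comment> \<open>A vector of another certificate has entry 1 in its own counting coordinate,
    where \<open>Main s\<close> has 0.\<close>
  have copy: "(\<exists>a x. e = Slot s a x \<and> a \<le> k \<and> x \<in> set (cands I)) \<or>
      (\<exists>\<rho>. e = Tup s \<rho> \<and> \<rho> \<in> set (assignments D k I))" if e: "e \<in> set rest" for e
    using rest_cases[OF e]
  proof (elim disjE exE conjE)
    fix s' a x
    assume *: "e = Slot s' a x" "s' < length Z" "a \<le> k" "x \<in> set (cands I)"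
    have "s' = s" using ent_le[OF e keysI(2)[OF *(2,3)]] *(1) by (auto split: if_splits)
    then show ?thesis using * by blast
  next
    fix s' \<rho>
    assume *: "e = Tup s' \<rho>" "s' < length Z" "\<rho> \<in> set (assignments D k I)"
    have "s' = s" using ent_le[OF e keysI(3)[OF *(2) assign(1)[OF *(3)]]] *(1) by (auto split: if_splits)
    then show ?thesis using * by blast
  qed
  have "\<exists>x. filter (\<lambda>e. ent e (1, s, [], a) = 1) rest = [Slot s a x] \<and> x \<in> set (cands I)" if "a \<le> k" for a
  proof -
    have le: "ent e (1, s, [], a) \<le> 1" if "e \<in> set rest" for e
      using copy[OF that] by auto
    have "(\<Sum>e\<leftarrow>rest. ent e (1, s, [], a)) = length (filter (\<lambda>e. ent e (1, s, [], a) = 1) rest)"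
      using le by (induction rest) (auto simp: le_Suc_eq)
    then have "length (filter (\<lambda>e. ent e (1, s, [], a) = 1) rest) = 1"
      using one_slot[OF that] by simp
    then obtain e where e: "filter (\<lambda>e. ent e (1, s, [], a) = 1) rest = [e]" by (auto simp: length_Suc_conv)
    then have "e \<in> set rest" "ent e (1, s, [], a) = 1" by (auto dest: filter_eq_ConsD)
    then have "\<exists>x. e = Slot s a x \<and> x \<in> set (cands I)" using copy[of e] by (auto split: if_splits)
    then show ?thesis using e by blast
  qed
  then obtain x where x: "\<And>a. a \<le> k \<Longrightarrow> filter (\<lambda>e. ent e (1, s, [], a) = 1) rest = [Slot s a (x a)]"
    "\<And>a. a \<le> k \<Longrightarrow> x a \<in> set (cands I)" by metis
  have "\<exists>\<rho>. filter (\<lambda>e. ent e (2, s, \<tau>, 0) = 1) rest = [Tup s \<rho>] \<and> \<rho> \<in> set (assignments D k I) \<and> map fst \<rho> = \<tau>"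
    if "\<tau> \<in> set (slot_tuples D k)" for \<tau>
  proof -
    have le: "ent e (2, s, \<tau>, 0) \<le> 1" if "e \<in> set rest" for e
      using copy[OF that] by auto
    have "(\<Sum>e\<leftarrow>rest. ent e (2, s, \<tau>, 0)) = length (filter (\<lambda>e. ent e (2, s, \<tau>, 0) = 1) rest)"
      using le by (induction rest) (auto simp: le_Suc_eq)
    then have "length (filter (\<lambda>e. ent e (2, s, \<tau>, 0) = 1) rest) = 1"
      using one_tuple[OF that] by simp
    then obtain e where e: "filter (\<lambda>e. ent e (2, s, \<tau>, 0) = 1) rest = [e]" by (auto simp: length_Suc_conv)
    then have "e \<in> set rest" "ent e (2, s, \<tau>, 0) = 1" by (auto dest: filter_eq_ConsD)
    then have "\<exists>\<rho>. e = Tup s \<rho> \<and> \<rho> \<in> set (assignments D k I) \<and> map fst \<rho> = \<tau>"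
      using copy[of e] by (auto split: if_splits)
    then show ?thesis using e by blast
  qed
  then obtain \<rho> where \<rho>: "\<And>\<tau>. \<tau> \<in> set (slot_tuples D k) \<Longrightarrow> filter (\<lambda>e. ent e (2, s, \<tau>, 0) = 1) rest = [Tup s (\<rho> \<tau>)]"
    "\<And>\<tau>. \<tau> \<in> set (slot_tuples D k) \<Longrightarrow> \<rho> \<tau> \<in> set (assignments D k I)"
    "\<And>\<tau>. \<tau> \<in> set (slot_tuples D k) \<Longrightarrow> map fst (\<rho> \<tau>) = \<tau>" by metis

  have agree: "map snd (\<rho> \<tau>) = map x \<tau>" if \<tau>: "\<tau> \<in> set (slot_tuples D k)" for \<tau>
  proof (rule nth_equalityI)
    have len\<tau>: "length (\<rho> \<tau>) = D" "length \<tau> = D" using assign(2)[OF \<rho>(2)[OF \<tau>]] \<tau> by auto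
    then show "length (map snd (\<rho> \<tau>)) = length (map x \<tau>)" by simp
    fix j
    assume "j < length (map snd (\<rho> \<tau>))"
    then have j: "j < D" using len\<tau> by simp
    have a: "\<tau> ! j \<le> k" using \<tau> j by (auto dest: nth_mem)
    \<comment> \<open>Only vectors for the slot \<open>\<tau> ! j\<close> and for the tuple
      \<open>\<tau>\<close> contribute here. Expressing this through coordinates 1 and 2 reduces the
      sum to the two unique vectors found above.\<close>
    have "ent e (3, s, \<tau>, j) = (if ent e (1, s, [], \<tau> ! j) = 1 then ent e (3, s, \<tau>, j) else 0) +
        (if ent e (2, s, \<tau>, 0) = 1 then ent e (3, s, \<tau>, j) else 0)" if "e \<in> set rest" for e
      using copy[OF that] len\<tau> j by auto
    then have "(\<Sum>e\<leftarrow>rest. ent e (3, s, \<tau>, j)) = (\<Sum>e\<leftarrow>rest. (if ent e (1, s, [], \<tau> ! j) = 1 then ent e (3, s, \<tau>, j) else 0) +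
        (if ent e (2, s, \<tau>, 0) = 1 then ent e (3, s, \<tau>, j) else 0))"
      by (metis (no_types, lifting) map_cong)
    also have "\<dots> = (\<Sum>e\<leftarrow>[Slot s (\<tau> ! j) (x (\<tau> ! j))]. ent e (3, s, \<tau>, j)) + (\<Sum>e\<leftarrow>[Tup s (\<rho> \<tau>)]. ent e (3, s, \<tau>, j))"
      unfolding sum_list_addf x(1)[OF a, symmetric] \<rho>(1)[OF \<tau>, symmetric] sum_list_map_filter' ..
    also have "\<dots> = x (\<tau> ! j) + (?N - snd (\<rho> \<tau> ! j))"
      using len\<tau> j by (simp add: \<rho>(3)[OF \<tau>])
    finally have "?N = x (\<tau> ! j) + (?N - snd (\<rho> \<tau> ! j))"
      using sum[OF keysI(4)[OF s \<tau> j]] by simp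
    moreover have "snd (\<rho> \<tau> ! j) \<in> set (cands I)"
      using assign(3)[OF \<rho>(2)[OF \<tau>]] len\<tau> j by (auto dest: nth_mem)
    ultimately have "snd (\<rho> \<tau> ! j) = x (\<tau> ! j)" using le_sum_cands by fastforce
    then show "map snd (\<rho> \<tau>) ! j = map x \<tau> ! j" using len\<tau> j by simp
  qed
  have pair: "(a = b \<longleftrightarrow> x a = x b) \<and> (a = 0 \<longleftrightarrow> x a = 0)" if "a \<le> k" "b \<le> k" for a b
  proof -
    \<comment> \<open>Since \<open>D\<close> is at least 2, some tuple contains both slots, and the
      assignment chosen for it has passed \<open>compat\<close>.\<close>
    let ?\<tau> = "a # b # replicate (D - 2) 0"
    have \<tau>: "?\<tau> \<in> set (slot_tuples D k)" using that D by auto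
    obtain p q ps where pq: "\<rho> ?\<tau> = p # q # ps" "fst p = a" "fst q = b"
      using \<rho>(3)[OF \<tau>] by (auto simp: map_eq_Cons_conv)
    moreover have "snd p = x a" "snd q = x b" using agree[OF \<tau>] pq(1) by simp_all
    ultimately show ?thesis using assign(4)[OF \<rho>(2)[OF \<tau>]] by (auto simp: compat_def)
  qed
  then have inj: "inj_on x {..k}" by (auto simp: inj_on_def)
  have x0: "x 0 = 0" using pair[of 0 0] by simp
  define X where "X = {i. Suc i \<in> x ` {..k}}"
  \<comment> \<open>Slot 0 holds only the padding value, so the remaining \<open>k\<close> slots
    hold precisely the elements of \<open>X\<close>.\<close>
  have X_image: "Suc ` X = x ` {1..k}"
  proof -
    have "n \<in> x ` {1..k}" if "n \<in> Suc ` X" for n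
    proof -
      obtain i a where "n = Suc i" "a \<le> k" "x a = Suc i" using \<open>n \<in> Suc ` X\<close> by (force simp: X_def)
      moreover from this have "a \<noteq> 0" using x0 by (cases "a = 0") auto
      ultimately show ?thesis by (intro image_eqI[of _ _ a]) auto
    qed
    moreover have "x a \<in> Suc ` X" if "a \<in> {1..k}" for a
    proof -
      have "x a \<noteq> 0" using pair[of a a] that by auto
      then obtain i where "x a = Suc i" by (cases "x a") auto
      moreover from this have "i \<in> X" using that by (force simp: X_def)
      ultimately show ?thesis by simp
    qed
    ultimately show ?thesis by blast
  qed
  have "card X = card (Suc ` X)" by (simp add: card_image)
  also have "\<dots> = k" unfolding X_image using card_image[OF inj_on_subset[OF inj], of "{1..k}"] by auto
  finally have "card X = k" .
  moreover have "X \<subseteq> set I"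
    using x(2) by (force simp: X_def cands_def)
  moreover have "sat X (Z ! s)"
    unfolding sat_def
  proof
    fix c
    assume c: "c \<in> set (Z ! s)"
    then obtain r where r: "r < length (Z ! s)" "c = Z ! s ! r" by (auto simp: in_set_conv_nth)
    obtain L a where La: "c = (L, a)" by (cases c)
    let ?g = "\<lambda>\<tau>. length (filter (\<lambda>\<mu>. pad D \<mu> = map x \<tau>) L)"
    have con: "constraint Z s r = (L, a)" using constraint_nth[OF s r(1)] r(2) La by simp
    \<comment> \<open>A tuple vector is counted at exactly one \<open>\<tau>\<close>, its own, and
      slot vectors contribute 0; thus the constraint splits over the tuples.\<close>
    have e: "ent e (4, s, [], r) = (\<Sum>\<tau>\<in>set (slot_tuples D k). if ent e (2, s, \<tau>, 0) = 1 then ent e (4, s, [], r) else 0)"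
      if "e \<in> set rest" for e
      using copy[OF that]
    proof (elim disjE exE conjE)
      fix \<sigma>
      assume *: "e = Tup s \<sigma>" "\<sigma> \<in> set (assignments D k I)"
      have "(\<Sum>\<tau>\<in>set (slot_tuples D k). if ent e (2, s, \<tau>, 0) = 1 then ent e (4, s, [], r) else 0) =
          (\<Sum>\<tau>\<in>set (slot_tuples D k). if map fst \<sigma> = \<tau> then ent e (4, s, [], r) else 0)"
        by (intro sum.cong) (auto simp: *)
      also have "\<dots> = ent e (4, s, [], r)"
        using assign(1)[OF *(2)] by (simp del: set_slot_tuples entry.simps)
      finally show ?thesis ..
    qed simp
    have "a = (\<Sum>e\<leftarrow>rest. ent e (4, s, [], r))"
      using sum[OF keysI(5)[OF s r(1)]] con by simp
    also have "\<dots> = (\<Sum>e\<leftarrow>rest. \<Sum>\<tau>\<in>set (slot_tuples D k). if ent e (2, s, \<tau>, 0) = 1 then ent e (4, s, [], r) else 0)"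
      using e by (metis (no_types, lifting) map_cong)
    also have "\<dots> = (\<Sum>\<tau>\<in>set (slot_tuples D k). \<Sum>e\<leftarrow>[Tup s (\<rho> \<tau>)]. ent e (4, s, [], r))"
      unfolding sum_list_sum_swap by (intro sum.cong refl) (simp only: \<rho>(1)[symmetric] sum_list_map_filter')
    also have "\<dots> = (\<Sum>\<tau>\<in>set (slot_tuples D k). ?g \<tau>)"
      by (intro sum.cong refl) (simp add: con agree del: set_slot_tuples)
    also have "\<dots> = num_true X L"
      by (rule num_true_via_tuples[OF inj x0]) (use bounded[OF nth_mem[OF s]] c La in \<open>auto simp: X_def\<close>)
    finally show "num_true X (fst c) = snd c" using La by simp
  qed
  ultimately show ?thesis using nth_mem[OF s] by blast
qed

end


section \<open>From vectors to integers\<close>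

text \<open>Least significant digit first, base \<open>2 ^ b\<close>. The general semiring covers
  both the natural digits of one vector and the signed digits of a sum.\<close>

fun horner :: "nat \<Rightarrow> 'a::comm_semiring_1 list \<Rightarrow> 'a" where
  "horner b [] = 0"
| "horner b (d # ds) = d + 2 ^ b * horner b ds"

lemma horner_of_nat: "int (horner b ds) = horner b (map int ds)"
  by (induction ds) simp_all

lemma horner_map_uminus: "horner b (map (\<lambda>x. - f x) xs) = - (horner b (map f xs) :: int)"
  by (induction xs) simp_all

lemma horner_map_add:
  "horner b (map (\<lambda>x. f x + g x) xs) = horner b (map f xs) + horner b (map g xs)"
  by (induction xs) (simp_all add: algebra_simps)

lemma horner_map_sum_list:
  "(\<Sum>e\<leftarrow>es. horner b (map (f e) xs)) = horner b (map (\<lambda>x. \<Sum>e\<leftarrow>es. f e x) xs)"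
proof (induction es)
  case Nil
  show ?case by (induction xs) simp_all
qed (simp add: horner_map_add)

text \<open>If the value is 0, the base divides the lowest digit, which is smaller in absolute value
  and hence 0; the argument repeats on the rest.\<close>

lemma horner_eq_0_iff:
  fixes ds :: "int list"
  assumes "\<And>d. d \<in> set ds \<Longrightarrow> \<bar>d\<bar> < 2 ^ b"
  shows "horner b ds = 0 \<longleftrightarrow> (\<forall>d\<in>set ds. d = 0)"
  using assms
proof (induction ds)
  case (Cons d ds)
  have "d = 0" if "d + 2 ^ b * horner b ds = 0"
  proof -
    have "2 ^ b dvd d" using that by (metis dvd_add_left_iff dvd_0_right dvd_triv_left)
    then show ?thesis using Cons.prems[of d] zdvd_imp_le[of "2 ^ b" "\<bar>d\<bar>"] by fastforce
  qed
  then show ?case using Cons by auto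
qed simp

definition elem_value :: "nat \<Rightarrow> nat \<Rightarrow> nat \<Rightarrow> nat list \<Rightarrow> cert list \<Rightarrow> elem \<Rightarrow> int" where
  "elem_value b D k I Z e =
    (if is_Main e then -1 else 1) * int (horner b (map (entry D I Z e) (keys D k Z)))"

lemma elem_value_horner: "elem_value b D k I Z e = horner b (map (signed_entry D I Z e) (keys D k Z))"
proof (cases "is_Main e")
  case True
  then have "signed_entry D I Z e = (\<lambda>x. - int (entry D I Z e x))" by (auto simp: signed_entry_def)
  then show ?thesis using True
    by (simp add: elem_value_def horner_of_nat o_def horner_map_uminus)
next
  case False
  then have "signed_entry D I Z e = (\<lambda>x. int (entry D I Z e x))" by (auto simp: signed_entry_def)
  then show ?thesis using False
    by (simp add: elem_value_def horner_of_nat o_def)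
qed

lemma horner_init_entry: "horner b (map init_entry (keys D k Z)) = 1"
proof -
  have zero: "horner b (map init_entry xs) = 0" if "\<And>x. x \<in> set xs \<Longrightarrow> fst x \<noteq> 0" for xs
    using that by (induction xs) (simp_all add: init_entry_def)
  have "horner b (map init_entry (tl (keys D k Z))) = 0"
    by (rule zero) (auto simp: keys_def)
  then show ?thesis by (simp add: keys_def init_entry_def)
qed

lemma sum_elem_values:
  "1 + (\<Sum>e\<leftarrow>es. elem_value b D k I Z e) =
    horner b (map (\<lambda>x. init_entry x + (\<Sum>e\<leftarrow>es. signed_entry D I Z e x)) (keys D k Z))"
  by (simp add: horner_map_add horner_init_entry elem_value_horner horner_map_sum_list)

text \<open>A crude common bound on all entries, chosen because sums of unary numbers are easy to
  compute.\<close>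

definition total_entries :: "nat \<Rightarrow> nat \<Rightarrow> nat list \<Rightarrow> cert list \<Rightarrow> nat" where
  "total_entries D k I Z = (\<Sum>e\<leftarrow>elems D k I Z. \<Sum>x\<leftarrow>keys D k Z. entry D I Z e x)"

lemma entry_le_total:
  assumes "e \<in> set (elems D k I Z)" "x \<in> set (keys D k Z)"
  shows "entry D I Z e x \<le> total_entries D k I Z"
proof -
  have "entry D I Z e x \<le> (\<Sum>x\<leftarrow>keys D k Z. entry D I Z e x)"
    using assms(2) by (intro member_le_sum_list) auto
  also have "\<dots> \<le> total_entries D k I Z"
    unfolding total_entries_def using assms(1) by (intro member_le_sum_list) auto
  finally show ?thesis .
qed

lemma abs_sum_list_le: "(\<And>e. e \<in> set es \<Longrightarrow> \<bar>f e\<bar> \<le> (c::int)) \<Longrightarrow> \<bar>\<Sum>e\<leftarrow>es. f e\<bar> \<le> int (length es) * c"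
  by (induction es) (fastforce simp: algebra_simps)+

text \<open>With this many bits per digit, sums of at most \<open>solution_length D k\<close> of the integers have no carries.\<close>

definition digit_width :: "nat \<Rightarrow> nat \<Rightarrow> nat list \<Rightarrow> cert list \<Rightarrow> nat" where
  "digit_width D k I Z = Suc (solution_length D k + total_entries D k I Z)"

lemma balanced_iff_sum:
  assumes "set es \<subseteq> set (elems D k I Z)" "length es \<le> solution_length D k"
  shows "balanced D k I Z es \<longleftrightarrow> 1 + (\<Sum>e\<leftarrow>es. elem_value (digit_width D k I Z) D k I Z e) = 0"
proof -
  let ?b = "digit_width D k I Z" and ?C = "total_entries D k I Z" and ?K = "solution_length D k"
  have "\<bar>init_entry x + (\<Sum>e\<leftarrow>es. signed_entry D I Z e x)\<bar> < 2 ^ ?b" if x: "x \<in> set (keys D k Z)" for x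
  proof -
    have "\<bar>\<Sum>e\<leftarrow>es. signed_entry D I Z e x\<bar> \<le> int (length es) * int ?C"
    proof (rule abs_sum_list_le)
      fix e
      assume "e \<in> set es"
      then have "entry D I Z e x \<le> ?C" using assms(1) x entry_le_total by blast
      then show "\<bar>signed_entry D I Z e x\<bar> \<le> int ?C" by (simp add: signed_entry_def)
    qed
    also have "\<dots> \<le> int (?K * ?C)" using assms(2) by (simp add: mult_right_mono)
    finally have "\<bar>init_entry x + (\<Sum>e\<leftarrow>es. signed_entry D I Z e x)\<bar> \<le> 1 + int (?K * ?C)"
      by (auto simp: init_entry_def)
    also have "\<dots> = int (1 + ?K * ?C)" by simp
    also have "\<dots> < int (2 ^ ?b)"
      unfolding of_nat_less_iff
    proof -
      \<comment> \<open>Both factors are estimated by \<open>n < 2 ^ n\<close>; the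
        \<open>Suc\<close> in \<open>digit_width\<close> doubles the power and absorbs the
        1.\<close>
      have "?K * ?C \<le> 2 ^ ?K * 2 ^ ?C" by (intro mult_le_mono less_imp_le less_exp)
      moreover have "(1::nat) < 2 ^ ?K * 2 ^ ?C"
        unfolding power_add[symmetric] by (rule one_less_power) (auto simp: solution_length_def)
      moreover have "2 ^ ?b = 2 * (2 ^ ?K * 2 ^ ?C :: nat)" by (simp add: digit_width_def power_add)
      ultimately show "1 + ?K * ?C < 2 ^ ?b" by linarith
    qed
    finally show ?thesis by simp
  qed
  then show ?thesis
    unfolding sum_elem_values by (subst horner_eq_0_iff) (auto simp: balanced_def)
qed

definition target_ints :: "nat \<Rightarrow> nat \<Rightarrow> nat list \<Rightarrow> cert list \<Rightarrow> int list" where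
  "target_ints D k I Z = map (elem_value (digit_width D k I Z) D k I Z) (elems D k I Z)"

lemma target_ints_iff:
  assumes D: "2 \<le> D" and bounded: "\<And>z L a \<mu>. z \<in> set Z \<Longrightarrow> (L, a) \<in> set z \<Longrightarrow> \<mu> \<in> set L \<Longrightarrow> length \<mu> \<le> D"
  shows "(\<exists>ws. set ws \<subseteq> set (target_ints D k I Z) \<and> length ws \<le> solution_length D k \<and> 1 + sum_list ws = 0) \<longleftrightarrow>
    (\<exists>z\<in>set Z. \<exists>X\<subseteq>set I. card X = k \<and> sat X z)" (is "?L \<longleftrightarrow> ?R")
proof
  let ?f = "elem_value (digit_width D k I Z) D k I Z"
  assume ?L
  then obtain ws where ws: "set ws \<subseteq> ?f ` set (elems D k I Z)" "length ws \<le> solution_length D k" "1 + sum_list ws = 0"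
    by (auto simp: target_ints_def)
  from ws(1) have "ws \<in> lists (?f ` set (elems D k I Z))" by auto
  then obtain es where es: "set es \<subseteq> set (elems D k I Z)" "ws = map ?f es"
    unfolding lists_image by auto
  then have "balanced D k I Z es"
    using ws by (subst balanced_iff_sum) auto
  with D bounded es(1) show ?R by (intro solution_sound) auto
next
  let ?f = "elem_value (digit_width D k I Z) D k I Z"
  assume ?R
  then obtain z X where "z \<in> set Z" "X \<subseteq> set I" "card X = k" "sat X z" by blast
  then have "\<exists>es. set es \<subseteq> set (elems D k I Z) \<and> length es = solution_length D k \<and> balanced D k I Z es"
    using bounded by (intro solution_exists) auto
  then obtain es where es: "set es \<subseteq> set (elems D k I Z)" "length es = solution_length D k" "balanced D k I Z es"
    by blast
  then show ?L
    using balanced_iff_sum[OF es(1)]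
    by (intro exI[of _ "map ?f es"]) (auto simp: target_ints_def)
qed


section \<open>Products of matrices\<close>

definition vec2 :: "rat \<Rightarrow> rat \<Rightarrow> rat vec" where
  "vec2 a b = vec 2 (\<lambda>i. if i = 0 then a else b)"

definition mat2 :: "rat \<Rightarrow> rat \<Rightarrow> rat \<Rightarrow> rat \<Rightarrow> rat mat" where
  "mat2 a b c d = mat 2 2 (\<lambda>(i, j). if i = 0 then (if j = 0 then a else b) else (if j = 0 then c else d))"

lemma mat2_mult_vec2: "mat2 a b c d *\<^sub>v vec2 x y = vec2 (a * x + b * y) (c * x + d * y)"
proof (rule eq_vecI)
  fix i
  assume "i < dim_vec (vec2 (a * x + b * y) (c * x + d * y))"
  then have "i = 0 \<or> i = 1" by (auto simp: vec2_def)
  then show "(mat2 a b c d *\<^sub>v vec2 x y) $ i = vec2 (a * x + b * y) (c * x + d * y) $ i"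
    by (auto simp: mat2_def vec2_def scalar_prod_def numeral_2_eq_2)
qed (simp add: mat2_def vec2_def)

lemma vec2_eq_0_iff: "vec2 a b = 0\<^sub>v 2 \<longleftrightarrow> a = 0 \<and> b = 0"
proof
  assume "vec2 a b = 0\<^sub>v 2"
  then have "vec2 a b $ 0 = 0" "vec2 a b $ 1 = 0" by simp_all
  then show "a = 0 \<and> b = 0" by (simp_all add: vec2_def)
next
  show "a = 0 \<and> b = 0 \<Longrightarrow> vec2 a b = 0\<^sub>v 2" by (auto simp: vec2_def intro: eq_vecI)
qed

definition shear :: "int \<Rightarrow> rat mat" where
  "shear z = mat2 1 (of_int z) 0 1"

definition shear_mats :: "int list \<Rightarrow> rat mat list" where
  "shear_mats zs = mat2 1 0 0 0 # map shear zs"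

lemma apply_mats_Cons: "apply_mats Ts (i # is) v = apply_mats Ts is (Ts ! i *\<^sub>v v)"
  by (simp add: apply_mats_def)

lemma apply_shear_mats_0: "set is \<subseteq> {..length zs} \<Longrightarrow> apply_mats (shear_mats zs) is (vec2 a 0) = vec2 a 0"
proof (induction "is")
  case (Cons i "is")
  then have "shear_mats zs ! i *\<^sub>v vec2 a 0 = vec2 a 0"
    by (cases i) (auto simp: shear_mats_def shear_def mat2_mult_vec2)
  with Cons show ?case by (simp add: apply_mats_Cons)
qed (simp add: apply_mats_def)

text \<open>The shears add to the first coordinate until the projection is applied for the first time,
  after which it is frozen; without a projection the second coordinate stays 1.\<close>

lemma apply_shear_mats_eq_0:
  "(\<exists>is. length is = Suc n \<and> set is \<subseteq> {..length zs} \<and> apply_mats (shear_mats zs) is (vec2 (of_int a) 1) = 0\<^sub>v 2) \<longleftrightarrow>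
   (\<exists>ws. set ws \<subseteq> set zs \<and> length ws \<le> n \<and> a + sum_list ws = 0)"
proof (induction n arbitrary: a)
  case 0
  have "(\<exists>is. length is = Suc 0 \<and> set is \<subseteq> {..length zs} \<and> apply_mats (shear_mats zs) is (vec2 (of_int a) 1) = 0\<^sub>v 2) \<longleftrightarrow>
    (\<exists>i\<le>length zs. shear_mats zs ! i *\<^sub>v vec2 (of_int a) 1 = 0\<^sub>v 2)"
    by (auto simp: length_Suc_conv apply_mats_def)
  also have "\<dots> \<longleftrightarrow> a = 0"
  proof
    assume "\<exists>i\<le>length zs. shear_mats zs ! i *\<^sub>v vec2 (of_int a) 1 = 0\<^sub>v 2"
    then obtain i where "i \<le> length zs" "shear_mats zs ! i *\<^sub>v vec2 (of_int a) 1 = 0\<^sub>v 2" by blast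
    then show "a = 0"
      by (cases i) (auto simp: shear_mats_def shear_def mat2_mult_vec2 vec2_eq_0_iff)
  next
    assume "a = 0"
    then show "\<exists>i\<le>length zs. shear_mats zs ! i *\<^sub>v vec2 (of_int a) 1 = 0\<^sub>v 2"
      by (intro exI[of _ 0]) (auto simp: shear_mats_def mat2_mult_vec2 vec2_eq_0_iff)
  qed
  finally show ?case by auto
next
  case (Suc n)
  let ?T = "shear_mats zs"
  have T0: "?T ! 0 *\<^sub>v vec2 (of_int a) 1 = vec2 (of_int a) 0"
    by (simp add: shear_mats_def mat2_mult_vec2)
  have TSuc: "?T ! Suc i *\<^sub>v vec2 (of_int a) 1 = vec2 (of_int (a + zs ! i)) 1" if "i < length zs" for i
    using that by (simp add: shear_mats_def shear_def mat2_mult_vec2)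
  show ?case
  proof
    assume "\<exists>is. length is = Suc (Suc n) \<and> set is \<subseteq> {..length zs} \<and> apply_mats ?T is (vec2 (of_int a) 1) = 0\<^sub>v 2"
    then obtain js where js: "length js = Suc (Suc n)" "set js \<subseteq> {..length zs}"
      "apply_mats ?T js (vec2 (of_int a) 1) = 0\<^sub>v 2" by blast
    then obtain i "is" where "js = i # is" by (cases js) auto
    with js have is': "length is = Suc n" "i \<le> length zs" "set is \<subseteq> {..length zs}"
      "apply_mats ?T is (?T ! i *\<^sub>v vec2 (of_int a) 1) = 0\<^sub>v 2"
      by (auto simp: apply_mats_Cons)
    show "\<exists>ws. set ws \<subseteq> set zs \<and> length ws \<le> Suc n \<and> a + sum_list ws = 0"
    proof (cases i)
      case 0
      then have "a = 0" using is' by (simp add: T0 apply_shear_mats_0 vec2_eq_0_iff)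
      then show ?thesis by (intro exI[of _ "[]"]) simp
    next
      case (Suc j)
      then have j: "j < length zs" using is'(2) by simp
      have "apply_mats ?T is (vec2 (of_int (a + zs ! j)) 1) = 0\<^sub>v 2" using is'(4) Suc TSuc[OF j] by simp
      then obtain ws where "set ws \<subseteq> set zs" "length ws \<le> n" "a + zs ! j + sum_list ws = 0"
        using Suc.IH[of "a + zs ! j"] is' by blast
      then show ?thesis using j by (intro exI[of _ "zs ! j # ws"]) auto
    qed
  next
    assume "\<exists>ws. set ws \<subseteq> set zs \<and> length ws \<le> Suc n \<and> a + sum_list ws = 0"
    then obtain ws where ws: "set ws \<subseteq> set zs" "length ws \<le> Suc n" "a + sum_list ws = 0" by blast
    show "\<exists>is. length is = Suc (Suc n) \<and> set is \<subseteq> {..length zs} \<and> apply_mats ?T is (vec2 (of_int a) 1) = 0\<^sub>v 2"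
    proof (cases ws)
      case Nil
      \<comment> \<open>Surplus positions are filled with the projection, which changes nothing
        after its first application.\<close>
      then have "apply_mats ?T (0 # replicate (Suc n) 0) (vec2 (of_int a) 1) = 0\<^sub>v 2"
        using ws by (simp only: apply_mats_Cons T0) (subst apply_shear_mats_0, auto simp: vec2_eq_0_iff)
      then show ?thesis by (intro exI[of _ "0 # replicate (Suc n) 0"]) auto
    next
      case (Cons w ws')
      then obtain j where j: "j < length zs" "zs ! j = w" using ws(1) by (auto simp: in_set_conv_nth)
      have "set ws' \<subseteq> set zs \<and> length ws' \<le> n \<and> (a + zs ! j) + sum_list ws' = 0"
        using ws Cons j by auto
      then obtain "is" where "length is = Suc n" "set is \<subseteq> {..length zs}"
        "apply_mats ?T is (vec2 (of_int (a + zs ! j)) 1) = 0\<^sub>v 2"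
        using Suc.IH[of "a + zs ! j"] by blast
      then show ?thesis using j TSuc[OF j(1)] by (intro exI[of _ "Suc j # is"]) (simp add: apply_mats_Cons)
    qed
  qed
qed

lemma vest_count_shear_mats:
  "0 < vest_count (vec2 1 1) (shear_mats zs) (1\<^sub>m 2) (Suc n) \<longleftrightarrow>
    (\<exists>ws. set ws \<subseteq> set zs \<and> length ws \<le> n \<and> 1 + sum_list ws = 0)"
proof -
  have len: "length (shear_mats zs) = Suc (length zs)" by (simp add: shear_mats_def)
  \<comment> \<open>Dimension 2 is needed for the identity matrix to fix the resulting
    vector.\<close>
  have dim: "apply_mats (shear_mats zs) is w \<in> carrier_vec 2"
    if "set is \<subseteq> {..length zs}" "w \<in> carrier_vec 2" for "is" w
    using that
  proof (induction "is" arbitrary: w)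
    case (Cons i "is")
    have "shear_mats zs ! i \<in> carrier_mat 2 2"
      using Cons.prems by (cases i) (auto simp: shear_mats_def shear_def mat2_def)
    then show ?case using Cons by (auto simp: apply_mats_Cons)
  qed (simp add: apply_mats_def)
  have fin: "finite {is. length is = Suc n \<and> set is \<subseteq> {..<length (shear_mats zs)} \<and>
      1\<^sub>m 2 *\<^sub>v apply_mats (shear_mats zs) is (vec2 1 1) = 0\<^sub>v (dim_row (1\<^sub>m 2 :: rat mat))}"
    by (rule finite_subset[OF _ finite_lists_length_eq[of "{..<length (shear_mats zs)}" "Suc n"]]) auto
  have "0 < vest_count (vec2 1 1) (shear_mats zs) (1\<^sub>m 2) (Suc n) \<longleftrightarrow>
    (\<exists>is. length is = Suc n \<and> set is \<subseteq> {..length zs} \<and> apply_mats (shear_mats zs) is (vec2 1 1) = 0\<^sub>v 2)"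
    unfolding vest_count_def card_gt_0_iff using fin dim[of _ "vec2 1 1"]
    by (auto simp: len lessThan_Suc_atMost vec2_def)
  then show ?thesis using apply_shear_mats_eq_0[of n zs 1] by simp
qed

lemma vest_instance_shear_mats:
  "vest_instance 2 (Suc (length zs)) 2 (vec2 1 1) (shear_mats zs) (1\<^sub>m 2)"
  by (auto simp: vest_instance_def shear_mats_def shear_def mat2_def vec2_def)

lemma shear_mats_integral: "T \<in> set (shear_mats zs) \<Longrightarrow> elements_mat T \<subseteq> \<int>"
  by (auto simp: shear_mats_def shear_def mat2_def elements_mat_def)


section \<open>Encoding of the instances\<close>

lemma bits_0 [simp]: "bits 0 = []"
  by (subst bits.simps) simp

lemma bits_pos: "0 < n \<Longrightarrow> bits n = odd n # bits (n div 2)"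
  by (subst bits.simps) simp

lemma bits_eq_Nil_iff [simp]: "bits n = [] \<longleftrightarrow> n = 0"
  by (cases "n = 0") (auto simp: bits_pos)

lemma bits_inject: "bits m = bits n \<Longrightarrow> m = n"
proof (induction m arbitrary: n rule: less_induct)
  case (less m)
  show ?case
  proof (cases "m = 0")
    case False
    with less.prems have "n \<noteq> 0" by (metis bits_eq_Nil_iff)
    then have "odd m = odd n" "bits (m div 2) = bits (n div 2)"
      using less.prems False by (auto simp: bits_pos)
    moreover from this have "m div 2 = n div 2" using less.IH[of "m div 2"] False by simp
    ultimately show ?thesis by (metis even_two_times_div_two odd_two_times_div_two_succ)
  qed (use less.prems in \<open>metis bits_eq_Nil_iff\<close>)
qed

lemma enc_binary_encode: "enc_binary n = encode (bits n)"
  by (simp add: enc_binary_def encode_list_def encode_bool_def)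

lemma enc_int_inject: "enc_int y = enc_int z \<Longrightarrow> y = z"
  by (auto simp: enc_int_def enc_binary_encode enc_bool_def split: if_splits dest!: bits_inject)

lemma enc_rat_inject: "enc_rat p = enc_rat q \<Longrightarrow> p = q"
  unfolding enc_rat_def by (auto dest!: enc_int_inject intro: quotient_of_inject simp: prod_eq_iff)

lemma map_inject: "(\<And>x y. f x = f y \<Longrightarrow> x = y) \<Longrightarrow> map f xs = map f ys \<Longrightarrow> xs = ys"
  by (metis injI inj_map_eq_map)

lemma enc_vec_inject: "enc_vec v = enc_vec w \<Longrightarrow> v = w"
  unfolding enc_vec_def enc_list_inject by (metis enc_rat_inject map_inject vec_list)

text \<open>A matrix without rows is encoded as \<open>Atom\<close> whatever its number of columns,
  hence the second hypothesis. In a VEST instance that number is the dimension of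
  \<open>v\<close>.\<close>

lemma enc_mat_inject: "enc_mat A = enc_mat B \<Longrightarrow> dim_col A = dim_col B \<Longrightarrow> A = B"
  unfolding enc_mat_def enc_list_inject by (metis enc_vec_inject map_inject mat_of_rows_rows)

lemma enc_vest_inject:
  assumes "vest_instance d m h v Ts S" "vest_instance d' m' h' v' Ts' S'"
    and "enc_vest v Ts S = enc_vest v' Ts' S'"
  shows "v = v' \<and> Ts = Ts' \<and> S = S'"
proof -
  have eq: "enc_vec v = enc_vec v'" "map enc_mat Ts = map enc_mat Ts'" "enc_mat S = enc_mat S'"
    using assms(3) by (auto simp: enc_vest_def)
  have v: "v = v'" using eq(1) by (rule enc_vec_inject)
  then have d: "d = d'" using assms(1,2) by (auto simp: vest_instance_def dest!: carrier_vecD)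
  have "S = S'" using assms(1,2) eq(3) d by (intro enc_mat_inject) (auto simp: vest_instance_def)
  moreover have "Ts = Ts'"
  proof (rule nth_equalityI)
    show len: "length Ts = length Ts'" using eq(2) by (rule map_eq_imp_length_eq)
    fix i
    assume i: "i < length Ts"
    then have "Ts ! i \<in> carrier_mat d d" "Ts' ! i \<in> carrier_mat d d"
      using assms(1,2) d len by (auto simp: vest_instance_def subset_iff)
    moreover have "enc_mat (Ts ! i) = enc_mat (Ts' ! i)" using eq(2) i len by (metis nth_map)
    ultimately show "Ts ! i = Ts' ! i" by (intro enc_mat_inject) auto
  qed
  ultimately show ?thesis using v by simp
qed

lemma enc_vest_in_VEST_iff:
  assumes "vest_instance d m h v Ts S"
  shows "(enc_vest v Ts S, k) \<in> VEST_decision \<longleftrightarrow> 0 < vest_count v Ts S k"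
proof
  assume "(enc_vest v Ts S, k) \<in> VEST_decision"
  then obtain d' m' h' v' Ts' S' where *: "enc_vest v Ts S = enc_vest v' Ts' S'"
    "vest_instance d' m' h' v' Ts' S'" "0 < vest_count v' Ts' S' k"
    unfolding VEST_decision_def by blast
  from enc_vest_inject[OF assms *(2,1)] *(3) show "0 < vest_count v Ts S k" by simp
next
  show "0 < vest_count v Ts S k \<Longrightarrow> (enc_vest v Ts S, k) \<in> VEST_decision"
    using assms unfolding VEST_decision_def by blast
qed

lemma enc_vec_vec2: "enc_vec (vec2 a b) = encode [enc_rat a, enc_rat b]"
  by (simp add: enc_vec_def vec2_def numeral_2_eq_2 list_of_vec_vec)

lemma enc_mat_mat2: "enc_mat (mat2 a b c d) = encode [[enc_rat a, enc_rat b], [enc_rat c, enc_rat d]]"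
proof -
  have "rows (mat2 a b c d) = [vec2 a b, vec2 c d]"
    unfolding rows_def by (auto simp: mat2_def vec2_def numeral_2_eq_2 intro!: eq_vecI)
  then show ?thesis by (simp add: enc_mat_def enc_vec_vec2)
qed

lemma enc_rat_of_int: "enc_rat (of_int z) = data.Pair (enc_int z) (enc_int 1)"
  by (simp add: enc_rat_def)


section \<open>The reduction runs in polynomial time\<close>

lemma polytime_slots: "polytime k \<Longrightarrow> polytime (\<lambda>e. slots (k e))"
  unfolding slots_def by (intro polytime_intros)

lemma polytime_cands: "polytime I \<Longrightarrow> polytime (\<lambda>e. cands (I e))"
  unfolding cands_def by (intro polytime_intros)

lemma polytime_slot_tuples: "polytime k \<Longrightarrow> polytime (\<lambda>e. slot_tuples D (k e))"
  unfolding slot_tuples_def by (intro polytime_intros polytime_slots)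

lemma polytime_compat: "polytime \<rho> \<Longrightarrow> polytime (\<lambda>e. compat (\<rho> e))"
proof (rule polytime_comp[where f = compat])
  show "polytime compat" unfolding compat_def by (intro polytime_intros)
qed

lemma polytime_assignments: "polytime k \<Longrightarrow> polytime I \<Longrightarrow> polytime (\<lambda>e. assignments D (k e) (I e))"
  unfolding assignments_def by (intro polytime_intros polytime_compat polytime_slots polytime_cands)

lemma polytime_pad: "polytime \<mu> \<Longrightarrow> polytime (\<lambda>e. pad D (\<mu> e))"
  unfolding pad_def by (intro polytime_intros)

lemma polytime_constraint:
  "polytime Z \<Longrightarrow> polytime s \<Longrightarrow> polytime r \<Longrightarrow> polytime (\<lambda>e. constraint (Z e) (s e) (r e))"
  unfolding constraint_def by (intro polytime_intros)

lemma polytime_keys: "polytime k \<Longrightarrow> polytime Z \<Longrightarrow> polytime (\<lambda>e. keys D (k e) (Z e))"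
proof (rule polytime_app2[where f = "keys D"])
  show "polytime (\<lambda>p. keys D (fst p) (snd p))"
    unfolding keys_def by (intro polytime_intros polytime_slots polytime_slot_tuples)
qed

text \<open>The type \<open>elem\<close> has no encoding of its own, so each constructor is treated
  through its arguments, and the pattern of the key is expanded into projections.\<close>

lemma polytime_entry_Main:
  assumes "polytime I" "polytime Z" "polytime s" "polytime y"
  shows "polytime (\<lambda>e. entry D (I e) (Z e) (Main (s e)) (y e))"
proof -
  have eq: "entry D I Z (Main s) y =
    (if fst y = 0 then 1
     else if fst y = 1 \<or> fst y = 2 then (if s = fst (snd y) then 1 else 0)
     else if fst y = 3 then (if s = fst (snd y) then sum_list (cands I) else 0)
     else (if s = fst (snd y) then snd (constraint Z s (snd (snd (snd y)))) else 0))" for I Z s y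
    by (cases y) simp
  show ?thesis unfolding eq
    by (intro polytime_intros polytime_cands polytime_constraint assms)
qed

lemma polytime_entry_Slot:
  assumes "polytime I" "polytime Z" "polytime s" "polytime a" "polytime x" "polytime y"
  shows "polytime (\<lambda>e. entry D (I e) (Z e) (Slot (s e) (a e) (x e)) (y e))"
proof -
  have eq: "entry D I Z (Slot s a x) y =
    (if fst y = 1 then (if s = fst (snd y) \<and> a = snd (snd (snd y)) then 1 else 0)
     else if fst y = 3 then (if s = fst (snd y) \<and> a = lookup 0 (fst (snd (snd y))) (snd (snd (snd y))) then x else 0)
     else 0)" for I Z s a x y
    by (cases y) simp
  show ?thesis unfolding eq by (intro polytime_intros assms)
qed

lemma polytime_entry_Tup:
  assumes "polytime I" "polytime Z" "polytime s" "polytime \<rho>" "polytime y"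
  shows "polytime (\<lambda>e. entry D (I e) (Z e) (Tup (s e) (\<rho> e)) (y e))"
proof -
  let ?count = "\<lambda>L \<rho>. length (filter (\<lambda>\<mu>. pad D \<mu> = map snd \<rho>) L)"
  have eq: "entry D I Z (Tup s \<rho>) y =
    (if fst y = 2 then (if s = fst (snd y) \<and> map fst \<rho> = fst (snd (snd y)) then 1 else 0)
     else if fst y = 3 then (if s = fst (snd y) \<and> map fst \<rho> = fst (snd (snd y))
       then sum_list (cands I) - lookup 0 (map snd \<rho>) (snd (snd (snd y))) else 0)
     else if fst y = 4 then (if s = fst (snd y) then ?count (fst (constraint Z s (snd (snd (snd y))))) \<rho> else 0)
     else 0)" for I Z s \<rho> y
    by (cases y) simp
  have count: "polytime (\<lambda>p. ?count (fst p) (snd p))"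
    by (intro polytime_intros polytime_pad)
  show ?thesis unfolding eq
    by (intro polytime_intros polytime_cands polytime_constraint polytime_app2[where f = ?count, OF count] assms)
qed

lemma polytime_solution_length: "polytime k \<Longrightarrow> polytime (\<lambda>e. solution_length D (k e))"
proof -
  have eq: "solution_length D k = 1 + Suc k + length (slot_tuples D k)" for k
    by (simp add: solution_length_def slot_tuples_def length_n_lists slots_def)
  show "polytime k \<Longrightarrow> ?thesis" unfolding eq by (intro polytime_intros polytime_slot_tuples)
qed

text \<open>The digits of the integers, least significant first; the flag marks the negative ones.\<close>

definition digit_rows :: "nat \<Rightarrow> nat \<Rightarrow> nat list \<Rightarrow> cert list \<Rightarrow> (bool \<times> nat list) list" where
  "digit_rows D k I Z = concat (map (\<lambda>s.
     (True, map (\<lambda>y. entry D I Z (Main s) y) (keys D k Z)) #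
     map (\<lambda>q. (False, map (\<lambda>y. entry D I Z (Slot s (fst q) (snd q)) y) (keys D k Z)))
       (List.product (slots k) (cands I)) @
     map (\<lambda>\<rho>. (False, map (\<lambda>y. entry D I Z (Tup s \<rho>) y) (keys D k Z))) (assignments D k I)) [0..<length Z])"

lemma digit_rows_eq: "digit_rows D k I Z = map (\<lambda>e. (is_Main e, map (entry D I Z e) (keys D k Z))) (elems D k I Z)"
  by (simp add: digit_rows_def elems_def map_concat o_def)

lemma polytime_digit_rows:
  "polytime k \<Longrightarrow> polytime I \<Longrightarrow> polytime Z \<Longrightarrow> polytime (\<lambda>e. digit_rows D (k e) (I e) (Z e))"
proof (rule polytime_app3[where f = "digit_rows D"])
  show "polytime (\<lambda>p. digit_rows D (fst p) (fst (snd p)) (snd (snd p)))"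
    unfolding digit_rows_def
    by (intro polytime_intros polytime_keys polytime_slots polytime_cands polytime_assignments
        polytime_entry_Main polytime_entry_Slot polytime_entry_Tup)
qed

lemma polytime_digit_width:
  assumes "polytime k" "polytime I" "polytime Z"
  shows "polytime (\<lambda>e. digit_width D (k e) (I e) (Z e))"
proof -
  have eq: "digit_width D k I Z = Suc (solution_length D k + sum_list (map (\<lambda>r. sum_list (snd r)) (digit_rows D k I Z)))" for k I Z
    by (simp add: digit_width_def total_entries_def digit_rows_eq o_def)
  show ?thesis unfolding eq
    by (intro polytime_intros polytime_solution_length polytime_digit_rows assms)
qed

subsection \<open>Binary expansions\<close>

text \<open>Binary numbers are computed by a sequence of doublings (\<open>False\<close>) and increments (\<open>True\<close>).\<close>

fun bit_inc :: "bool list \<Rightarrow> bool list" where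
  "bit_inc [] = [True]"
| "bit_inc (False # bs) = True # bs"
| "bit_inc (True # bs) = False # bit_inc bs"

lemma bits_Suc: "bits (Suc n) = bit_inc (bits n)"
proof (induction n rule: less_induct)
  case (less n)
  show ?case
  proof (cases "n = 0 \<or> even n")
    case True
    then show ?thesis by (cases "n = 0") (auto simp: bits_pos)
  next
    case False
    then obtain m where m: "n = Suc (2 * m)" by (auto elim: oddE)
    then have "bits (Suc m) = bit_inc (bits m)" using less.IH[of m] by simp
    then show ?thesis using m bits_pos[of "Suc n"] bits_pos[of n] by simp
  qed
qed

lemma bits_double: "bits (2 * n) = (case bits n of [] \<Rightarrow> [] | b # bs \<Rightarrow> False # b # bs)"
  by (cases "n = 0") (auto simp: bits_pos)

definition bit_step :: "bool list \<Rightarrow> bool \<Rightarrow> bool list" where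
  "bit_step bs q = (if q then bit_inc bs else (case bs of [] \<Rightarrow> [] | b # bs' \<Rightarrow> False # b # bs'))"

text \<open>Horner's scheme from the most significant digit on: \<open>w\<close> doublings, then
  \<open>d\<close> increments. The list is short because \<open>w\<close> and the digits are
  unary.\<close>

definition digit_steps :: "nat \<Rightarrow> nat list \<Rightarrow> bool list" where
  "digit_steps w ds = concat (map (\<lambda>d. replicate w False @ replicate d True) (rev ds))"

lemma foldl_bit_step_double: "foldl bit_step (bits n) (replicate w False) = bits (2 ^ w * n)"
  by (induction w arbitrary: n) (simp_all add: bit_step_def bits_double[symmetric] mult.assoc[symmetric] mult.commute)

lemma foldl_bit_step_inc: "foldl bit_step (bits n) (replicate d True) = bits (d + n)"
  by (induction d arbitrary: n) (simp_all add: bit_step_def bits_Suc[symmetric])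

lemma foldl_digit_steps: "foldl bit_step [] (digit_steps w ds) = bits (horner w ds)"
proof (induction ds)
  case (Cons d ds)
  then show ?case
    by (simp add: digit_steps_def foldl_bit_step_double foldl_bit_step_inc)
qed (simp add: digit_steps_def)

lemma length_bit_inc: "length (bit_inc bs) \<le> Suc (length bs)"
  by (induction bs rule: bit_inc.induct) auto

lemma dsize_bool_list: "dsize (encode (bs :: bool list)) \<le> 1 + length bs * 4"
proof -
  have "dsize (encode b) \<le> 3" for b :: bool by (cases b) auto
  then show ?thesis using dsize_list_le[of bs 3] by simp
qed

lemma polytime_bit_inc: "polytime bs \<Longrightarrow> polytime (\<lambda>e. bit_inc (bs e))"
proof (rule polytime_comp[where f = bit_inc])
  \<comment> \<open>The state is the pending carry and the bits already produced, in reverse; under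
    a carry a bit is flipped and its old value is the new carry.\<close>
  define step :: "bool \<times> bool list \<Rightarrow> bool \<Rightarrow> bool \<times> bool list" where
    "step p b = (if fst p then (b, (\<not> b) # snd p) else (False, b # snd p))" for p b
  define out :: "bool \<times> bool list \<Rightarrow> bool list" where
    "out p = rev (if fst p then True # snd p else snd p)" for p
  have step: "step (c, os) b = (if c then (b, (\<not> b) # os) else (False, b # os))" for c os b
    by (simp add: step_def)
  have eq: "out (foldl step (c, os) bs) = rev os @ (if c then bit_inc bs else bs)" for c os bs
  proof (induction bs arbitrary: c os)
    case (Cons b bs)
    show ?case by (cases b; cases c) (simp_all add: step Cons)
  qed (simp add: out_def)
  have len: "length (snd (foldl step p bs)) = length (snd p) + length bs" for p bs
  proof (induction bs arbitrary: p)
    case (Cons b bs)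
    show ?case by (cases p) (simp add: step Cons)
  qed simp
  have run: "polytime (\<lambda>bs. foldl step (True, []) bs)"
  proof (rule polytime_foldl[where q = "\<lambda>n. 5 + n * 4"])
    fix bs :: "bool list" and i
    let ?p = "foldl step (True, []) (take i bs)"
    have "dsize (encode (snd ?p)) \<le> 1 + length (snd ?p) * 4" by (rule dsize_bool_list)
    moreover have "length (snd ?p) \<le> length bs" by (simp add: len)
    moreover have "dsize (encode (fst ?p)) \<le> 3" by (cases "fst ?p") auto
    moreover have "dsize (encode ?p) = Suc (dsize (encode (fst ?p)) + dsize (encode (snd ?p)))"
      by (simp add: encode_prod_def)
    ultimately show "dsize (encode ?p) \<le> 5 + dsize (encode bs) * 4"
      using length_le_dsize[of bs] by linarith
  next
    show "polytime (\<lambda>p :: bool list \<times> (bool \<times> bool list) \<times> bool. step (fst (snd p)) (snd (snd p)))"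
      unfolding step_def by (intro polytime_intros)
  qed (intro polytime_intros pb_intros)+
  have "polytime out" unfolding out_def by (intro polytime_intros)
  from polytime_comp[OF this run] show "polytime bit_inc" by (simp add: eq)
qed

text \<open>The value is exponential in \<open>w\<close> and cannot be held in unary. Each step
  lengthens the bit list by at most one, which bounds all accumulators.\<close>

lemma polytime_bits_of_digits:
  assumes "polytime w" "polytime ds"
  shows "polytime (\<lambda>e. bits (horner (w e) (ds e)))"
proof -
  have len: "length (foldl bit_step bs qs) \<le> length bs + length qs" for bs qs
  proof (induction qs arbitrary: bs)
    case (Cons q qs)
    have "length (bit_step bs q) \<le> Suc (length bs)"
      using length_bit_inc[of bs] by (auto simp: bit_step_def split: list.split)
    then show ?case using Cons[of "bit_step bs q"] by simp
  qed simp
  have run: "polytime (\<lambda>qs. foldl bit_step [] qs)"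
  proof (rule polytime_foldl[where q = "\<lambda>n. 1 + n * 4"])
    fix qs :: "bool list" and i
    have "dsize (encode (foldl bit_step [] (take i qs))) \<le> 1 + length (foldl bit_step [] (take i qs)) * 4"
      by (rule dsize_bool_list)
    also have "length (foldl bit_step [] (take i qs)) \<le> dsize (encode qs)"
      using len[of "[]" "take i qs"] length_le_dsize[of qs] by simp
    finally show "dsize (encode (foldl bit_step [] (take i qs))) \<le> 1 + dsize (encode qs) * 4" by simp
  next
    show "polytime (\<lambda>p :: bool list \<times> bool list \<times> bool. bit_step (fst (snd p)) (snd (snd p)))"
      unfolding bit_step_def by (intro polytime_intros polytime_bit_inc)
  qed (intro polytime_intros pb_intros)+
  have "polytime (\<lambda>p. digit_steps (fst p) (snd p))"
    unfolding digit_steps_def by (intro polytime_intros)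
  from polytime_comp[OF run polytime_app2[OF this assms]]
  show ?thesis by (simp add: foldl_digit_steps)
qed

subsection \<open>The instance\<close>

definition reduction :: "nat \<Rightarrow> data \<times> nat \<Rightarrow> data \<times> nat" where
  "reduction n p =
    (enc_vest (vec2 1 1)
       (shear_mats (target_ints (2 ^ n) (snd p) (input_list (fst p)) (circuit_certs n (fst p)))) (1\<^sub>m 2),
     Suc (solution_length (2 ^ n) (snd p)))"

text \<open>The extra condition suppresses the sign of zero, because \<open>enc_int 0\<close>
  carries the flag \<open>False\<close>.\<close>

definition int_data :: "nat \<Rightarrow> bool \<times> nat list \<Rightarrow> data" where
  "int_data w r = data.Pair (encode (fst r \<and> \<not> bits (horner w (snd r)) = [])) (encode (bits (horner w (snd r))))"

lemma int_data_eq: "int_data w r = enc_int ((if fst r then -1 else 1) * int (horner w (snd r)))"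
  by (auto simp: int_data_def enc_int_def enc_binary_encode encode_bool_def)

lemma target_ints_data:
  "map enc_int (target_ints D k I Z) = map (int_data (digit_width D k I Z)) (digit_rows D k I Z)"
  by (simp add: target_ints_def digit_rows_eq int_data_eq elem_value_def)

lemma enc_mat_shear:
  "enc_mat (shear z) = encode [[enc_rat 1, data.Pair (enc_int z) (enc_int 1)], [enc_rat 0, enc_rat 1]]"
  unfolding shear_def enc_mat_mat2 enc_rat_of_int ..

text \<open>Isolates the integers as the only varying part of the list of matrices, so that their
  binary codes can be inserted directly.\<close>

lemma enc_vest_shear_mats:
  "enc_vest v (shear_mats zs) S = data.Pair (enc_vec v) (data.Pair (encode (enc_mat (mat2 1 0 0 0) #
     map (\<lambda>d. encode [[enc_rat 1, data.Pair d (enc_int 1)], [enc_rat 0, enc_rat 1]]) (map enc_int zs))) (enc_mat S))"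
proof -
  have "enc_list ds = encode ds" for ds :: "data list" by (simp add: encode_list_def map_idI)
  then show ?thesis by (simp add: enc_vest_def shear_mats_def enc_mat_shear o_def)
qed

lemma polytime_reduction: "polytime (reduction n)"
proof -
  have int_data: "polytime (\<lambda>p. int_data (fst p) (snd p))"
    unfolding int_data_def by (intro polytime_intros polytime_bits_of_digits)
  show ?thesis
    unfolding reduction_def enc_vest_shear_mats target_ints_data
    by (intro polytime_intros polytime_app2[where f = int_data, OF int_data] polytime_digit_width polytime_digit_rows
        polytime_input_list polytime_circuit_certs polytime_solution_length)
qed

lemma reduction_correct:
  assumes "1 \<le> n"
  shows "(x, k) \<in> WCS 1 n \<longleftrightarrow> reduction n (x, k) \<in> VEST_decision"
proof -
  have D: "2 \<le> (2::nat) ^ n" using power_increasing[OF assms, of "2::nat"] by simp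
  let ?Z = "circuit_certs n x"
  have "reduction n (x, k) \<in> VEST_decision \<longleftrightarrow> (\<exists>z\<in>set ?Z. \<exists>X\<subseteq>set (input_list x). card X = k \<and> sat X z)"
    unfolding reduction_def fst_conv snd_conv enc_vest_in_VEST_iff[OF vest_instance_shear_mats] vest_count_shear_mats
    by (rule target_ints_iff[OF D]) (rule circuit_certs_bounded)
  then show ?thesis using WCS_iff_certs by simp
qed

lemma reduction_in_VEST_2x2_int_id: "reduction n (x, k) \<in> VEST_2x2_int_id"
  unfolding reduction_def VEST_2x2_int_id_def
  using vest_instance_shear_mats shear_mats_integral by fastforce


section \<open>Composition with arbitrary programs\<close>

primrec expr_vars :: "expr \<Rightarrow> nat set" where
  "expr_vars ENil = {}"
| "expr_vars (EVar x) = {x}"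
| "expr_vars (ECons x y) = {x, y}"
| "expr_vars (EHd x) = {x}"
| "expr_vars (ETl x) = {x}"

primrec prog_vars :: "prog \<Rightarrow> nat set" where
  "prog_vars Skip = {}"
| "prog_vars (Assign x e) = insert x (expr_vars e)"
| "prog_vars (Seq c d) = prog_vars c \<union> prog_vars d"
| "prog_vars (If x c d) = insert x (prog_vars c \<union> prog_vars d)"
| "prog_vars (While x c) = insert x (prog_vars c)"

lemma finite_prog_vars: "finite (prog_vars c)"
proof -
  have "finite (expr_vars e)" for e by (cases e) auto
  then show ?thesis by (induction c) auto
qed

lemma prog_vars_bound: obtains N where "0 < N" "prog_vars c \<subseteq> {..<N}"
proof -
  obtain M where "\<forall>x\<in>prog_vars c. x < M"
    using finite_prog_vars finite_nat_set_iff_bounded by blast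
  then show ?thesis by (intro that[of "Suc M"]) (auto simp: less_SucI)
qed

definition join_store :: "nat \<Rightarrow> store \<Rightarrow> store \<Rightarrow> store" where
  "join_store N s r = (\<lambda>i. if i < N then s i else r i)"

text \<open>A program neither reads nor writes variables outside \<open>prog_vars\<close>, so data
  may be parked there during its run.\<close>

lemma exec_join_store:
  "exec c s t s' \<Longrightarrow> prog_vars c \<subseteq> {..<N} \<Longrightarrow> exec c (join_store N s r) t (join_store N s' r)"
proof (induction rule: exec.induct)
  case (exec_Skip s)
  show ?case by (rule exec.exec_Skip)
next
  case (exec_Assign x e s)
  have "eval_expr (join_store N s r) e = eval_expr s e"
    using exec_Assign by (cases e) (auto simp: join_store_def)
  moreover have "join_store N (s(x := d)) r = (join_store N s r)(x := d)" for d
    using exec_Assign by (auto simp: join_store_def)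
  ultimately show ?case by (intro exec_AssignI) (simp_all only:)
next
  case (exec_IfT s x c t s' c')
  then show ?case by (intro exec.exec_IfT) (auto simp: join_store_def)
next
  case (exec_IfF s x c' t s' c)
  then show ?case by (intro exec.exec_IfF) (auto simp: join_store_def)
next
  case (exec_WhileT s x c t s' t' s'')
  then show ?case by (intro exec.exec_WhileT) (auto simp: join_store_def)
next
  case (exec_WhileF s x c)
  then show ?case by (intro exec.exec_WhileF) (auto simp: join_store_def)
qed (auto intro: exec.intros)

lemma exec_unused: "exec c s t s' \<Longrightarrow> i \<notin> prog_vars c \<Longrightarrow> s' i = s i"
  by (induction rule: exec.induct) auto

primrec clear :: "nat \<Rightarrow> prog" where
  "clear 0 = Skip"
| "clear (Suc n) = Seq (clear n) (Assign (Suc n) ENil)"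

lemma exec_clear: "exec (clear n) s (1 + 2 * n) (\<lambda>i. if 1 \<le> i \<and> i \<le> n then Atom else s i)"
proof (induction n)
  case 0
  have "(\<lambda>i. if 1 \<le> i \<and> i \<le> 0 then Atom else s i) = s" by auto
  then show ?case using exec_Skip[of s] by simp
next
  case (Suc n)
  have "exec (clear (Suc n)) s (1 + 2 * n + 2) (\<lambda>i. if 1 \<le> i \<and> i \<le> Suc n then Atom else s i)"
    unfolding clear.simps
    by (rule exec_Seq[OF Suc exec_AssignI]) (auto simp: fun_eq_iff le_Suc_eq)
  then show ?case by simp
qed

text \<open>The arbitrary program \<open>c\<close> may leave garbage in its finitely many variables,
  whereas \<open>P 0\<close> expects empty ones; clearing them in between costs a constant.\<close>

lemma runs_then_polytime:
  fixes f :: "'a::encodable \<Rightarrow> 'b::encodable"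
  assumes "polytime f"
  obtains d a p where "pb p"
    "\<And>x t y. runs c x t (encode y) \<Longrightarrow> \<exists>t'. t' \<le> t + a + p (dsize x + t) \<and> runs d x t' (encode (f y))"
proof -
  obtain P p where p: "pb p" "implements P p f" using assms by (rule polytimeE)
  obtain N where N: "0 < N" "prog_vars c \<subseteq> {..<N}" by (rule prog_vars_bound)
  show ?thesis
  proof (rule that[of p "1 + 2 * N" "Seq c (Seq (clear N) (P 0))"])
    fix x t and y :: 'a
    assume "runs c x t (encode y)"
    then obtain s where s: "exec c ((\<lambda>_. Atom)(0 := x)) t s" "s 0 = encode y" by (auto simp: runs_def)
    let ?s = "(\<lambda>_. Atom)(0 := encode y)"
    have "s i = Atom" if "N < i" for i
    proof -
      have "i \<notin> prog_vars c" using N(2) that by auto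
      from exec_unused[OF s(1) this] show ?thesis using that by simp
    qed
    then have "(\<lambda>i. if 1 \<le> i \<and> i \<le> N then Atom else s i) = ?s"
      using s(2) by (auto simp: fun_eq_iff not_le)
    then have clear: "exec (clear N) s (1 + 2 * N) ?s" using exec_clear[of N s] by simp
    obtain u where u: "u \<le> p (dsize (encode y))" "exec (P 0) ?s u (?s(0 := encode (f y)))"
      using implementsD[OF p(2), of 0 ?s y] by auto
    have "dsize (encode y) \<le> dsize x + t" using exec_dsize[OF s(1), of 0] s(2) by auto
    then have "u \<le> p (dsize x + t)" using u(1) pb_mono[OF p(1)] le_trans by blast
    moreover have "exec (Seq c (Seq (clear N) (P 0))) ((\<lambda>_. Atom)(0 := x)) (t + (1 + 2 * N + u)) (?s(0 := encode (f y)))"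
      by (intro exec_Seq[OF s(1)] exec_Seq[OF clear u(2)])
    ultimately show "\<exists>t'. t' \<le> t + (1 + 2 * N) + p (dsize x + t) \<and> runs (Seq c (Seq (clear N) (P 0))) x t' (encode (f y))"
      unfolding runs_def by (intro exI[of _ "t + (1 + 2 * N + u)"]) auto
  qed (rule p(1))
qed

text \<open>The argument \<open>n\<close> is needed again after \<open>c\<close> has overwritten it,
  so a copy is kept in variable \<open>N\<close>, which does not occur in \<open>c\<close>.\<close>

lemma computable_polytime:
  assumes f: "computable f" and h: "polytime (\<lambda>p. h (fst p) (snd p))"
  shows "computable (\<lambda>n. h n (f n))"
proof -
  obtain c where c: "\<And>n. \<exists>t. runs c (encode n) t (encode (f n))"
    using f unfolding computable_def encode_nat_def by blast
  obtain P p where p: "implements P p (\<lambda>p. h (fst p) (snd p))" using h by (rule polytimeE)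
  obtain N where N: "0 < N" "prog_vars c \<subseteq> {..<N}" by (rule prog_vars_bound)
  let ?c = "Seq (Assign N (EVar 0)) (Seq c (Seq (clear (N - 1)) (Seq (Assign 0 (ECons N 0)) (Seq (Assign N ENil) (P 0)))))"
  have "\<exists>t. runs ?c (encode n) t (encode (h n (f n)))" for n
  proof -
    obtain t s where s: "exec c ((\<lambda>_. Atom)(0 := encode n)) t s" "s 0 = encode (f n)"
      using c[of n] by (auto simp: runs_def)
    let ?r = "(\<lambda>_. Atom)(N := encode n)"
    let ?s0 = "(\<lambda>_. Atom)(0 := encode n)"
    let ?s1 = "(\<lambda>_. Atom)(0 := encode (f n), N := encode n)"
    let ?s2 = "(\<lambda>_. Atom)(0 := encode (n, f n), N := encode n)"
    let ?s3 = "(\<lambda>_. Atom)(0 := encode (n, f n))"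
    have "join_store N ?s0 ?r = ?s0(N := encode n)" using N by (auto simp: join_store_def)
    then have 1: "exec c (?s0(N := encode n)) t (join_store N s ?r)"
      using exec_join_store[OF s(1) N(2), of ?r] by simp
    have "(\<lambda>i. if 1 \<le> i \<and> i \<le> N - 1 then Atom else join_store N s ?r i) = ?s1"
      using N s(2) by (auto simp: join_store_def fun_eq_iff)
    then have 2: "exec (clear (N - 1)) (join_store N s ?r) (1 + 2 * (N - 1)) ?s1"
      using exec_clear[of "N - 1" "join_store N s ?r"] by simp
    obtain u where u: "exec (P 0) ?s3 u (?s3(0 := encode (h n (f n))))"
      using implementsD[OF p, of 0 ?s3 "(n, f n)"] by auto
    have "\<exists>t s'. exec ?c ?s0 t s' \<and> s' 0 = encode (h n (f n))"
      by (intro exI conjI, rule exec_Seq[OF exec_AssignI exec_Seq[OF 1[simplified] exec_Seq[OF 2 exec_Seq[where s' = ?s2, OF exec_AssignI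
        exec_Seq[where s' = ?s3, OF exec_AssignI u]]]]], use N in \<open>auto simp: fun_eq_iff\<close>)
    then show ?thesis unfolding runs_def .
  qed
  then show ?thesis unfolding computable_def encode_nat_def by blast
qed

lemma polytime_times:
  fixes m n :: "'a::encodable \<Rightarrow> nat"
  assumes "polytime m" "polytime n"
  shows "polytime (\<lambda>e. m e * n e)"
proof -
  have eq: "k * l = length (List.product (replicate k Atom) (replicate l Atom))" for k l :: nat by simp
  show ?thesis unfolding eq by (intro polytime_intros assms)
qed

lemma polytime_power:
  fixes m :: "'a::encodable \<Rightarrow> nat"
  shows "polytime m \<Longrightarrow> polytime (\<lambda>e. m e ^ n)"
  by (induction n) (simp_all add: polytime_const polytime_times)

lemma solution_length_mono: "k \<le> l \<Longrightarrow> solution_length D k \<le> solution_length D l"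
  by (simp add: solution_length_def add_mono power_mono)

text \<open>In \<open>4 + 2 * k + F\<close> the 1 beyond \<open>3 + 2 * k\<close> pays for
  \<open>X\<close>, and \<open>F\<close> pays for \<open>t\<close>. The exponent dominates both
  \<open>e\<close> and \<open>Suc e * d\<close>.\<close>

lemma fpt_bound:
  fixes X :: nat
  assumes X: "1 \<le> X" and t: "t \<le> F * X ^ e"
  shows "t + a + b * (2 + X + 2 * k + t + 1) ^ d \<le> (F + a + b * (4 + 2 * k + F) ^ d) * X ^ (Suc e * Suc d)"
proof -
  have mono: "X ^ i \<le> X ^ j" if "i \<le> j" for i j using X that by (simp add: power_increasing)
  have one: "1 \<le> X ^ i" for i using X by simp
  have "2 + X + 2 * k + t + 1 \<le> (3 + 2 * k) * X ^ Suc e + X ^ Suc e + F * X ^ Suc e"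
  proof -
    have "3 + 2 * k \<le> (3 + 2 * k) * X ^ Suc e" using one[of "Suc e"] by (metis mult.right_neutral mult_le_mono2)
    moreover have "X \<le> X ^ Suc e" using mono[of 1 "Suc e"] by simp
    moreover have "t \<le> F * X ^ Suc e" using t mono[of e "Suc e"] by (meson le_SucI le_refl le_trans mult_le_mono2)
    ultimately show ?thesis by linarith
  qed
  also have "\<dots> = (4 + 2 * k + F) * X ^ Suc e" by (simp add: algebra_simps)
  finally have "(2 + X + 2 * k + t + 1) ^ d \<le> (4 + 2 * k + F) ^ d * X ^ (Suc e * d)"
    by (metis power_mono power_mult power_mult_distrib zero_le)
  also have "\<dots> \<le> (4 + 2 * k + F) ^ d * X ^ (Suc e * Suc d)" by (intro mult_le_mono2 mono) simp
  finally have "b * (2 + X + 2 * k + t + 1) ^ d \<le> b * (4 + 2 * k + F) ^ d * X ^ (Suc e * Suc d)"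
    by (simp add: mult.assoc)
  moreover have "t \<le> F * X ^ (Suc e * Suc d)"
  proof -
    have "e \<le> Suc e * Suc d" by simp
    from le_trans[OF t mult_le_mono2[OF mono[OF this]]] show ?thesis .
  qed
  moreover have "a \<le> a * X ^ (Suc e * Suc d)" using one by (metis mult.right_neutral mult_le_mono2)
  ultimately show ?thesis unfolding distrib_right by linarith
qed

text \<open>The given reduction to \<open>WCS 1 n\<close> is followed by \<open>reduction n\<close>.
  Since \<open>n\<close> is fixed by \<open>A\<close>, the exponent of the second running time is a
  constant.\<close>

lemma VEST_2x2_hard: "W1_hard_on VEST_2x2_int_id VEST_decision"
  unfolding W1_hard_on_def
proof
  fix A
  assume "A \<in> W 1"
  then obtain n where n: "1 \<le> n" "fpt_reducible A (WCS 1 n)" by (auto simp: W_def)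
  from n(2) obtain c f g e where f: "computable f" and g: "computable g" and
    red: "\<forall>x k. \<exists>x' k' t. runs c (data.Pair x (enc_unary k)) t (data.Pair x' (enc_unary k')) \<and>
      t \<le> f k * dsize x ^ e \<and> k' \<le> g k \<and> ((x, k) \<in> A \<longleftrightarrow> (x', k') \<in> WCS 1 n) \<and> (x', k') \<in> (UNIV :: param_problem)"
    unfolding fpt_reducible_def fpt_reducible_within_def by (elim exE conjE)
  obtain d a p where p: "pb p" and d:
    "\<And>x t y. runs c x t (encode y) \<Longrightarrow> \<exists>t'. t' \<le> t + a + p (dsize x + t) \<and> runs d x t' (encode (reduction n y))"
    using runs_then_polytime[OF polytime_reduction] by metis
  obtain b q where bq: "\<And>m. p m \<le> b * (m + 1) ^ q" using pb_bound[OF p] by blast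
  define F where "F k = f k + a + b * (4 + 2 * k + f k) ^ q" for k
  define G where "G k = Suc (solution_length (2 ^ n) (g k))" for k
  have "computable F"
    unfolding F_def by (rule computable_polytime[OF f]) (intro polytime_intros polytime_times polytime_power)
  moreover have "computable G"
    unfolding G_def by (rule computable_polytime[OF g]) (intro polytime_intros polytime_solution_length)
  moreover have "\<exists>x'' k'' t'. runs d (data.Pair x (enc_unary k)) t' (data.Pair x'' (enc_unary k'')) \<and>
      t' \<le> F k * dsize x ^ (Suc e * Suc q) \<and> k'' \<le> G k \<and> ((x, k) \<in> A \<longleftrightarrow> (x'', k'') \<in> VEST_decision) \<and>
      (x'', k'') \<in> VEST_2x2_int_id" for x k
  proof -
    obtain x' k' t where r: "runs c (data.Pair x (enc_unary k)) t (encode (x', k'))" "t \<le> f k * dsize x ^ e"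
      "k' \<le> g k" "(x, k) \<in> A \<longleftrightarrow> (x', k') \<in> WCS 1 n"
      using red[rule_format, of x k] by (auto simp: encode_nat_def)
    obtain t' where t': "t' \<le> t + a + p (dsize (data.Pair x (enc_unary k)) + t)"
      "runs d (data.Pair x (enc_unary k)) t' (encode (reduction n (x', k')))"
      using d[OF r(1)] by blast
    have size: "dsize (data.Pair x (enc_unary k)) = 2 + dsize x + 2 * k"
      using dsize_encode_nat[of k] by (simp add: encode_nat_def del: dsize_encode_nat)
    have "t' \<le> t + a + b * (2 + dsize x + 2 * k + t + 1) ^ q"
      using t'(1) bq[of "2 + dsize x + 2 * k + t"] unfolding size by linarith
    also have "\<dots> \<le> F k * dsize x ^ (Suc e * Suc q)"
      unfolding F_def by (rule fpt_bound[OF _ r(2)]) (simp add: Suc_le_eq)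
    finally have bound: "t' \<le> F k * dsize x ^ (Suc e * Suc q)" .
    obtain x'' k'' where xk: "reduction n (x', k') = (x'', k'')" by (cases "reduction n (x', k')")
    have "k'' = Suc (solution_length (2 ^ n) k')" using xk by (simp add: reduction_def)
    then have "k'' \<le> G k" using solution_length_mono[OF r(3)] by (simp add: G_def)
    moreover have "(x, k) \<in> A \<longleftrightarrow> (x'', k'') \<in> VEST_decision"
      using r(4) reduction_correct[OF n(1)] xk by simp
    moreover have "(x'', k'') \<in> VEST_2x2_int_id" using reduction_in_VEST_2x2_int_id[of n x' k'] xk by simp
    ultimately show ?thesis using t'(2) bound xk by (auto simp: encode_nat_def)
  qed
  ultimately show "fpt_reducible_within VEST_2x2_int_id A VEST_decision"
    unfolding fpt_reducible_within_def by blast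
qed

theorem theorem8:
  shows "W1_hard VEST_decision \<and> W1_hard_on VEST_2x2_int_id VEST_decision"
proof
  show "W1_hard VEST_decision"
    using VEST_2x2_hard unfolding W1_hard_def W1_hard_on_def fpt_reducible_def fpt_reducible_within_def by fast
qed (rule VEST_2x2_hard)

end
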